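(* Let $\Gamma$ be a connected graph such that the flag complex $\Delta_\Gamma$ is simply connected. Then the following statements are equivalent. (1) $\Gamma$ is biconnected. (2) $\Sigma^1(BB_\Gamma)\neq\varnothing$. (3) $BB_\Gamma$ does not split as a free product. (4) $BB_\Gamma$ is $1$-ended. (5) $BB_\Gamma$ algebraically fibers.
   Context: All graphs are finite simplicial graphs. A graph is biconnected if it has no cut vertices, where a cut vertex is a vertex $v$ such that the full subgraph on $V(\Gamma)\setminus\{v\}$ is disconnected. The flag complex $\Delta_\Gamma$ is the simplicial complex whose simplices are the nonempty sets of pairwise adjacent vertices of $\Gamma$. The right-angled Artin group on $\Gamma$ is $A_\Gamma=\langle V(\Gamma)\mid [v,w] \text{ whenever } (v,w)\in E(\Gamma)\rangle$, and the Bestvina--Brady group $BB_\Gamma$ is the kernel of the homomorphism $A_\Gamma\to\mathbb Z$ sending every vertex generator to $1$; it is finitely generated when $\Gamma$ is connected. For a finitely generated group $G$, let $S(G)=\{[\chi]\mid \chi\in\operatorname{Hom}(G,\mathbb R)\setminus\{0\}\}$, where $[\chi]$ is the class of $\chi$ up to multiplication by positive reals. For a finite generating set $\mathcal S$, the BNS-invariant $\Sigma^1(G)\subseteq S(G)$ is the set of $[\chi]$ such that the full subgraph of the Cayley graph $\operatorname{Cay}(G,\mathcal S)$ spanned by $\{g\in G\mid\chi(g)\ge 0\}$ is connected (independent of $\mathcal S$). A finitely generated group $G$ algebraically fibers if there is a surjective homomorphism $G\to\mathbb Z$ whose kernel is finitely generated.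
   Formalization: The equivalence fails for a single vertex (trivial group) and for a single edge (BB = Z has two ends), so (1)⇔(3) is proved for all such graphs, (1)⇔(2) and (1)⇔(5) for at least two vertices, and (1)⇔(4) for at least three vertices. *)

theory Defs
  imports
    "HOL-Library.Extended_Nat"
    "HOL-Algebra.Elementary_Groups"
    "HOL-Analysis.Homotopy"
    "HOL-Analysis.Function_Topology"
    "Graph_Theory.Digraph_Component"
begin

section \<open>Graphs and flag complexes\<close>

text \<open>A finite simplicial graph is a \<open>pair_graph\<close>: a finite vertex set \<open>pverts\<close> and a symmetric,
  loop-free set \<open>parcs\<close> of ordered pairs, both orientations of an edge being present.\<close>

abbreviation graph_connected :: "'a pair_pre_digraph \<Rightarrow> bool" where
  "graph_connected G \<equiv> Digraph_Component.connected (with_proj G)"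

definition full_subgraph :: "'a pair_pre_digraph \<Rightarrow> 'a set \<Rightarrow> 'a pair_pre_digraph" where
  "full_subgraph G U = \<lparr>pverts = U, parcs = parcs G \<inter> (U \<times> U)\<rparr>"

text \<open>The library's \<open>connected\<close> is false for the graph without vertices, but that graph is not
  disconnected either: the only vertex of a one-vertex graph is not a cut vertex. Thus a single
  vertex and a single edge are biconnected; their Bestvina--Brady groups are trivial and infinite
  cyclic, hence not one-ended, and the trivial group has no nonzero character.\<close>

definition cut_vertex :: "'a pair_pre_digraph \<Rightarrow> 'a \<Rightarrow> bool" where
  "cut_vertex G v \<longleftrightarrow> v \<in> pverts G \<and> pverts G - {v} \<noteq> {} \<and>
     \<not> graph_connected (full_subgraph G (pverts G - {v}))"

definition biconnected :: "'a pair_pre_digraph \<Rightarrow> bool" where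
  "biconnected G \<longleftrightarrow> \<not> (\<exists>v. cut_vertex G v)"

definition flag_complex :: "'a pair_pre_digraph \<Rightarrow> 'a set set" where
  "flag_complex G = {\<sigma>. \<sigma> \<noteq> {} \<and> \<sigma> \<subseteq> pverts G \<and> (\<forall>v\<in>\<sigma>. \<forall>w\<in>\<sigma>. v \<noteq> w \<longrightarrow> (v, w) \<in> parcs G)}"

text \<open>Barycentric coordinates. The ambient topology is the product topology, which for a finite
  complex induces the usual topology on the realization.\<close>

definition geometric_realization :: "'a set set \<Rightarrow> ('a \<Rightarrow> real) set" where
  "geometric_realization K =
     {t. (\<forall>v. 0 \<le> t v) \<and> {v. t v \<noteq> 0} \<in> K \<and> (\<Sum>v | t v \<noteq> 0. t v) = 1}"


section \<open>Groups given by generators and relators\<close>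

text \<open>The letter \<open>(x, True)\<close> stands for the generator \<open>x\<close>, and \<open>(x, False)\<close> for its inverse.\<close>

type_synonym 'a gword = "('a \<times> bool) list"

definition gwords :: "'a set \<Rightarrow> 'a gword set" where
  "gwords X = lists (X \<times> UNIV)"

inductive pres_eq :: "'a set \<Rightarrow> 'a gword set \<Rightarrow> 'a gword \<Rightarrow> 'a gword \<Rightarrow> bool"
  for X :: "'a set" and R :: "'a gword set" where
  refl: "u \<in> gwords X \<Longrightarrow> pres_eq X R u u"
| sym: "pres_eq X R u v \<Longrightarrow> pres_eq X R v u"
| trans: "pres_eq X R u v \<Longrightarrow> pres_eq X R v w \<Longrightarrow> pres_eq X R u w"
| cancel: "u \<in> gwords X \<Longrightarrow> v \<in> gwords X \<Longrightarrow> x \<in> X \<Longrightarrow>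
    pres_eq X R (u @ [(x, b), (x, \<not> b)] @ v) (u @ v)"
| relator: "u \<in> gwords X \<Longrightarrow> v \<in> gwords X \<Longrightarrow> r \<in> R \<Longrightarrow> r \<in> gwords X \<Longrightarrow>
    pres_eq X R (u @ r @ v) (u @ v)"

definition pres_class :: "'a set \<Rightarrow> 'a gword set \<Rightarrow> 'a gword \<Rightarrow> 'a gword set" where
  "pres_class X R u = {v. pres_eq X R u v}"

definition presented_group :: "'a set \<Rightarrow> 'a gword set \<Rightarrow> 'a gword set monoid" where
  "presented_group X R =
     \<lparr>carrier = pres_class X R ` gwords X,
      monoid.mult = (\<lambda>A B. \<Union>u\<in>A. \<Union>v\<in>B. pres_class X R (u @ v)),
      one = pres_class X R []\<rparr>"

lemma gwords_Nil [simp]: "[] \<in> gwords X"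
  by (simp add: gwords_def)

lemma gwords_append [simp]: "u @ v \<in> gwords X \<longleftrightarrow> u \<in> gwords X \<and> v \<in> gwords X"
  by (simp add: gwords_def)

lemma gwords_Cons [simp]: "l # u \<in> gwords X \<longleftrightarrow> fst l \<in> X \<and> u \<in> gwords X"
  by (cases l) (auto simp: gwords_def)

lemma pres_eq_gwords:
  assumes "pres_eq X R u v"
  shows "u \<in> gwords X" "v \<in> gwords X"
  using assms by (induction rule: pres_eq.induct) auto

lemma pres_eq_context:
  assumes "pres_eq X R u v" "p \<in> gwords X" "q \<in> gwords X"
  shows "pres_eq X R (p @ u @ q) (p @ v @ q)"
  using assms
proof (induction rule: pres_eq.induct)
  case (refl u)
  then show ?case by (intro pres_eq.refl) simp
next
  case (sym u v)
  then show ?case by (simp add: pres_eq.sym)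
next
  case (trans u v w)
  then show ?case using pres_eq.trans by simp
next
  case (cancel u v x b)
  then show ?case using pres_eq.cancel[of "p @ u" X "v @ q" x R b] by simp
next
  case (relator u v r)
  then show ?case using pres_eq.relator[of "p @ u" X "v @ q" r R] by simp
qed

lemma pres_eq_append:
  assumes "pres_eq X R u u'" "pres_eq X R v v'"
  shows "pres_eq X R (u @ v) (u' @ v')"
proof (rule pres_eq.trans)
  show "pres_eq X R (u @ v) (u' @ v)"
    using pres_eq_context[OF assms(1), of "[]" v] pres_eq_gwords[OF assms(2)] by simp
  show "pres_eq X R (u' @ v) (u' @ v')"
    using pres_eq_context[OF assms(2), of u' "[]"] pres_eq_gwords[OF assms(1)] by simp
qed

lemma pres_class_eqI: "pres_eq X R u v \<Longrightarrow> pres_class X R u = pres_class X R v"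
  unfolding pres_class_def
  by (intro Collect_cong iffI) (erule pres_eq.trans[OF pres_eq.sym] pres_eq.trans, assumption)+

lemma presented_group_mult:
  assumes "u \<in> gwords X" "v \<in> gwords X"
  shows "pres_class X R u \<otimes>\<^bsub>presented_group X R\<^esub> pres_class X R v = pres_class X R (u @ v)"
proof -
  have eq: "pres_class X R (u' @ v') = pres_class X R (u @ v)"
    if "u' \<in> pres_class X R u" "v' \<in> pres_class X R v" for u' v'
    using that unfolding pres_class_def mem_Collect_eq
    by (intro pres_class_eqI[unfolded pres_class_def] pres_eq.sym[OF pres_eq_append])
  have ne: "u \<in> pres_class X R u" "v \<in> pres_class X R v"
    using assms by (auto simp: pres_class_def intro: pres_eq.refl)
  have "(\<Union>u'\<in>pres_class X R u. \<Union>v'\<in>pres_class X R v. pres_class X R (u' @ v')) =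
      (\<Union>u'\<in>pres_class X R u. \<Union>v'\<in>pres_class X R v. pres_class X R (u @ v))"
    by (intro SUP_cong HOL.refl eq)
  also have "\<dots> = pres_class X R (u @ v)"
    using ne by blast
  finally show ?thesis
    by (simp add: presented_group_def)
qed

definition gword_inv :: "'a gword \<Rightarrow> 'a gword" where
  "gword_inv u = rev (map (\<lambda>(x, b). (x, \<not> b)) u)"

lemma gword_inv_gwords: "u \<in> gwords X \<Longrightarrow> gword_inv u \<in> gwords X"
  by (induction u) (auto simp: gword_inv_def split: prod.splits)

lemma pres_eq_inv: "u \<in> gwords X \<Longrightarrow> pres_eq X R (gword_inv u @ u) []"
proof (induction u)
  case Nil
  then show ?case by (auto simp: gword_inv_def intro: pres_eq.refl)
next
  case (Cons l u)
  obtain x b where l: "l = (x, b)" by (cases l)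
  have "pres_eq X R (gword_inv u @ [(x, \<not> b), (x, \<not> \<not> b)] @ u) (gword_inv u @ u)"
    using Cons.prems l by (intro pres_eq.cancel) (auto simp: gword_inv_gwords)
  then show ?case
    using Cons l pres_eq.trans[of X R "gword_inv (l # u) @ l # u" "gword_inv u @ u" "[]"]
    by (simp add: gword_inv_def)
qed

lemma group_presented_group: "group (presented_group X R)"
proof (rule groupI)
  fix A assume "A \<in> carrier (presented_group X R)"
  then obtain u where u: "u \<in> gwords X" "A = pres_class X R u"
    by (auto simp: presented_group_def)
  have "pres_class X R (gword_inv u) \<otimes>\<^bsub>presented_group X R\<^esub> A = \<one>\<^bsub>presented_group X R\<^esub>"
    using u pres_class_eqI[OF pres_eq_inv[OF u(1)]]
    by (simp add: presented_group_mult gword_inv_gwords) (simp add: presented_group_def)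
  then show "\<exists>B\<in>carrier (presented_group X R). B \<otimes>\<^bsub>presented_group X R\<^esub> A = \<one>\<^bsub>presented_group X R\<^esub>"
    using gword_inv_gwords[OF u(1)] by (auto simp: presented_group_def)
  have "pres_class X R [] \<otimes>\<^bsub>presented_group X R\<^esub> A = A"
    using u by (simp add: presented_group_mult)
  then show "\<one>\<^bsub>presented_group X R\<^esub> \<otimes>\<^bsub>presented_group X R\<^esub> A = A"
    by (simp add: presented_group_def)
next
  fix A B assume "A \<in> carrier (presented_group X R)" "B \<in> carrier (presented_group X R)"
  then obtain u v where "u \<in> gwords X" "A = pres_class X R u" "v \<in> gwords X" "B = pres_class X R v"
    by (auto simp: presented_group_def)
  then have "A \<otimes>\<^bsub>presented_group X R\<^esub> B = pres_class X R (u @ v)" "u @ v \<in> gwords X"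
    by (simp_all add: presented_group_mult)
  then show "A \<otimes>\<^bsub>presented_group X R\<^esub> B \<in> carrier (presented_group X R)"
    by (auto simp: presented_group_def)
next
  fix A B C assume "A \<in> carrier (presented_group X R)" "B \<in> carrier (presented_group X R)"
    "C \<in> carrier (presented_group X R)"
  then obtain u v w where "u \<in> gwords X" "A = pres_class X R u" "v \<in> gwords X" "B = pres_class X R v"
    "w \<in> gwords X" "C = pres_class X R w"
    by (auto simp: presented_group_def)
  then show "A \<otimes>\<^bsub>presented_group X R\<^esub> B \<otimes>\<^bsub>presented_group X R\<^esub> C =
      A \<otimes>\<^bsub>presented_group X R\<^esub> (B \<otimes>\<^bsub>presented_group X R\<^esub> C)"
    by (simp add: presented_group_mult)
qed (auto simp: presented_group_def)


section \<open>Right-angled Artin groups and Bestvina--Brady groups\<close>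

definition raag_relators :: "'a pair_pre_digraph \<Rightarrow> 'a gword set" where
  "raag_relators G = {[(v, True), (w, True), (v, False), (w, False)] | v w. (v, w) \<in> parcs G}"

definition raag :: "'a pair_pre_digraph \<Rightarrow> 'a gword set monoid" where
  "raag G = presented_group (pverts G) (raag_relators G)"

definition exponent_sum :: "'a gword \<Rightarrow> int" where
  "exponent_sum u = (\<Sum>(x, b)\<leftarrow>u. if b then 1 else - 1)"

text \<open>The exponent sum is constant on each element of \<open>raag G\<close>; see \<open>raag_height_class\<close>.\<close>

definition raag_height :: "'a gword set \<Rightarrow> int" where
  "raag_height A = the_elem (exponent_sum ` A)"

definition bestvina_brady :: "'a pair_pre_digraph \<Rightarrow> 'a gword set monoid" where
  "bestvina_brady G = (raag G)\<lparr>carrier := kernel (raag G) integer_group raag_height\<rparr>"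

lemma group_raag: "group (raag G)"
  by (simp add: raag_def group_presented_group)

lemma exponent_sum_append [simp]: "exponent_sum (u @ v) = exponent_sum u + exponent_sum v"
  by (simp add: exponent_sum_def)

lemma exponent_sum_pres_eq:
  "pres_eq (pverts G) (raag_relators G) u v \<Longrightarrow> exponent_sum u = exponent_sum v"
  by (induction rule: pres_eq.induct) (auto simp: raag_relators_def exponent_sum_def)

lemma raag_height_class:
  assumes "u \<in> gwords (pverts G)"
  shows "raag_height (pres_class (pverts G) (raag_relators G) u) = exponent_sum u"
proof -
  have "exponent_sum ` pres_class (pverts G) (raag_relators G) u = {exponent_sum u}"
    using assms by (force simp: pres_class_def dest: exponent_sum_pres_eq intro: pres_eq.refl)
  then show ?thesis by (simp add: raag_height_def)
qed

lemma raag_height_hom: "raag_height \<in> hom (raag G) integer_group"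
proof (rule homI)
  fix A B assume "A \<in> carrier (raag G)" "B \<in> carrier (raag G)"
  then obtain u v where "u \<in> gwords (pverts G)" "A = pres_class (pverts G) (raag_relators G) u"
    "v \<in> gwords (pverts G)" "B = pres_class (pverts G) (raag_relators G) v"
    by (auto simp: raag_def presented_group_def)
  then show "raag_height (A \<otimes>\<^bsub>raag G\<^esub> B) = raag_height A \<otimes>\<^bsub>integer_group\<^esub> raag_height B"
    by (simp add: raag_def presented_group_mult raag_height_class)
qed simp

lemma raag_height_generator:
  "v \<in> pverts G \<Longrightarrow> raag_height (pres_class (pverts G) (raag_relators G) [(v, True)]) = 1"
  by (simp add: raag_height_class exponent_sum_def)

lemma group_bestvina_brady: "group (bestvina_brady G)"
proof -
  interpret group_hom "raag G" integer_group raag_height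
    by (intro group_hom.intro group_hom_axioms.intro group_raag raag_height_hom) simp
  show ?thesis
    unfolding bestvina_brady_def by (intro subgroup.subgroup_is_group subgroup_kernel group_raag)
qed


section \<open>Free products\<close>

text \<open>The presentation of \<open>H * K\<close> by the multiplication tables of both factors.\<close>

definition free_product ::
  "('g, 'm) monoid_scheme \<Rightarrow> ('h, 'n) monoid_scheme \<Rightarrow> ('g + 'h) gword set monoid" where
  "free_product H K = presented_group (Inl ` carrier H \<union> Inr ` carrier K)
     ({[(Inl a, True), (Inl b, True), (Inl (a \<otimes>\<^bsub>H\<^esub> b), False)] | a b. a \<in> carrier H \<and> b \<in> carrier H} \<union>
      {[(Inr a, True), (Inr b, True), (Inr (a \<otimes>\<^bsub>K\<^esub> b), False)] | a b. a \<in> carrier K \<and> b \<in> carrier K})"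

text \<open>The factors may be taken over the element type of \<open>G\<close>, since they embed into \<open>G\<close>.\<close>

definition splits_as_free_product :: "('g, 'm) monoid_scheme \<Rightarrow> bool" where
  "splits_as_free_product G \<longleftrightarrow>
     (\<exists>(H :: 'g monoid) (K :: 'g monoid). group H \<and> group K \<and>
        \<not> trivial_group H \<and> \<not> trivial_group K \<and> G \<cong> free_product H K)"


section \<open>Finite generation, Cayley graphs, ends\<close>

definition finite_generating_set :: "('g, 'm) monoid_scheme \<Rightarrow> 'g set \<Rightarrow> bool" where
  "finite_generating_set G S \<longleftrightarrow> finite S \<and> S \<subseteq> carrier G \<and> generate G S = carrier G"

definition finitely_generated :: "('g, 'm) monoid_scheme \<Rightarrow> bool" where
  "finitely_generated G \<longleftrightarrow> (\<exists>S. finite_generating_set G S)"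

definition cayley_graph :: "('g, 'm) monoid_scheme \<Rightarrow> 'g set \<Rightarrow> 'g pair_pre_digraph" where
  "cayley_graph G S =
     \<lparr>pverts = carrier G,
      parcs = {(g, h). g \<in> carrier G \<and> h \<in> carrier G \<and> (\<exists>s\<in>S. h = g \<otimes>\<^bsub>G\<^esub> s \<or> g = h \<otimes>\<^bsub>G\<^esub> s)}\<rparr>"

text \<open>The arc relation being symmetric, strongly connected components are the connected
  components.\<close>

definition infinite_components :: "'a pair_pre_digraph \<Rightarrow> 'a set set" where
  "infinite_components G = {C \<in> pre_digraph.sccs_verts (with_proj G). infinite C}"

text \<open>The number of ends of a locally finite graph: the supremum, over all finite vertex sets
  \<open>F\<close>, of the number of infinite components of the complement of \<open>F\<close>.\<close>

definition graph_ends :: "'a pair_pre_digraph \<Rightarrow> enat" where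
  "graph_ends G =
     (SUP F \<in> {F. finite F \<and> F \<subseteq> pverts G}.
        let Cs = infinite_components (full_subgraph G (pverts G - F))
        in if finite Cs then enat (card Cs) else \<infinity>)"

text \<open>The number of ends of \<open>cayley_graph G S\<close> is the same for all finite generating sets \<open>S\<close>,
  so the choice of \<open>S\<close> is immaterial.\<close>

definition one_ended :: "('g, 'm) monoid_scheme \<Rightarrow> bool" where
  "one_ended G \<longleftrightarrow> (\<exists>S. finite_generating_set G S \<and> graph_ends (cayley_graph G S) = 1)"


section \<open>Characters, the BNS-invariant and algebraic fibering\<close>

definition real_additive_group :: "real monoid" where
  "real_additive_group = \<lparr>carrier = UNIV, monoid.mult = (+), one = 0\<rparr>"

text \<open>Elements of \<open>hom\<close> are arbitrary outside the carrier; restricting to extensional functions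
  makes equality of characters mean equality on the group.\<close>

definition nonzero_characters :: "('g, 'm) monoid_scheme \<Rightarrow> ('g \<Rightarrow> real) set" where
  "nonzero_characters G =
     {chi \<in> hom G real_additive_group \<inter> extensional (carrier G). \<exists>g\<in>carrier G. chi g \<noteq> 0}"

definition character_class :: "('g, 'm) monoid_scheme \<Rightarrow> ('g \<Rightarrow> real) \<Rightarrow> ('g \<Rightarrow> real) set" where
  "character_class G chi = {\<lambda>g\<in>carrier G. c * chi g | c. c > 0}"

definition character_sphere :: "('g, 'm) monoid_scheme \<Rightarrow> ('g \<Rightarrow> real) set set" where
  "character_sphere G = character_class G ` nonzero_characters G"

text \<open>The condition on \<open>chi\<close> depends neither on the representative of its class nor on the finite
  generating set \<open>S\<close>.\<close>

definition BNS_invariant :: "('g, 'm) monoid_scheme \<Rightarrow> ('g \<Rightarrow> real) set set" where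
  "BNS_invariant G =
     {character_class G chi | chi. chi \<in> nonzero_characters G \<and>
        (\<exists>S. finite_generating_set G S \<and>
             graph_connected (full_subgraph (cayley_graph G S) {g \<in> carrier G. chi g \<ge> 0}))}"

lemma BNS_invariant_subset: "BNS_invariant G \<subseteq> character_sphere G"
  by (auto simp: BNS_invariant_def character_sphere_def)

definition algebraically_fibers :: "('g, 'm) monoid_scheme \<Rightarrow> bool" where
  "algebraically_fibers G \<longleftrightarrow> finitely_generated G \<and>
     (\<exists>\<phi> \<in> epi G integer_group. finitely_generated (G\<lparr>carrier := kernel G integer_group \<phi>\<rparr>))"

end

theory Submission
  imports Defs "HOL-Complex_Analysis.Winding_Numbers"
begin

text \<open>Let \<open>v\<close> be a vertex that is not a cut vertex. If its link were disconnected, then separating one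
  side of the link from the rest would give a map from the flag complex to the punctured plane and a
  loop through \<open>v\<close> whose image has winding number one, contradicting simple connectedness. So all
  links of a biconnected \<open>\<Gamma>\<close> are connected, and any two edges of \<open>\<Gamma>\<close> are joined by a chain of
  triangles. The quotients \<open>v w\<^sup>-\<^sup>1\<close> along edges generate the Bestvina--Brady group; those of two edges
  of a triangle commute and generate a free abelian group of rank two. A chain of overlapping flats
  has a single end, and a homomorphism to \<open>\<int>\<close> that vanishes on none of these generators has finitely
  generated kernel.

  Conversely, a cut vertex splits the group as a free product. The elements whose normal form begins
  with a letter from the first factor then form an almost invariant set; this set gives at least two
  ends, and its translates separate every half space \<open>\<chi> \<ge> 0\<close>. So the BNS-invariant is empty, and
  the group does not fiber, since the projection of a fibering lies in the BNS-invariant.\<close>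

section \<open>Links in simply connected flag complexes\<close>

text \<open>No presentation of the Bestvina--Brady group is used: all computations take place in the
  right-angled Artin group. Its relators are commutators, so every integer labelling of the vertices
  extends to a homomorphism to \<int>. Such labellings supply the fibering, the nonzero characters,
  and the independence of the two edge quotients in a triangle. The kernel argument has to cope with
  generators of different heights; a common multiple of the heights makes suitable powers
  comparable. In the one-endedness argument an edge quotient and its inverse do not span a flat, so
  an edge is reversed by walking around a triangle; this is why three vertices are asked for there.
  In the other direction, a free product is given by a presentation, which by itself never shows an
  element to be nontrivial. Letting words act on normal forms does, and what the action yields is
  condensed into one set \<open>E\<close>, so that the separation arguments never see a normal
  form.\<close>

lemma graph_connected_iff:
  assumes "sym (parcs G)" "parcs G \<subseteq> pverts G \<times> pverts G"
  shows "graph_connected G \<longleftrightarrow>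
    pverts G \<noteq> {} \<and> (\<forall>u\<in>pverts G. \<forall>v\<in>pverts G. (u, v) \<in> (parcs G)\<^sup>*)"
proof -
  have arcs: "parcs (mk_symmetric (with_proj G)) = parcs G"
    using assms(1) by (auto simp: mk_symmetric_def sym_def)
  have verts: "pverts (mk_symmetric (with_proj G)) = pverts G"
    by (simp add: mk_symmetric_def)
  have "(u, v) \<in> rtrancl_on (pverts G) (parcs G) \<longleftrightarrow> (u, v) \<in> (parcs G)\<^sup>*"
    if "u \<in> pverts G" "v \<in> pverts G" for u v
    using rtrancl_on_rtranclI[of u v] rtrancl_consistent_rtrancl_on[of u v "parcs G" "pverts G"]
      that assms(2) by auto
  then show ?thesis
    by (simp add: Digraph_Component.connected_def strongly_connected_def reachable_def arcs verts)
qed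

lemma pair_graph_arcs:
  assumes "pair_graph G" "(x, y) \<in> parcs G"
  shows "(y, x) \<in> parcs G" "x \<noteq> y" "x \<in> pverts G" "y \<in> pverts G"
proof -
  interpret pair_graph G by fact
  show "(y, x) \<in> parcs G" using assms(2) pair_sym_arcs by (simp add: symmetric_def sym_def)
  show "x \<noteq> y" using pair_no_loops[of "(x, y)"] assms(2) by simp
  show "x \<in> pverts G" "y \<in> pverts G" using assms(2) by (rule in_arcsD1, rule in_arcsD2)
qed

section \<open>Paths in the realization of a flag complex, and loops around the origin\<close>

definition vertex_point :: "'a \<Rightarrow> 'a \<Rightarrow> real" where
  "vertex_point x = (\<lambda>z. if z = x then 1 else 0)"

definition edge_path :: "'a \<Rightarrow> 'a \<Rightarrow> real \<Rightarrow> 'a \<Rightarrow> real" where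
  "edge_path x y s = (\<lambda>z. (1 - s) * vertex_point x z + s * vertex_point y z)"

lemma path_edge_path: "path (edge_path x y)"
  unfolding path_def edge_path_def
  by (intro continuous_on_coordinatewise_then_product continuous_intros)

lemma edge_path_ends [simp]:
  "edge_path x y 0 = vertex_point x" "edge_path x y 1 = vertex_point y"
  by (simp_all add: edge_path_def fun_eq_iff)

lemma edge_path_in_realization:
  assumes "(x, y) \<in> parcs G" "(y, x) \<in> parcs G" "x \<noteq> y" "x \<in> pverts G" "y \<in> pverts G" "s \<in> {0..1}"
  shows "edge_path x y s \<in> geometric_realization (flag_complex G)"
proof -
  have supp: "{z. edge_path x y s z \<noteq> 0} = (if s = 0 then {x} else if s = 1 then {y} else {x, y})"
    using assms by (auto simp: edge_path_def vertex_point_def)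
  have "(\<Sum>z | edge_path x y s z \<noteq> 0. edge_path x y s z) = 1"
    unfolding supp using assms by (auto simp: edge_path_def vertex_point_def)
  moreover have "{z. edge_path x y s z \<noteq> 0} \<in> flag_complex G"
    unfolding supp using assms by (auto simp: flag_complex_def)
  moreover have "0 \<le> edge_path x y s z" for z
    using assms by (simp add: edge_path_def vertex_point_def)
  ultimately show ?thesis by (simp add: geometric_realization_def)
qed

text \<open>A teardrop around the origin. Unlike the unit circle it is polynomial, so it extends to
  barycentric coordinates without case distinctions.\<close>

lemma winding_number_teardrop:
  "winding_number (\<lambda>s. 1 + complex_of_real (s * (1 - s)) * Complex (- 8) (1 - 2 * s)) 0 = 1"
    (is "winding_number ?p 0 = 1")
proof -
  let ?q = "circlepath 0 1"
  have q: "?q s = exp (2 * of_real pi * \<i> * of_real s)" for s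
    by (simp add: circlepath)
  have Imq: "Im (?q s) = sin (2 * pi * s)" and Req: "Re (?q s) = cos (2 * pi * s)" for s
    by (simp_all add: q Im_exp Re_exp)
  have Imp: "Im (?p s) = s * (1 - s) * (1 - 2 * s)" and Rep: "Re (?p s) = 1 - 8 * (s * (1 - s))" for s
    by simp_all
  \<comment> \<open>The straight-line homotopy avoids 0. For \<open>s\<close> other than 0, 1/2 and
    1 the imaginary parts of both curves have the same strict sign; at 0 and 1 both curves are at 1,
    and at 1/2 both are at -1, which the constant 8 arranges.\<close>
  have "homotopic_loops (- {0}) ?p ?q"
  proof (rule homotopic_loops_linear)
    show "path ?p" unfolding path_def
      unfolding Complex_eq by (intro continuous_intros)
    show "path ?q" by simp
    show "pathfinish ?p = pathstart ?p" by (simp add: pathfinish_def pathstart_def)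
    show "pathfinish ?q = pathstart ?q" by simp
    fix s :: real assume s: "s \<in> {0..1}"
    show "closed_segment (?p s) (?q s) \<subseteq> - {0}"
    proof (rule ccontr)
      assume "\<not> ?thesis"
      then have "0 \<in> closed_segment (?p s) (?q s)" by auto
      then obtain u where u: "0 \<le> u" "u \<le> 1" "0 = (1 - u) *\<^sub>R ?p s + u *\<^sub>R ?q s"
        by (auto simp: closed_segment_def)
      have im: "(1 - u) * Im (?p s) + u * Im (?q s) = 0"
        using arg_cong[OF u(3), of Im] using Imq[of s] Imp[of s] by simp
      have re: "(1 - u) * Re (?p s) + u * Re (?q s) = 0"
        using arg_cong[OF u(3), of Re] using Req[of s] Rep[of s] by simp
      consider "s = 0 \<or> s = 1" | "s = 1/2" | "0 < s" "s < 1/2" | "1/2 < s" "s < 1" using s by force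
      then show False
      proof cases
        case 1 then show False using re unfolding Rep Req by auto
      next
        case 2
        have "Re (?p s) = - 1" "Re (?q s) = - 1" unfolding Rep Req 2 by simp_all
        then have "(1 - u) * - 1 + u * - 1 = 0" using re by (simp only:)
        then show False by simp
      next
        case 3
        have "Im (?p s) > 0" using 3 unfolding Imp by simp
        moreover have "Im (?q s) > 0" unfolding Imq using 3 by (intro sin_gt_zero) auto
        ultimately show False using im u(1,2)
          by (smt (verit) mult_nonneg_nonneg mult_pos_pos)
      next
        case 4
        have "Im (?p s) < 0" using 4 unfolding Imp by (simp add: mult_pos_neg)
        moreover have "sin (2 * pi * s) < 0" using 4 by (intro sin_lt_zero) auto
        ultimately show False using im u(1,2) unfolding Imq
          by (smt (verit) mult_nonneg_nonpos mult_pos_neg)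
      qed
    qed
  qed
  then have "winding_number ?p 0 = winding_number ?q 0"
    by (rule winding_number_homotopic_loops)
  then show ?thesis by (simp add: winding_number_circlepath_centre)
qed

text \<open>By \<open>closed\<close>, \<open>B\<close> is a union of components of the link of
  \<open>v\<close>. A path from \<open>b\<close> to \<open>a\<close> off \<open>v\<close> would
  close up, through the edges from \<open>a\<close> to \<open>v\<close> and from \<open>v\<close> to
  \<open>b\<close>, to a loop that passes between \<open>v\<close> and \<open>B\<close> once; the
  map \<open>f\<close> below turns it into a loop of winding number one.\<close>

lemma no_disconnected_link:
  assumes G: "pair_graph G" and sc: "simply_connected (geometric_realization (flag_complex G))"
    and v: "v \<in> pverts G" and B: "B \<subseteq> {x. (v, x) \<in> parcs G}"
    and closed: "\<And>x y. x \<in> B \<Longrightarrow> (x, y) \<in> parcs G \<Longrightarrow> (v, y) \<in> parcs G \<Longrightarrow> y \<in> B"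
    and b: "b \<in> B" and a: "(v, a) \<in> parcs G" "a \<notin> B"
  shows "(b, a) \<notin> (parcs G \<inter> (pverts G - {v}) \<times> (pverts G - {v}))\<^sup>*"
proof
  assume conn: "(b, a) \<in> (parcs G \<inter> (pverts G - {v}) \<times> (pverts G - {v}))\<^sup>*"
  interpret pair_graph G by fact
  let ?R = "geometric_realization (flag_complex G)"
  note E = pair_graph_arcs[OF G]
  have "B \<subseteq> pverts G" using B E(4) by blast
  then have finB: "finite B" using pair_finite_verts by (rule finite_subset)
  have vb: "(v, b) \<in> parcs G" using B b by blast
  have vB: "v \<notin> B" using B E(2) by blast
  define \<beta> where "\<beta> t = (\<Sum>x\<in>B. t x)" for t :: "'a \<Rightarrow> real"
  \<comment> \<open>\<open>f\<close> is 1 wherever \<open>t v\<close> or the weight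
    \<open>\<beta> t\<close> of \<open>B\<close> vanishes, so it detects just the simplices that
    contain \<open>v\<close> and a vertex of \<open>B\<close>. On an edge from \<open>v\<close> into
    \<open>B\<close> the two weights are \<open>1 - s\<close> and \<open>s\<close>, and
    \<open>f\<close> runs through the teardrop.\<close>
  define f where "f t = 1 + complex_of_real (\<beta> t * t v) * Complex (- 8) (t v - \<beta> t)" for t
  have contf: "continuous_on S f" for S
  proof -
    have coord: "continuous_on S (\<lambda>t. t x)" for x :: 'a
      by (rule continuous_on_subset[OF continuous_on_product_coordinates subset_UNIV])
    have "continuous_on S \<beta>" unfolding \<beta>_def by (intro continuous_on_sum coord)
    then show ?thesis
      unfolding f_def Complex_eq using coord[of v] by (intro continuous_intros)
  qed
  have nz: "f t \<noteq> 0" if t: "t \<in> ?R" for t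
  proof
    assume 0: "f t = 0"
    let ?s = "{x. t x \<noteq> 0}"
    have cl: "?s \<in> flag_complex G" and sum1: "(\<Sum>x\<in>?s. t x) = 1"
      using t by (auto simp: geometric_realization_def)
    from 0 have im: "\<beta> t * t v * (t v - \<beta> t) = 0" and re: "1 - 8 * (\<beta> t * t v) = 0"
      by (auto simp: f_def complex_eq_iff)
    then have ne: "\<beta> t \<noteq> 0" "t v \<noteq> 0" and eq: "t v = \<beta> t" by auto
    obtain b' where b': "b' \<in> B" "t b' \<noteq> 0" using ne(1) unfolding \<beta>_def by (meson sum.neutral)
    \<comment> \<open>A simplex through \<open>v\<close> and \<open>b'\<close> has its remaining
      vertices in \<open>B\<close>, since they are adjacent to both. So \<open>t v\<close> and
      \<open>\<beta> t\<close> add up to 1; being equal, they are 1/2, where \<open>f\<close> is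
      -1.\<close>
    have "x \<in> B" if "t x \<noteq> 0" "x \<noteq> v" for x
    proof (cases "x = b'")
      case False
      have "(b', x) \<in> parcs G" "(v, x) \<in> parcs G"
        using cl that b' False ne(2) by (auto simp: flag_complex_def)
      then show ?thesis using closed b' by blast
    qed (use b' in simp)
    then have sub: "?s \<subseteq> insert v B" by auto
    have "(\<Sum>x\<in>?s. t x) = (\<Sum>x\<in>insert v B. t x)"
      by (rule sum.mono_neutral_left) (use sub finB in auto)
    also have "\<dots> = t v + \<beta> t" using finB vB by (simp add: \<beta>_def)
    finally have "t v = 1/2" "\<beta> t = 1/2" using eq sum1 by auto
    then show False using re unfolding \<open>t v = 1/2\<close> \<open>\<beta> t = 1/2\<close> by simp
  qed
  let ?S = "{t \<in> ?R. f t = 1}"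
  \<comment> \<open>Edges that avoid \<open>v\<close> or avoid \<open>B\<close> are collapsed to the
    point 1, so the whole way back from \<open>b\<close> to \<open>v\<close> contributes no
    winding.\<close>
  have edge: "path_component ?S (vertex_point x) (vertex_point y)"
    if "(x, y) \<in> parcs G" "x \<noteq> v \<and> y \<noteq> v \<or> x \<notin> B \<and> y \<notin> B" for x y
    unfolding path_component_def
  proof (intro exI[of _ "edge_path x y"] conjI path_edge_path)
    have "f (edge_path x y s) = 1" for s
    proof -
      have "edge_path x y s v = 0" if "x \<noteq> v" "y \<noteq> v"
        using that by (simp add: edge_path_def vertex_point_def)
      moreover have "\<beta> (edge_path x y s) = 0" if "x \<notin> B" "y \<notin> B"
        unfolding \<beta>_def using that by (intro sum.neutral) (auto simp: edge_path_def vertex_point_def)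
      ultimately show ?thesis using that(2) by (auto simp: f_def)
    qed
    then show "path_image (edge_path x y) \<subseteq> ?S"
      using edge_path_in_realization[OF that(1)] E[OF that(1)] by (auto simp: path_image_def)
  qed (simp_all add: pathstart_def pathfinish_def)
  have "path_component ?S (vertex_point b) (vertex_point a)"
    using conn
  proof (induction rule: rtrancl_induct)
    case base
    have "edge_path v b 1 \<in> ?R" using edge_path_in_realization[of v b G 1] vb E[OF vb] by simp
    moreover have "f (vertex_point b) = 1" using vB b by (auto simp: f_def vertex_point_def)
    ultimately show ?case by (intro path_component_refl) simp
  next
    case (step y z)
    then show ?case using edge[of y z] by (auto intro: path_component_trans)
  qed
  moreover have "path_component ?S (vertex_point a) (vertex_point v)"
    using edge[of a v] a vB E(1)[OF a(1)] by simp
  ultimately have "path_component ?S (vertex_point b) (vertex_point v)"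
    by (rule path_component_trans)
  then obtain r where r: "path r" "path_image r \<subseteq> ?S" "pathstart r = vertex_point b"
    "pathfinish r = vertex_point v"
    unfolding path_component_def by blast
  define e where "e = edge_path v b"
  have e: "path e" "pathstart e = vertex_point v" "pathfinish e = vertex_point b"
    by (simp_all add: e_def path_edge_path pathstart_def pathfinish_def)
  have eR: "path_image e \<subseteq> ?R"
    unfolding path_image_def e_def using edge_path_in_realization[OF vb] E[OF vb] by blast
  have loop: "path (e +++ r)" "path_image (e +++ r) \<subseteq> ?R" "pathstart (e +++ r) = vertex_point v"
    "pathfinish (e +++ r) = vertex_point v"
    using e r eR by (auto simp: path_image_join)
  have const: "path (\<lambda>_. vertex_point v)" "path_image (\<lambda>_. vertex_point v) \<subseteq> ?R"
    using loop(2) loop(3) pathstart_in_path_image[of "e +++ r"] by (auto simp: path_def path_image_def)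
  have "homotopic_loops ?R (e +++ r) (\<lambda>_. vertex_point v)"
    using sc loop const unfolding simply_connected_def
    by (auto simp: pathstart_def pathfinish_def)
  then have "homotopic_loops (- {0}) (f \<circ> (e +++ r)) (f \<circ> (\<lambda>_. vertex_point v))"
    by (rule homotopic_loops_continuous_image[OF _ contf]) (use nz in auto)
  then have "winding_number (f \<circ> (e +++ r)) 0 = winding_number (f \<circ> (\<lambda>_. vertex_point v)) 0"
    by (rule winding_number_homotopic_loops)
  moreover have triv: "winding_number (\<lambda>_. 1) 0 = 0"
    using winding_number_trivial[of 0 1] by (simp add: linepath_def scaleR_conv_of_real)
  ultimately have "winding_number (f \<circ> (e +++ r)) 0 = 0"
  proof -
    have "f (vertex_point v) = 1" using r(2,4) pathfinish_in_path_image[of r] by auto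
    then show ?thesis using triv \<open>winding_number (f \<circ> (e +++ r)) 0 = _\<close> by (simp add: o_def)
  qed
  moreover have "f \<circ> (e +++ r) = (f \<circ> e) +++ (f \<circ> r)" by (simp add: path_compose_join)
  moreover have "winding_number ((f \<circ> e) +++ (f \<circ> r)) 0 = winding_number (f \<circ> e) 0 + winding_number (f \<circ> r) 0"
  proof (rule winding_number_join)
    show "path (f \<circ> e)" "path (f \<circ> r)" using e r by (auto intro: path_continuous_image contf)
    show "0 \<notin> path_image (f \<circ> e)" using eR nz by (force simp: path_image_compose)
    show "0 \<notin> path_image (f \<circ> r)" using r(2) by (force simp: path_image_compose)
    show "pathfinish (f \<circ> e) = pathstart (f \<circ> r)" using e r by (simp add: pathfinish_compose pathstart_compose)
  qed
  moreover have "winding_number (f \<circ> r) 0 = 0"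
  proof -
    have "winding_number (f \<circ> r) 0 = winding_number (\<lambda>_. 1) 0"
      by (rule winding_number_cong) (use r(2) in \<open>force simp: path_image_def\<close>)
    then show ?thesis using triv by simp
  qed
  moreover have "winding_number (f \<circ> e) 0 = 1"
  proof -
    have "\<beta> (e s) = s" for s
    proof -
      have "\<beta> (e s) = (\<Sum>x\<in>B. s * vertex_point b x)"
        unfolding \<beta>_def by (rule sum.cong) (use vB in \<open>auto simp: e_def edge_path_def vertex_point_def\<close>)
      also have "\<dots> = s * (\<Sum>x\<in>B. vertex_point b x)" by (simp add: sum_distrib_left)
      also have "(\<Sum>x\<in>B. vertex_point b x) = 1" using b finB by (simp add: vertex_point_def)
      finally show ?thesis by simp
    qed
    moreover have "e s v = 1 - s" for s
      using b vB by (auto simp: e_def edge_path_def vertex_point_def)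
    ultimately have "f \<circ> e = (\<lambda>s. 1 + complex_of_real (s * (1 - s)) * Complex (- 8) (1 - 2 * s))"
      by (auto simp: fun_eq_iff f_def)
    then show ?thesis using winding_number_teardrop by simp
  qed
  ultimately show False by simp
qed

text \<open>Take for \<open>B\<close> the link component of \<open>b\<close>. If it misses
  \<open>a\<close>, the previous lemma forbids a path from \<open>b\<close> to \<open>a\<close> off
  \<open>v\<close>, but such a path exists because \<open>v\<close> is not a cut vertex.\<close>

lemma link_connected:
  assumes G: "pair_graph G" and sc: "simply_connected (geometric_realization (flag_complex G))"
    and v: "\<not> cut_vertex G v" and a: "(v, a) \<in> parcs G" and b: "(v, b) \<in> parcs G"
  shows "(b, a) \<in> (parcs G \<inter> {x. (v, x) \<in> parcs G} \<times> {x. (v, x) \<in> parcs G})\<^sup>*"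
proof (rule ccontr)
  assume n: "\<not> ?thesis"
  interpret pair_graph G by fact
  note E = pair_graph_arcs[OF G]
  let ?N = "{x. (v, x) \<in> parcs G}"
  let ?H = "full_subgraph G (pverts G - {v})"
  define B where "B = {x. (b, x) \<in> (parcs G \<inter> ?N \<times> ?N)\<^sup>*}"
  have "B \<subseteq> ?N"
  proof
    fix x assume "x \<in> B"
    then have "(b, x) \<in> (parcs G \<inter> ?N \<times> ?N)\<^sup>*" by (simp add: B_def)
    then show "x \<in> ?N" using b by (induction) auto
  qed
  moreover have "y \<in> B" if "x \<in> B" "(x, y) \<in> parcs G" "(v, y) \<in> parcs G" for x y
    using that \<open>B \<subseteq> ?N\<close> unfolding B_def by (auto intro: rtrancl_into_rtrancl)
  ultimately have nc: "(b, a) \<notin> (parcs G \<inter> (pverts G - {v}) \<times> (pverts G - {v}))\<^sup>*"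
    using n a b E by (intro no_disconnected_link[OF G sc, of v B]) (auto simp: B_def)
  have "graph_connected ?H"
    using v a E[of v a] by (auto simp: cut_vertex_def)
  moreover have "sym (parcs ?H)" "parcs ?H \<subseteq> pverts ?H \<times> pverts ?H"
    using E by (auto simp: full_subgraph_def sym_def)
  ultimately show False
    using nc a b E by (auto simp: graph_connected_iff full_subgraph_def)
qed

section \<open>Presented groups\<close>

abbreviation pres_gen :: "'a set \<Rightarrow> 'a gword set \<Rightarrow> 'a \<Rightarrow> 'a gword set" where
  "pres_gen X R x \<equiv> pres_class X R [(x, True)]"

fun gword_eval :: "('g, 'm) monoid_scheme \<Rightarrow> ('a \<Rightarrow> 'g) \<Rightarrow> 'a gword \<Rightarrow> 'g" where
  "gword_eval M f [] = \<one>\<^bsub>M\<^esub>"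
| "gword_eval M f ((x, b) # u) = (if b then f x else inv\<^bsub>M\<^esub> (f x)) \<otimes>\<^bsub>M\<^esub> gword_eval M f u"

context group
begin

lemma gword_eval_closed:
  "f \<in> X \<rightarrow> carrier G \<Longrightarrow> u \<in> gwords X \<Longrightarrow> gword_eval G f u \<in> carrier G"
  by (induction u) (auto simp: Pi_iff)

lemma gword_eval_append:
  "f \<in> X \<rightarrow> carrier G \<Longrightarrow> u \<in> gwords X \<Longrightarrow> v \<in> gwords X \<Longrightarrow>
    gword_eval G f (u @ v) = gword_eval G f u \<otimes> gword_eval G f v"
  by (induction u) (auto simp: Pi_iff gword_eval_closed m_assoc)

lemma gword_eval_in_subgroup:
  "subgroup H G \<Longrightarrow> f \<in> X \<rightarrow> H \<Longrightarrow> u \<in> gwords X \<Longrightarrow> gword_eval G f u \<in> H"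
  by (induction u) (auto simp: Pi_iff subgroup.one_closed subgroup.m_closed subgroup.m_inv_closed)

text \<open>The well-definedness part of von Dyck's theorem.\<close>

lemma gword_eval_pres_eq:
  assumes f: "f \<in> X \<rightarrow> carrier G" and rel: "\<And>r. r \<in> R \<Longrightarrow> gword_eval G f r = \<one>"
    and "pres_eq X R u v"
  shows "gword_eval G f u = gword_eval G f v"
  using assms(3)
proof (induction rule: pres_eq.induct)
  case (cancel u v x b)
  have "f x \<in> carrier G" using f cancel by auto
  then show ?case
    using cancel gword_eval_append[OF f, of u "[(x, b), (x, \<not> b)] @ v"] gword_eval_append[OF f, of u v]
      gword_eval_closed[OF f, of v]
    by (simp add: inv_solve_left' m_assoc[symmetric])
next
  case (relator u v r)
  then show ?case
    using gword_eval_append[OF f, of u "r @ v"] gword_eval_append[OF f, of r v]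
      gword_eval_append[OF f, of u v] gword_eval_closed[OF f, of v]
    by (simp add: rel)
qed auto

end

lemma pres_class_eq_iff:
  assumes "u \<in> gwords X"
  shows "pres_class X R u = pres_class X R v \<longleftrightarrow> pres_eq X R u v"
proof
  assume "pres_class X R u = pres_class X R v"
  then have "pres_eq X R v u" using pres_eq.refl[OF assms, of R] by (auto simp: pres_class_def)
  then show "pres_eq X R u v" by (rule pres_eq.sym)
qed (rule pres_class_eqI)

lemma pres_class_carrier [simp]: "u \<in> gwords X \<Longrightarrow> pres_class X R u \<in> carrier (presented_group X R)"
  by (simp add: presented_group_def)

lemma presented_group_cases:
  assumes "A \<in> carrier (presented_group X R)"
  obtains u where "u \<in> gwords X" "A = pres_class X R u"
  using assms by (auto simp: presented_group_def)

lemma one_presented_group: "\<one>\<^bsub>presented_group X R\<^esub> = pres_class X R []"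
  by (simp add: presented_group_def)

lemma inv_presented_group:
  assumes "u \<in> gwords X"
  shows "inv\<^bsub>presented_group X R\<^esub> pres_class X R u = pres_class X R (gword_inv u)"
proof (rule group.inv_equality[OF group_presented_group])
  show "pres_class X R (gword_inv u) \<otimes>\<^bsub>presented_group X R\<^esub> pres_class X R u = \<one>\<^bsub>presented_group X R\<^esub>"
    using assms pres_class_eqI[OF pres_eq_inv[OF assms, of R]]
    by (simp add: presented_group_mult gword_inv_gwords one_presented_group)
qed (simp_all add: assms gword_inv_gwords)

lemma pres_class_Cons:
  assumes "(x, b) # u \<in> gwords X"
  shows "pres_class X R ((x, b) # u) =
    (if b then pres_gen X R x else inv\<^bsub>presented_group X R\<^esub> pres_gen X R x)
      \<otimes>\<^bsub>presented_group X R\<^esub> pres_class X R u"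
proof -
  have "pres_class X R [(x, b)] = (if b then pres_gen X R x else inv\<^bsub>presented_group X R\<^esub> pres_gen X R x)"
    using assms by (simp add: inv_presented_group gword_inv_def)
  then show ?thesis
    using assms presented_group_mult[of "[(x, b)]" X u R] by simp
qed

lemma pres_class_eval:
  "u \<in> gwords X \<Longrightarrow> pres_class X R u = gword_eval (presented_group X R) (pres_gen X R) u"
proof (induction u)
  case (Cons l u)
  then show ?case using pres_class_Cons[of "fst l" "snd l" u X R] by (cases l) simp
qed (simp add: one_presented_group)

lemma pres_class_relator:
  "r \<in> R \<Longrightarrow> r \<in> gwords X \<Longrightarrow> pres_class X R r = \<one>\<^bsub>presented_group X R\<^esub>"
  using pres_class_eqI[OF pres_eq.relator[of "[]" X "[]" r R]] by (simp add: one_presented_group)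

section \<open>Normal forms in free products\<close>

text \<open>The last clause is a filler for letters of different factors. Returning the first
  argument makes \<open>letter_mult H K y x\<close> lie on the side of \<open>y\<close> in every
  case.\<close>

fun letter_mult :: "('g, 'm) monoid_scheme \<Rightarrow> ('h, 'n) monoid_scheme \<Rightarrow> 'g + 'h \<Rightarrow> 'g + 'h \<Rightarrow> 'g + 'h" where
  "letter_mult H K (Inl a) (Inl b) = Inl (a \<otimes>\<^bsub>H\<^esub> b)"
| "letter_mult H K (Inr a) (Inr b) = Inr (a \<otimes>\<^bsub>K\<^esub> b)"
| "letter_mult H K x y = x"

definition letter_one :: "('g, 'm) monoid_scheme \<Rightarrow> ('h, 'n) monoid_scheme \<Rightarrow> 'g + 'h \<Rightarrow> bool" where
  "letter_one H K x \<longleftrightarrow> x = Inl \<one>\<^bsub>H\<^esub> \<or> x = Inr \<one>\<^bsub>K\<^esub>"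

fun letter_inv :: "('g, 'm) monoid_scheme \<Rightarrow> ('h, 'n) monoid_scheme \<Rightarrow> 'g + 'h \<Rightarrow> 'g + 'h" where
  "letter_inv H K (Inl a) = Inl (inv\<^bsub>H\<^esub> a)"
| "letter_inv H K (Inr a) = Inr (inv\<^bsub>K\<^esub> a)"

text \<open>Normal forms are stored in reverse, so that multiplication on the right acts at the head.\<close>

fun nf_push :: "('g, 'm) monoid_scheme \<Rightarrow> ('h, 'n) monoid_scheme \<Rightarrow> 'g + 'h \<Rightarrow> ('g + 'h) list \<Rightarrow> ('g + 'h) list" where
  "nf_push H K x [] = (if letter_one H K x then [] else [x])"
| "nf_push H K x (y # ws) =
    (if isl y = isl x
     then if letter_one H K (letter_mult H K y x) then ws else letter_mult H K y x # ws
     else if letter_one H K x then y # ws else x # y # ws)"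

fun nf_reduced :: "('g, 'm) monoid_scheme \<Rightarrow> ('h, 'n) monoid_scheme \<Rightarrow> ('g + 'h) list \<Rightarrow> bool" where
  "nf_reduced H K [] \<longleftrightarrow> True"
| "nf_reduced H K (x # ws) \<longleftrightarrow> x \<in> carrier H <+> carrier K \<and> \<not> letter_one H K x \<and>
    (ws = [] \<or> isl (hd ws) \<noteq> isl x) \<and> nf_reduced H K ws"

text \<open>Van der Waerden's method: words act on reduced sequences from the right, so that
  uniqueness of normal forms becomes the statement that this action respects the relators.\<close>

definition nf_act :: "('g, 'm) monoid_scheme \<Rightarrow> ('h, 'n) monoid_scheme \<Rightarrow> ('g + 'h) gword \<Rightarrow> ('g + 'h) list \<Rightarrow> ('g + 'h) list" where
  "nf_act H K u ws = fold (\<lambda>(x, b). nf_push H K (if b then x else letter_inv H K x)) u ws"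

abbreviation fp_gens :: "('g, 'm) monoid_scheme \<Rightarrow> ('h, 'n) monoid_scheme \<Rightarrow> ('g + 'h) set" where
  "fp_gens H K \<equiv> carrier H <+> carrier K"

abbreviation fp_relators :: "('g, 'm) monoid_scheme \<Rightarrow> ('h, 'n) monoid_scheme \<Rightarrow> ('g + 'h) gword set" where
  "fp_relators H K \<equiv>
     {[(Inl a, True), (Inl b, True), (Inl (a \<otimes>\<^bsub>H\<^esub> b), False)] | a b. a \<in> carrier H \<and> b \<in> carrier H} \<union>
     {[(Inr a, True), (Inr b, True), (Inr (a \<otimes>\<^bsub>K\<^esub> b), False)] | a b. a \<in> carrier K \<and> b \<in> carrier K}"

lemma nf_act_append: "nf_act H K (u @ v) ws = nf_act H K v (nf_act H K u ws)"
  by (simp add: nf_act_def)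

lemma nf_act_simps [simp]:
  "nf_act H K [] ws = ws"
  "nf_act H K ((x, b) # u) ws = nf_act H K u (nf_push H K (if b then x else letter_inv H K x) ws)"
  by (simp_all add: nf_act_def)

context
  fixes H :: "('g, 'm) monoid_scheme" and K :: "('h, 'n) monoid_scheme"
  assumes H: "group H" and K: "group K"
begin

interpretation H: group H by (fact H)
interpretation K: group K by (fact K)

lemma letter_inv_closed: "x \<in> fp_gens H K \<Longrightarrow> letter_inv H K x \<in> fp_gens H K"
  by (cases x) auto

lemma nf_push_reduced:
  assumes "nf_reduced H K ws" "x \<in> fp_gens H K"
  shows "nf_reduced H K (nf_push H K x ws)"
proof (cases ws)
  case Nil
  then show ?thesis using assms by auto
next
  case (Cons y vs)
  then show ?thesis using assms by (cases x; cases y) (auto simp: letter_one_def)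
qed

lemma nf_push_one:
  "nf_reduced H K ws \<Longrightarrow> letter_one H K x \<Longrightarrow> nf_push H K x ws = ws"
  by (cases ws; cases x) (auto simp: letter_one_def split: if_splits)

text \<open>Associativity in the factor settles this unless \<open>x\<close> cancels the head of
  \<open>ws\<close>. In that case the rest begins with a letter of the other factor, so
  \<open>y\<close> is either stacked on it or trivial.\<close>

lemma nf_push_mult:
  assumes "nf_reduced H K ws" "x \<in> fp_gens H K" "y \<in> fp_gens H K" "isl x = isl y"
  shows "nf_push H K y (nf_push H K x ws) = nf_push H K (letter_mult H K x y) ws"
proof (cases ws)
  case Nil
  then show ?thesis using assms by (cases x; cases y) (auto simp: letter_one_def)
next
  case (Cons z vs)
  show ?thesis
  proof (cases "isl z = isl x")
    case False
    then show ?thesis using assms Cons by (cases x; cases y; cases z) (auto simp: letter_one_def)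
  next
    case True
    show ?thesis
    proof (cases "letter_one H K (letter_mult H K z x)")
      case False
      then show ?thesis using assms Cons True
        by (cases x; cases y; cases z) (auto simp: letter_one_def H.m_assoc K.m_assoc)
    next
      case one: True
      have zxy: "letter_mult H K z (letter_mult H K x y) = y"
        using one assms Cons True
        by (cases x; cases y; cases z) (auto simp: letter_one_def H.m_assoc[symmetric] K.m_assoc[symmetric])
      have "nf_push H K x ws = vs" using one Cons True by simp
      moreover have "nf_push H K (letter_mult H K x y) ws = (if letter_one H K y then vs else y # vs)"
        using zxy Cons True assms(4) by (cases x; cases y) (auto simp del: letter_mult.simps(1,2), (metis letter_mult.simps sum.disc)+)
      moreover have "nf_push H K y vs = (if letter_one H K y then vs else y # vs)"
        using assms Cons True by (cases vs) auto
      ultimately show ?thesis by simp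
    qed
  qed
qed

lemma nf_act_reduced:
  "u \<in> gwords (fp_gens H K) \<Longrightarrow> nf_reduced H K ws \<Longrightarrow> nf_reduced H K (nf_act H K u ws)"
proof (induction u arbitrary: ws)
  case (Cons l u)
  then show ?case by (cases l) (simp add: nf_push_reduced letter_inv_closed)
qed simp

lemma nf_act_pres_eq:
  assumes "pres_eq (fp_gens H K) (fp_relators H K) u v" "nf_reduced H K ws"
  shows "nf_act H K u ws = nf_act H K v ws"
proof -
  have inv: "nf_push H K (letter_inv H K x) (nf_push H K x ws) = ws"
    "nf_push H K x (nf_push H K (letter_inv H K x) ws) = ws"
    if "x \<in> fp_gens H K" "nf_reduced H K ws" for x ws
  proof -
    have "isl x = isl (letter_inv H K x)" by (cases x) auto
    moreover have "letter_one H K (letter_mult H K x (letter_inv H K x))"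
      "letter_one H K (letter_mult H K (letter_inv H K x) x)"
      using that(1) by (cases x; force simp: letter_one_def)+
    ultimately show "nf_push H K (letter_inv H K x) (nf_push H K x ws) = ws"
      "nf_push H K x (nf_push H K (letter_inv H K x) ws) = ws"
      using that by (simp_all add: nf_push_mult nf_push_one letter_inv_closed)
  qed
  have rel: "nf_act H K r ws = ws" if r: "r \<in> fp_relators H K" and ws: "nf_reduced H K ws" for r ws
  proof -
    obtain x y where xy: "x \<in> fp_gens H K" "y \<in> fp_gens H K" "isl x = isl y"
      "r = [(x, True), (y, True), (letter_mult H K x y, False)]"
      using r
    proof (elim UnE CollectE exE conjE)
      fix a b assume "r = [(Inl a, True), (Inl b, True), (Inl (a \<otimes>\<^bsub>H\<^esub> b), False)]" "a \<in> carrier H" "b \<in> carrier H"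
      then show ?thesis by (intro that[of "Inl a" "Inl b"]) auto
    next
      fix a b assume "r = [(Inr a, True), (Inr b, True), (Inr (a \<otimes>\<^bsub>K\<^esub> b), False)]" "a \<in> carrier K" "b \<in> carrier K"
      then show ?thesis by (intro that[of "Inr a" "Inr b"]) auto
    qed
    then have "letter_mult H K x y \<in> fp_gens H K" by (cases x; cases y) auto
    then show ?thesis using xy ws inv(1) by (simp add: nf_push_mult)
  qed
  show ?thesis
    using assms
  proof (induction arbitrary: ws rule: pres_eq.induct)
    case (cancel u v x b)
    then show ?case
      using inv nf_act_reduced[of u ws] by (simp add: nf_act_append)
  next
    case (relator u v r)
    then show ?case
      using rel nf_act_reduced[of u ws] by (simp add: nf_act_append)
  qed auto
qed

section \<open>Normal forms as elements of the free product\<close>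

abbreviation fp_letter :: "'g + 'h \<Rightarrow> ('g + 'h) gword set" where
  "fp_letter \<equiv> pres_gen (fp_gens H K) (fp_relators H K)"

lemma free_product_altdef: "free_product H K = presented_group (fp_gens H K) (fp_relators H K)"
  by (simp add: free_product_def Plus_def)

interpretation P: group "free_product H K"
  unfolding free_product_altdef by (rule group_presented_group)

lemma fp_letter_closed [simp]: "x \<in> fp_gens H K \<Longrightarrow> fp_letter x \<in> carrier (free_product H K)"
  by (simp add: free_product_altdef)

lemma fp_letter_mult:
  assumes "x \<in> fp_gens H K" "y \<in> fp_gens H K" "isl x = isl y"
  shows "fp_letter (letter_mult H K x y) = fp_letter x \<otimes>\<^bsub>free_product H K\<^esub> fp_letter y"
proof -
  let ?z = "letter_mult H K x y"
  have z: "?z \<in> fp_gens H K" using assms by (cases x; cases y) auto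
  have "[(x, True), (y, True), (?z, False)] \<in> fp_relators H K"
    using assms by (cases x; cases y) auto
  then have "pres_class (fp_gens H K) (fp_relators H K) [(x, True), (y, True), (?z, False)] = \<one>\<^bsub>free_product H K\<^esub>"
    unfolding free_product_altdef by (rule pres_class_relator) (use assms z in simp)
  then have "fp_letter x \<otimes>\<^bsub>free_product H K\<^esub> (fp_letter y \<otimes>\<^bsub>free_product H K\<^esub> inv\<^bsub>free_product H K\<^esub> fp_letter ?z)
      = \<one>\<^bsub>free_product H K\<^esub>"
    using assms(1,2) z
    by (subst (asm) pres_class_eval) (simp_all add: free_product_altdef[symmetric])
  then have "\<one>\<^bsub>free_product H K\<^esub> =
      (fp_letter x \<otimes>\<^bsub>free_product H K\<^esub> fp_letter y) \<otimes>\<^bsub>free_product H K\<^esub> inv\<^bsub>free_product H K\<^esub> fp_letter ?z"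
    using assms(1,2) z by (simp add: P.m_assoc)
  then have "fp_letter x \<otimes>\<^bsub>free_product H K\<^esub> fp_letter y = \<one>\<^bsub>free_product H K\<^esub> \<otimes>\<^bsub>free_product H K\<^esub> fp_letter ?z"
    by (subst (asm) P.inv_solve_right) (use assms(1,2) z in simp_all)
  then show ?thesis using z by simp
qed

text \<open>The relator for the product of \<open>x\<close> with itself makes the letter an
  idempotent of a group.\<close>

lemma fp_letter_one:
  assumes "x \<in> fp_gens H K" "letter_one H K x"
  shows "fp_letter x = \<one>\<^bsub>free_product H K\<^esub>"
proof -
  have "letter_mult H K x x = x" using assms by (cases x) (auto simp: letter_one_def)
  then have "fp_letter x \<otimes>\<^bsub>free_product H K\<^esub> fp_letter x = fp_letter x"
    using fp_letter_mult[of x x] assms by simp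
  then show ?thesis using assms by simp
qed

lemma fp_letter_inv:
  assumes "x \<in> fp_gens H K"
  shows "fp_letter (letter_inv H K x) = inv\<^bsub>free_product H K\<^esub> fp_letter x"
proof -
  have "fp_letter (letter_inv H K x) \<otimes>\<^bsub>free_product H K\<^esub> fp_letter x
      = fp_letter (letter_mult H K (letter_inv H K x) x)"
    using assms by (subst fp_letter_mult) (auto simp: letter_inv_closed)
  also have "\<dots> = \<one>\<^bsub>free_product H K\<^esub>"
    using assms by (intro fp_letter_one; cases x) (auto simp: letter_one_def)
  finally show ?thesis using assms by (simp add: P.inv_equality letter_inv_closed)
qed

fun nf_val :: "('g + 'h) list \<Rightarrow> ('g + 'h) gword set" where
  "nf_val [] = \<one>\<^bsub>free_product H K\<^esub>"
| "nf_val (x # ws) = nf_val ws \<otimes>\<^bsub>free_product H K\<^esub> fp_letter x"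

lemma nf_val_closed: "nf_reduced H K ws \<Longrightarrow> nf_val ws \<in> carrier (free_product H K)"
  by (induction ws) auto

lemma nf_val_push:
  assumes "nf_reduced H K ws" "x \<in> fp_gens H K"
  shows "nf_val (nf_push H K x ws) = nf_val ws \<otimes>\<^bsub>free_product H K\<^esub> fp_letter x"
proof (cases ws)
  case Nil
  then show ?thesis using assms fp_letter_one by auto
next
  case (Cons y vs)
  have y: "y \<in> fp_gens H K" "nf_reduced H K vs" using assms Cons by auto
  note closed = fp_letter_closed[OF assms(2)] fp_letter_closed[OF y(1)] nf_val_closed[OF y(2)]
  show ?thesis
  proof (cases "isl y = isl x")
    case True
    then have mult: "fp_letter (letter_mult H K y x) = fp_letter y \<otimes>\<^bsub>free_product H K\<^esub> fp_letter x"
      using assms y by (intro fp_letter_mult)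
    have "letter_mult H K y x \<in> fp_gens H K" using True assms y by (cases x; cases y) auto
    then show ?thesis
      using Cons True closed fp_letter_one[of "letter_mult H K y x"] by (auto simp: P.m_assoc mult)
  next
    case False
    then show ?thesis using Cons assms closed fp_letter_one by auto
  qed
qed

text \<open>For \<open>ws = []\<close> this says that the normal form of a word evaluates back to
  the class of the word. Together with \<open>nf_act_pres_eq\<close>, elements and their normal
  forms determine each other.\<close>

lemma nf_val_act:
  "u \<in> gwords (fp_gens H K) \<Longrightarrow> nf_reduced H K ws \<Longrightarrow>
    nf_val (nf_act H K u ws) =
      nf_val ws \<otimes>\<^bsub>free_product H K\<^esub> pres_class (fp_gens H K) (fp_relators H K) u"
proof (induction u arbitrary: ws)
  case Nil
  then show ?case
    using P.r_one[OF nf_val_closed[OF Nil(2)]] by (simp add: free_product_altdef one_presented_group)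
next
  case (Cons l u)
  obtain x b where l: "l = (x, b)" by (cases l)
  let ?y = "if b then x else letter_inv H K x"
  have x: "x \<in> fp_gens H K" "?y \<in> fp_gens H K" using Cons.prems l letter_inv_closed[of x] by auto
  have u: "pres_class (fp_gens H K) (fp_relators H K) u \<in> carrier (free_product H K)"
    using Cons.prems by (simp add: free_product_altdef)
  have "pres_class (fp_gens H K) (fp_relators H K) (l # u) =
      fp_letter ?y \<otimes>\<^bsub>free_product H K\<^esub> pres_class (fp_gens H K) (fp_relators H K) u"
    using Cons.prems l x(1) fp_letter_inv[of x] pres_class_Cons[of x b u "fp_gens H K" "fp_relators H K"]
    by (cases b) (simp_all add: free_product_altdef)
  then show ?case
    using Cons.IH[of "nf_push H K ?y ws"] Cons.prems l x u nf_push_reduced[of ws ?y]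
      nf_val_closed[of ws]
    by (simp add: nf_val_push P.m_assoc del: if_split)
qed

text \<open>The last entry is the first letter of the normal form, and multiplying on the right
  affects it only if the form has at most one letter. A letter of the first factor can exchange the
  empty form with a one-letter form of that factor, so the first claim counts the empty form in; for
  a letter of the second factor the empty form is counted out.\<close>

lemma nf_push_last_isl:
  assumes "nf_reduced H K ws" "x \<in> fp_gens H K"
  shows "isl x \<Longrightarrow> (nf_push H K x ws = [] \<or> isl (last (nf_push H K x ws))) \<longleftrightarrow> (ws = [] \<or> isl (last ws))"
    and "\<not> isl x \<Longrightarrow> (nf_push H K x ws \<noteq> [] \<and> isl (last (nf_push H K x ws))) \<longleftrightarrow> (ws \<noteq> [] \<and> isl (last ws))"
proof -
  have "isl (letter_mult H K y x) = isl y" for y by (cases x; cases y) auto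
  then show "isl x \<Longrightarrow> (nf_push H K x ws = [] \<or> isl (last (nf_push H K x ws))) \<longleftrightarrow> (ws = [] \<or> isl (last ws))"
    "\<not> isl x \<Longrightarrow> (nf_push H K x ws \<noteq> [] \<and> isl (last (nf_push H K x ws))) \<longleftrightarrow> (ws \<noteq> [] \<and> isl (last ws))"
    using assms by (cases ws; simp)+
qed

end

text \<open>\<open>E\<close> stands for the elements of \<open>A * B\<close> whose normal form begins with a letter from \<open>A\<close>. Its two
  invariance properties are all that is needed from normal forms in the sequel.\<close>

locale free_splitting = group G for G (structure) +
  fixes A B E :: "'a set"
  assumes subgroup_A: "subgroup A G" and subgroup_B: "subgroup B G"
    and A_nontrivial: "A \<noteq> {\<one>}" and B_nontrivial: "B \<noteq> {\<one>}"
    and generate_AB: "generate G (A \<union> B) = carrier G"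
    and one_notin_E: "\<one> \<notin> E"
    and E_right_B: "\<lbrakk>g \<in> carrier G; b \<in> B\<rbrakk> \<Longrightarrow> g \<otimes> b \<in> E \<longleftrightarrow> g \<in> E"
    and E_right_A: "\<lbrakk>g \<in> carrier G; a \<in> A\<rbrakk> \<Longrightarrow> g \<otimes> a \<in> insert \<one> E \<longleftrightarrow> g \<in> insert \<one> E"

text \<open>\<open>A\<close> and \<open>B\<close> are the images of the factors. That they are
  nontrivial is read off from the action of a single letter on the empty normal form.\<close>

lemma free_splitting_free_product:
  assumes H: "group H" "\<not> trivial_group H" and K: "group K" "\<not> trivial_group K"
  shows "\<exists>A B E. free_splitting (free_product H K) A B E"
proof -
  interpret H: group H by fact
  interpret K: group K by fact
  let ?P = "free_product H K" and ?X = "fp_gens H K" and ?R = "fp_relators H K"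
  note alt = free_product_altdef[OF H(1) K(1)]
  interpret P: group ?P unfolding alt by (rule group_presented_group)
  let ?\<iota> = "fp_letter H K" and ?c = "pres_class ?X ?R"
  note mult = fp_letter_mult[OF H(1) K(1)] and one = fp_letter_one[OF H(1) K(1)]
    and closed = fp_letter_closed[OF H(1) K(1)] and inv = fp_letter_inv[OF H(1) K(1)]
  define A where "A = (\<lambda>a. ?\<iota> (Inl a)) ` carrier H"
  define B where "B = (\<lambda>b. ?\<iota> (Inr b)) ` carrier K"
  have A_I: "?\<iota> (Inl a) \<in> A" if "a \<in> carrier H" for a using that by (simp add: A_def)
  have B_I: "?\<iota> (Inr b) \<in> B" if "b \<in> carrier K" for b using that by (simp add: B_def)
  have eq_act: "nf_act H K u [] = nf_act H K v []" if "?c u = ?c v" "u \<in> gwords ?X" for u v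
    using that nf_act_pres_eq[OF H(1) K(1), of u v "[]"] by (simp add: pres_class_eq_iff)
  \<comment> \<open>Words with the same class act in the same way (\<open>eq_act\<close>), so
    membership may be tested on any representative.\<close>
  define E where "E = {g. \<exists>u\<in>gwords ?X. g = ?c u \<and> nf_act H K u [] \<noteq> [] \<and> isl (last (nf_act H K u []))}"
  have E: "?c u \<in> E \<longleftrightarrow> nf_act H K u [] \<noteq> [] \<and> isl (last (nf_act H K u []))" if "u \<in> gwords ?X" for u
  proof
    assume "?c u \<in> E"
    then obtain v where v: "?c u = ?c v" "nf_act H K v [] \<noteq> [] \<and> isl (last (nf_act H K v []))"
      unfolding E_def by blast
    show "nf_act H K u [] \<noteq> [] \<and> isl (last (nf_act H K u []))"
      unfolding eq_act[OF v(1) that] by (rule v(2))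
  qed (use that in \<open>unfold E_def, blast\<close>)
  have one_iff: "?c u = \<one>\<^bsub>?P\<^esub> \<longleftrightarrow> nf_act H K u [] = []" if u: "u \<in> gwords ?X" for u
  proof
    assume "?c u = \<one>\<^bsub>?P\<^esub>"
    then show "nf_act H K u [] = []" using eq_act[of u "[]"] u by (simp add: alt one_presented_group)
  next
    assume "nf_act H K u [] = []"
    then show "?c u = \<one>\<^bsub>?P\<^esub>"
      using nf_val_act[OF H(1) K(1) u, of "[]"] u P.l_one[of "?c u"] by (simp add: alt nf_val.simps[OF H(1) K(1)])
  qed
  have mult_gen: "?c u \<otimes>\<^bsub>?P\<^esub> ?\<iota> x = ?c (u @ [(x, True)])" if "u \<in> gwords ?X" "x \<in> ?X" for u x
    using that by (simp add: alt presented_group_mult)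
  have red: "nf_reduced H K (nf_act H K u [])" if "u \<in> gwords ?X" for u
    using nf_act_reduced[OF H(1) K(1) that, of "[]"] by simp
  note last = nf_push_last_isl[OF H(1) K(1) red]
  have "free_splitting ?P A B E"
  proof (intro free_splitting.intro free_splitting_axioms.intro P.group_axioms)
    show "subgroup A ?P"
    proof
      fix x y assume "x \<in> A" "y \<in> A"
      then obtain a b where ab: "a \<in> carrier H" "x = ?\<iota> (Inl a)" "b \<in> carrier H" "y = ?\<iota> (Inl b)"
        unfolding A_def by blast
      then have "x \<otimes>\<^bsub>?P\<^esub> y = ?\<iota> (letter_mult H K (Inl a) (Inl b))"
        by (subst mult) auto
      then show "x \<otimes>\<^bsub>?P\<^esub> y \<in> A" using ab A_I by simp
    next
      have "?\<iota> (Inl \<one>\<^bsub>H\<^esub>) = \<one>\<^bsub>?P\<^esub>" by (rule one) (auto simp: letter_one_def)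
      then show "\<one>\<^bsub>?P\<^esub> \<in> A" using A_I[of "\<one>\<^bsub>H\<^esub>"] by simp
    next
      fix x assume "x \<in> A"
      then obtain a where a: "a \<in> carrier H" "x = ?\<iota> (Inl a)" unfolding A_def by blast
      then have "inv\<^bsub>?P\<^esub> x = ?\<iota> (letter_inv H K (Inl a))" by (subst inv) auto
      then show "inv\<^bsub>?P\<^esub> x \<in> A" using a A_I by simp
    qed (use closed[OF InlI] in \<open>auto simp: A_def\<close>)
    show "subgroup B ?P"
    proof
      fix x y assume "x \<in> B" "y \<in> B"
      then obtain a b where ab: "a \<in> carrier K" "x = ?\<iota> (Inr a)" "b \<in> carrier K" "y = ?\<iota> (Inr b)"
        unfolding B_def by blast
      then have "x \<otimes>\<^bsub>?P\<^esub> y = ?\<iota> (letter_mult H K (Inr a) (Inr b))"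
        by (subst mult) auto
      then show "x \<otimes>\<^bsub>?P\<^esub> y \<in> B" using ab B_I by simp
    next
      have "?\<iota> (Inr \<one>\<^bsub>K\<^esub>) = \<one>\<^bsub>?P\<^esub>" by (rule one) (auto simp: letter_one_def)
      then show "\<one>\<^bsub>?P\<^esub> \<in> B" using B_I[of "\<one>\<^bsub>K\<^esub>"] by simp
    next
      fix x assume "x \<in> B"
      then obtain a where a: "a \<in> carrier K" "x = ?\<iota> (Inr a)" unfolding B_def by blast
      then have "inv\<^bsub>?P\<^esub> x = ?\<iota> (letter_inv H K (Inr a))" by (subst inv) auto
      then show "inv\<^bsub>?P\<^esub> x \<in> B" using a B_I by simp
    qed (use closed[OF InrI] in \<open>auto simp: B_def\<close>)
    obtain a where a: "a \<in> carrier H" "a \<noteq> \<one>\<^bsub>H\<^esub>" using H by (auto simp: trivial_group_def)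
    have "nf_act H K [(Inl a, True)] [] \<noteq> []" using a by (simp add: letter_one_def)
    moreover have "[(Inl a, True)] \<in> gwords ?X" using a by auto
    ultimately have "?\<iota> (Inl a) \<noteq> \<one>\<^bsub>?P\<^esub>" by (simp only: one_iff not_False_eq_True)
    then show "A \<noteq> {\<one>\<^bsub>?P\<^esub>}" using A_I[of a] a(1) by auto
    obtain b where b: "b \<in> carrier K" "b \<noteq> \<one>\<^bsub>K\<^esub>" using K by (auto simp: trivial_group_def)
    have "nf_act H K [(Inr b, True)] [] \<noteq> []" using b by (simp add: letter_one_def)
    moreover have "[(Inr b, True)] \<in> gwords ?X" using b by auto
    ultimately have "?\<iota> (Inr b) \<noteq> \<one>\<^bsub>?P\<^esub>" by (simp only: one_iff not_False_eq_True)
    then show "B \<noteq> {\<one>\<^bsub>?P\<^esub>}" using B_I[of b] b(1) by auto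
    have AB: "A \<union> B \<subseteq> carrier ?P"
      using closed[OF InlI] closed[OF InrI] by (auto simp: A_def B_def)
    show "generate ?P (A \<union> B) = carrier ?P"
    proof
      show "carrier ?P \<subseteq> generate ?P (A \<union> B)"
      proof
        fix g assume "g \<in> carrier ?P"
        then obtain u where u: "u \<in> gwords ?X" "g = ?c u" unfolding alt by (rule presented_group_cases)
        have "?\<iota> \<in> ?X \<rightarrow> generate ?P (A \<union> B)"
          using A_I B_I by (auto intro!: generate.incl)
        then show "g \<in> generate ?P (A \<union> B)"
          using u P.gword_eval_in_subgroup[OF P.generate_is_subgroup[OF AB], of ?\<iota> ?X u]
          by (simp add: pres_class_eval[of u] alt)
      qed
    qed (rule P.generate_incl[OF AB])
    show "\<one>\<^bsub>?P\<^esub> \<notin> E" using E[of "[]"] by (simp add: alt one_presented_group)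
    fix g assume "g \<in> carrier ?P"
    then obtain u where u: "u \<in> gwords ?X" "g = ?c u" unfolding alt by (rule presented_group_cases)
    show "g \<otimes>\<^bsub>?P\<^esub> b \<in> E \<longleftrightarrow> g \<in> E" if b: "b \<in> B" for b
    proof -
      obtain k where "k \<in> carrier K" "b = ?\<iota> (Inr k)" using b unfolding B_def by (elim imageE)
      then show ?thesis using u last(2)[of u "Inr k"] InrI[of k "carrier K" "carrier H"] by (simp add: mult_gen E nf_act_append)
    qed
    show "g \<otimes>\<^bsub>?P\<^esub> a \<in> insert \<one>\<^bsub>?P\<^esub> E \<longleftrightarrow> g \<in> insert \<one>\<^bsub>?P\<^esub> E" if a: "a \<in> A" for a
    proof -
      obtain h where h: "h \<in> carrier H" "a = ?\<iota> (Inl h)" using a unfolding A_def by blast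
      have "?c v \<in> insert \<one>\<^bsub>?P\<^esub> E \<longleftrightarrow> nf_act H K v [] = [] \<or> isl (last (nf_act H K v []))"
        if "v \<in> gwords ?X" for v
        using one_iff[OF that] E[OF that] by (simp only: insert_iff) blast
      then show ?thesis
        using h u last(1)[of u "Inl h"] InlI[of h "carrier H" "carrier K"] by (simp add: mult_gen nf_act_append)
    qed
  qed
  then show ?thesis by blast
qed

lemma splits_as_free_product_imp_free_splitting:
  fixes G (structure)
  assumes "group G" "splits_as_free_product G"
  shows "\<exists>A B E. free_splitting G A B E"
proof -
  obtain H K :: "'a monoid" where HK: "group H" "group K" "\<not> trivial_group H" "\<not> trivial_group K"
    "G \<cong> free_product H K"
    using assms(2) unfolding splits_as_free_product_def by blast
  obtain A B E where "free_splitting (free_product H K) A B E"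
    using free_splitting_free_product HK by blast
  then interpret F: free_splitting "free_product H K" A B E .
  interpret G: group G by fact
  obtain \<phi> where \<phi>: "\<phi> \<in> iso G (free_product H K)" using HK(5) by (auto simp: is_iso_def)
  define \<psi> where "\<psi> = inv_into (carrier G) \<phi>"
  have \<psi>: "\<psi> \<in> iso (free_product H K) G" unfolding \<psi>_def by (rule G.iso_set_sym[OF \<phi>])
  then interpret \<psi>: group_hom "free_product H K" G \<psi>
    by unfold_locales (simp add: iso_def)
  interpret \<phi>: group_hom G "free_product H K" \<phi> using \<phi>
    by unfold_locales (simp add: iso_def)
  have bij: "bij_betw \<phi> (carrier G) (carrier (free_product H K))" using \<phi> by (simp add: iso_def)
  have \<phi>\<psi>: "\<phi> (\<psi> x) = x" if "x \<in> carrier (free_product H K)" for x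
    using that bij unfolding \<psi>_def by (simp add: bij_betw_inv_into_right)
  have \<psi>\<phi>: "\<psi> (\<phi> x) = x" if "x \<in> carrier G" for x
    using that bij unfolding \<psi>_def by (simp add: bij_betw_inv_into_left)
  have sub: "A \<subseteq> carrier (free_product H K)" "B \<subseteq> carrier (free_product H K)"
    using F.subgroup_A F.subgroup_B by (auto dest: subgroup.subset)
  let ?E = "{g \<in> carrier G. \<phi> g \<in> E}"
  have "free_splitting G (\<psi> ` A) (\<psi> ` B) ?E"
  proof (intro free_splitting.intro free_splitting_axioms.intro assms(1))
    show "subgroup (\<psi> ` A) G" "subgroup (\<psi> ` B) G"
      using \<psi>.subgroup_img_is_subgroup F.subgroup_A F.subgroup_B by auto
    have nontrivial: "\<psi> ` C \<noteq> {\<one>\<^bsub>G\<^esub>}"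
      if C: "subgroup C (free_product H K)" "C \<noteq> {\<one>\<^bsub>free_product H K\<^esub>}" for C
    proof
      assume triv: "\<psi> ` C = {\<one>\<^bsub>G\<^esub>}"
      have "c = \<one>\<^bsub>free_product H K\<^esub>" if "c \<in> C" for c
      proof -
        have "\<psi> c = \<one>\<^bsub>G\<^esub>" using triv that by blast
        moreover have "\<phi> (\<psi> c) = c" using \<phi>\<psi> that subgroup.subset[OF C(1)] by blast
        ultimately show ?thesis by simp
      qed
      then show False using C subgroup.one_closed[OF C(1)] by blast
    qed
    show "\<psi> ` A \<noteq> {\<one>\<^bsub>G\<^esub>}" "\<psi> ` B \<noteq> {\<one>\<^bsub>G\<^esub>}"
      using nontrivial F.subgroup_A F.subgroup_B F.A_nontrivial F.B_nontrivial by simp_all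
    have "generate G (\<psi> ` (A \<union> B)) = \<psi> ` carrier (free_product H K)"
      using \<psi>.generate_img[of "A \<union> B"] sub by (simp add: F.generate_AB)
    also have "\<dots> = carrier G" using \<psi> by (simp add: iso_def bij_betw_def)
    finally show "generate G (\<psi> ` A \<union> \<psi> ` B) = carrier G" by (simp add: image_Un)
    show "\<one>\<^bsub>G\<^esub> \<notin> ?E" using F.one_notin_E by simp
    fix g assume g: "g \<in> carrier G"
    show "g \<otimes>\<^bsub>G\<^esub> b \<in> ?E \<longleftrightarrow> g \<in> ?E" if "b \<in> \<psi> ` B" for b
      using that g sub F.E_right_B[of "\<phi> g"] by (auto simp: \<phi>\<psi> subset_iff)
    have one: "\<phi> x = \<one>\<^bsub>free_product H K\<^esub> \<longleftrightarrow> x = \<one>\<^bsub>G\<^esub>" if "x \<in> carrier G" for x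
      using that \<psi>\<phi>[OF that] by auto
    have ins: "x \<in> insert \<one>\<^bsub>G\<^esub> ?E \<longleftrightarrow> \<phi> x \<in> insert \<one>\<^bsub>free_product H K\<^esub> E" if "x \<in> carrier G" for x
      using that one by auto
    show "g \<otimes>\<^bsub>G\<^esub> a \<in> insert \<one>\<^bsub>G\<^esub> ?E \<longleftrightarrow> g \<in> insert \<one>\<^bsub>G\<^esub> ?E" if a: "a \<in> \<psi> ` A" for a
    proof -
      obtain h where h: "h \<in> A" "a = \<psi> h" using a by blast
      then have "a \<in> carrier G" "\<phi> a = h" using sub \<phi>\<psi> by auto
      then show ?thesis
        using g h F.E_right_A[of "\<phi> g" h] by (simp only: ins G.m_closed \<phi>.hom_mult \<phi>.hom_closed)
    qed
  qed
  then show ?thesis by blast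
qed

section \<open>Characters and almost invariant sets\<close>

context group
begin

lemma character_mult:
  "\<lbrakk>chi \<in> hom G real_additive_group; g \<in> carrier G; h \<in> carrier G\<rbrakk> \<Longrightarrow> chi (g \<otimes> h) = chi g + chi h"
  by (simp add: hom_def real_additive_group_def)

lemma character_one:
  assumes "chi \<in> hom G real_additive_group" shows "chi \<one> = 0"
  using character_mult[OF assms one_closed one_closed] by simp

lemma character_inv:
  assumes "chi \<in> hom G real_additive_group" "g \<in> carrier G" shows "chi (inv g) = - chi g"
  using character_mult[OF assms(1), of "inv g" g] character_one[OF assms(1)] assms(2) by simp

lemma character_pow:
  assumes "chi \<in> hom G real_additive_group" "g \<in> carrier G" shows "chi (g [^] (n :: nat)) = n * chi g"
proof (induction n)
  case 0
  then show ?case using character_one[OF assms(1)] by simp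
next
  case (Suc n)
  then show ?case using character_mult[OF assms(1), of "g [^] n" g] assms(2) by (simp add: algebra_simps)
qed

lemma character_eq_0_on_generate:
  assumes chi: "chi \<in> hom G real_additive_group" and S: "S \<subseteq> carrier G" "\<And>s. s \<in> S \<Longrightarrow> chi s = 0"
    and "g \<in> generate G S"
  shows "chi g = 0"
  using assms(4)
proof (induction rule: generate.induct)
  case (eng g h)
  then show ?case using character_mult[OF chi] generate_in_carrier[OF S(1)] by simp
qed (use S character_one[OF chi] character_inv[OF chi] in auto)

end

section \<open>Almost invariance of \<open>E\<close>, and characters on its two sides\<close>

context free_splitting
begin

text \<open>Elements of \<open>B\<close> move nothing across \<open>E\<close>, and \<open>s\<close>
  in \<open>A\<close> can do so only at \<open>\<one>\<close> and at \<open>inv s\<close>, the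
  places where \<open>\<one>\<close> itself is involved. For a product, the places where membership
  changes come from those of the two factors, up to a translation.\<close>

lemma finite_boundary:
  assumes "s \<in> carrier G"
  shows "finite {g \<in> carrier G. (g \<in> E) \<noteq> (g \<otimes> s \<in> E)}"
proof -
  let ?D = "\<lambda>s. {g \<in> carrier G. (g \<in> E) \<noteq> (g \<otimes> s \<in> E)}"
  have AB: "A \<union> B \<subseteq> carrier G" using subgroup_A subgroup_B by (auto dest: subgroup.subset)
  have D: "finite (?D s)" if s: "s \<in> A \<union> B" for s
  proof (cases "s \<in> B")
    case True
    then have "?D s = {}" using E_right_B by blast
    then show ?thesis by (simp only: finite.emptyI)
  next
    case False
    have "?D s \<subseteq> {\<one>, inv s}"
    proof
      fix g assume g: "g \<in> ?D s"
      have "s \<in> A" using False s by blast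
      then have "g \<otimes> s \<in> insert \<one> E \<longleftrightarrow> g \<in> insert \<one> E" using g E_right_A by blast
      then have "g = \<one> \<or> g \<otimes> s = \<one>" using g by blast
      then show "g \<in> {\<one>, inv s}" using g s AB inv_equality[of g s] by auto
    qed
    then show ?thesis by (rule finite_subset) simp
  qed
  from assms have "s \<in> generate G (A \<union> B)" by (simp add: generate_AB)
  then show ?thesis
  proof (induction rule: generate.induct)
    case one
    have "?D \<one> = {}" by auto
    then show ?case by (simp only: finite.emptyI)
  next
    case (incl h)
    then show ?case by (rule D)
  next
    case (inv h)
    then have "inv h \<in> A \<union> B" using subgroup_A subgroup_B by (auto intro: subgroup.m_inv_closed)
    then show ?case by (rule D)
  next
    case (eng s t)
    then have st: "s \<in> carrier G" "t \<in> carrier G" by (auto dest: generate_in_carrier[OF AB])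
    have "?D (s \<otimes> t) \<subseteq> ?D s \<union> (\<lambda>g. g \<otimes> inv s) ` ?D t"
    proof
      fix g assume g: "g \<in> ?D (s \<otimes> t)"
      show "g \<in> ?D s \<union> (\<lambda>g. g \<otimes> inv s) ` ?D t"
      proof (cases "g \<in> ?D s")
        case False
        then have "g \<otimes> s \<in> ?D t" using g st by (simp add: m_assoc)
        moreover have "g = (g \<otimes> s) \<otimes> inv s" using g st by (simp add: m_assoc)
        ultimately show ?thesis by blast
      qed simp
    qed
    then show ?case using eng by (meson finite_Un finite_imageI finite_subset)
  qed
qed

text \<open>\<open>chi\<close> is nonzero on \<open>A\<close> or on \<open>B\<close>, hence positive
  at some \<open>x\<close> in one of them. Large powers of \<open>x\<close>, preceded where
  necessary by a fixed nontrivial \<open>a\<close> or \<open>b\<close> to start on the wanted side,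
  stay on that side while \<open>chi\<close> grows.\<close>

lemma character_unbounded:
  assumes chi: "chi \<in> hom G real_additive_group" "\<exists>g\<in>carrier G. chi g \<noteq> 0"
  shows "\<exists>g\<in>carrier G \<inter> E. c \<le> chi g" and "\<exists>g\<in>carrier G - E. c \<le> chi g"
proof -
  have AB: "A \<union> B \<subseteq> carrier G" using subgroup_A subgroup_B by (auto dest: subgroup.subset)
  have "\<exists>x\<in>A \<union> B. chi x \<noteq> 0"
    using character_eq_0_on_generate[OF chi(1) AB] chi(2) generate_AB by blast
  then obtain x0 where x0: "x0 \<in> A \<union> B" "chi x0 \<noteq> 0" by blast
  define x where "x = (if chi x0 > 0 then x0 else inv x0)"
  have inv: "inv x0 \<in> A" if "x0 \<in> A" using subgroup.m_inv_closed[OF subgroup_A that] .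
  have inv': "inv x0 \<in> B" if "x0 \<in> B" using subgroup.m_inv_closed[OF subgroup_B that] .
  have x: "x \<in> A \<or> x \<in> B" "chi x > 0"
    using x0 inv inv' character_inv[OF chi(1), of x0] AB by (auto simp: x_def)
  have xG: "x \<in> carrier G" using x AB by blast
  obtain a where a: "a \<in> A" "a \<noteq> \<one>" using A_nontrivial subgroup.one_closed[OF subgroup_A] by blast
  obtain b where b: "b \<in> B" "b \<noteq> \<one>" using B_nontrivial subgroup.one_closed[OF subgroup_B] by blast
  have ab: "a \<in> carrier G" "b \<in> carrier G" using a b AB by auto
  have AE: "h \<in> E" if "h \<in> A" "h \<noteq> \<one>" for h
  proof -
    have "h \<in> carrier G" using that AB by blast
    then show ?thesis using E_right_A[of \<one> h] that by simp
  qed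
  have BE: "k \<notin> E" if "k \<in> B" for k
  proof -
    have "k \<in> carrier G" using that AB by blast
    then show ?thesis using E_right_B[of \<one> k] that one_notin_E by simp
  qed
  \<comment> \<open>The exponent is positive so that the power differs from \<open>\<one>\<close>,
    which does not belong to \<open>E\<close>.\<close>
  have big: "\<exists>n > 0. c \<le> d + real n * chi x" for d
  proof -
    obtain m :: nat where m: "c - d \<le> real m * chi x"
      using reals_Archimedean3[OF x(2)] by (meson less_imp_le)
    have "real m * chi x \<le> real (Suc m) * chi x" using x(2) by (intro mult_right_mono) auto
    then show ?thesis using m by (intro exI[of _ "Suc m"]) auto
  qed
  obtain n where n: "n > 0" "c \<le> 0 + real n * chi x" using big by blast
  let ?p = "\<lambda>n :: nat. x [^] n"
  have pG: "?p n \<in> carrier G" for n using xG by simp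
  have chip: "chi (?p n) = n * chi x" for n by (rule character_pow[OF chi(1) xG])
  have p1: "?p n \<noteq> \<one>" if "n > 0" for n
    using chip[of n] character_one[OF chi(1)] that x(2) by force
  show "\<exists>g\<in>carrier G \<inter> E. c \<le> chi g"
  proof (cases "x \<in> A")
    case True
    then have "?p n \<in> A" using subgroup_A
      by (induction n) (auto intro: subgroup.m_closed subgroup.one_closed)
    then show ?thesis using AE p1 n pG chip by (intro bexI[of _ "?p n"]) auto
  next
    case False
    then have "?p m \<in> B" for m using x(1) subgroup_B
      by (induction m) (auto intro: subgroup.m_closed subgroup.one_closed)
    moreover obtain m where "c \<le> chi a + real m * chi x" using big by blast
    ultimately show ?thesis
      using E_right_B[of a "?p m"] AE[OF a] ab pG character_mult[OF chi(1), of a "?p m"] chip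
      by (intro bexI[of _ "a \<otimes> ?p m"]) auto
  qed
  show "\<exists>g\<in>carrier G - E. c \<le> chi g"
  proof (cases "x \<in> B")
    case True
    then have "?p n \<in> B" using subgroup_B
      by (induction n) (auto intro: subgroup.m_closed subgroup.one_closed)
    then show ?thesis using BE n pG chip by (intro bexI[of _ "?p n"]) auto
  next
    case False
    then have pA: "?p m \<in> A" for m using x(1) subgroup_A
      by (induction m) (auto intro: subgroup.m_closed subgroup.one_closed)
    moreover obtain m where "c \<le> chi b + real m * chi x" using big by blast
    moreover have "b \<otimes> ?p m \<notin> E"
      using E_right_A[of b "?p m"] pA BE[OF b(1)] b(2) ab by blast
    ultimately show ?thesis
      using ab pG character_mult[OF chi(1), of b "?p m"] chip
      by (intro bexI[of _ "b \<otimes> ?p m"]) auto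
  qed
qed

end

section \<open>Cayley graphs and half spaces of characters\<close>

lemma (in group) sym_cayley_graph: "sym (parcs (cayley_graph G S))"
  by (auto simp: cayley_graph_def sym_def)

lemma (in group) cayley_graph_connected:
  assumes "finite_generating_set G S" "g \<in> carrier G" "x \<in> carrier G"
  shows "(x, x \<otimes> g) \<in> (parcs (cayley_graph G S))\<^sup>*"
proof -
  have S: "S \<subseteq> carrier G" and "g \<in> generate G S" using assms by (auto simp: finite_generating_set_def)
  from this(2) assms(3) show ?thesis
  proof (induction arbitrary: x rule: generate.induct)
    case (incl h)
    then have "(x, x \<otimes> h) \<in> parcs (cayley_graph G S)" using S by (auto simp: cayley_graph_def)
    then show ?case by blast
  next
    case (inv h)
    then have "h \<in> carrier G" using S by blast
    moreover have "x = (x \<otimes> inv h) \<otimes> h" using inv.prems \<open>h \<in> carrier G\<close> by (simp add: m_assoc)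
    ultimately have "(x, x \<otimes> inv h) \<in> parcs (cayley_graph G S)"
      using inv unfolding cayley_graph_def by auto
    then show ?case by blast
  next
    case (eng s t)
    then have "s \<in> carrier G" "t \<in> carrier G" by (auto dest: generate_in_carrier[OF S])
    then have "(x, x \<otimes> s) \<in> (parcs (cayley_graph G S))\<^sup>*" "(x \<otimes> s, x \<otimes> s \<otimes> t) \<in> (parcs (cayley_graph G S))\<^sup>*"
      using eng by simp_all
    then show ?case using \<open>s \<in> carrier G\<close> \<open>t \<in> carrier G\<close> eng.prems by (simp add: m_assoc)
  qed simp
qed

context free_splitting
begin

text \<open>An arc is read as right multiplication by a generator from one of its two endpoints.
  Recording that endpoint is enough: an arc crossing between \<open>E\<close> and its complement
  always has an endpoint in this set.\<close>

definition cayley_boundary :: "'a set \<Rightarrow> 'a set" where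
  "cayley_boundary S = (\<Union>s\<in>S. {g \<in> carrier G. (g \<in> E) \<noteq> (g \<otimes> s \<in> E)})"

lemma finite_cayley_boundary: "finite_generating_set G S \<Longrightarrow> finite (cayley_boundary S)"
  unfolding cayley_boundary_def finite_generating_set_def using finite_boundary by blast

lemma arc_cayley_boundary:
  "(g, h) \<in> parcs (cayley_graph G S) \<Longrightarrow> g \<notin> cayley_boundary S \<Longrightarrow> h \<notin> cayley_boundary S \<Longrightarrow> g \<in> E \<longleftrightarrow> h \<in> E"
  unfolding cayley_boundary_def cayley_graph_def by auto

text \<open>If \<open>chi c\<close> is large, then the translate of \<open>E\<close> by the inverse of \<open>c\<close> has its boundary in the
  half space \<open>chi < 0\<close>, so it separates the half space \<open>chi \<ge> 0\<close>.\<close>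

lemma BNS_invariant_empty: "BNS_invariant G = {}"
proof (rule ccontr)
  assume "BNS_invariant G \<noteq> {}"
  then obtain chi S where chi: "chi \<in> nonzero_characters G" and S: "finite_generating_set G S"
    and con: "graph_connected (full_subgraph (cayley_graph G S) {g \<in> carrier G. chi g \<ge> 0})"
    unfolding BNS_invariant_def by blast
  let ?Q = "full_subgraph (cayley_graph G S) {g \<in> carrier G. chi g \<ge> 0}"
  have hom: "chi \<in> hom G real_additive_group" "\<exists>g\<in>carrier G. chi g \<noteq> 0"
    using chi by (auto simp: nonzero_characters_def)
  have "sym (parcs ?Q)" "parcs ?Q \<subseteq> pverts ?Q \<times> pverts ?Q"
    using sym_cayley_graph[of S] by (auto simp: full_subgraph_def sym_def)
  then have reach: "(u, v) \<in> (parcs ?Q)\<^sup>*"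
    if "u \<in> carrier G" "v \<in> carrier G" "chi u \<ge> 0" "chi v \<ge> 0" for u v
    using con that by (simp add: graph_connected_iff) (simp add: full_subgraph_def)
  have "finite (chi ` cayley_boundary S)" using finite_cayley_boundary[OF S] by simp
  then have "bdd_above (chi ` cayley_boundary S)" by simp
  then obtain M where M: "\<And>d. d \<in> cayley_boundary S \<Longrightarrow> chi d \<le> M" by (auto simp: bdd_above_def)
  obtain c where c: "c \<in> carrier G" "M + 1 \<le> chi c" using character_unbounded(1)[OF hom] by blast
  have inv: "c \<otimes> u \<in> E \<longleftrightarrow> c \<otimes> v \<in> E" if "(u, v) \<in> (parcs ?Q)\<^sup>*" for u v
    using that
  proof (induction rule: rtrancl_induct)
    case (step y z)
    have yz: "y \<in> carrier G" "z \<in> carrier G" "chi y \<ge> 0" "chi z \<ge> 0" "(y, z) \<in> parcs (cayley_graph G S)"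
      using step(2) by (auto simp: full_subgraph_def)
    \<comment> \<open>On the translate by \<open>c\<close> of the half space, \<open>chi\<close> is
      at least \<open>M + 1\<close>, beyond every boundary element.\<close>
    have "c \<otimes> y \<notin> cayley_boundary S" "c \<otimes> z \<notin> cayley_boundary S"
      using M[of "c \<otimes> y"] M[of "c \<otimes> z"] yz c character_mult[OF hom(1)] by auto
    moreover have "(c \<otimes> y, c \<otimes> z) \<in> parcs (cayley_graph G S)"
      using yz c S by (auto simp: cayley_graph_def m_assoc finite_generating_set_def subset_iff)
    ultimately show ?case using step arc_cayley_boundary by blast
  qed simp
  \<comment> \<open>Asking for values of at least \<open>chi c\<close> puts the translates of
    \<open>e\<close> and \<open>e'\<close> by \<open>inv c\<close> back into the half space, where
    they are joined by a path although they lie on different sides.\<close>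
  obtain e where e: "e \<in> carrier G" "e \<in> E" "chi c \<le> chi e" using character_unbounded(1)[OF hom] by blast
  obtain e' where e': "e' \<in> carrier G" "e' \<notin> E" "chi c \<le> chi e'" using character_unbounded(2)[OF hom] by blast
  have "(inv c \<otimes> e, inv c \<otimes> e') \<in> (parcs ?Q)\<^sup>*"
    using c e e' by (intro reach) (simp_all add: character_mult[OF hom(1)] character_inv[OF hom(1)])
  from inv[OF this] show False using c e e' by (simp add: m_assoc[symmetric])
qed

end

section \<open>Components of Cayley graphs and the ends of a group with a free splitting\<close>

lemma infinite_components_iff:
  assumes "sym (parcs Q)" "parcs Q \<subseteq> pverts Q \<times> pverts Q"
  shows "C \<in> infinite_components Q \<longleftrightarrow> infinite C \<and> (\<exists>x\<in>pverts Q. C = {y. (x, y) \<in> (parcs Q)\<^sup>*})"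
proof -
  have r: "reachable (with_proj Q) u v \<longleftrightarrow> u \<in> pverts Q \<and> (u, v) \<in> (parcs Q)\<^sup>*" for u v
  proof
    assume "reachable (with_proj Q) u v"
    then show "u \<in> pverts Q \<and> (u, v) \<in> (parcs Q)\<^sup>*"
      by (auto simp: reachable_def dest: rtrancl_on_rtranclI in_rtrancl_on_in_F)
  next
    assume uv: "u \<in> pverts Q \<and> (u, v) \<in> (parcs Q)\<^sup>*"
    then have "v \<in> pverts Q" using assms(2) by (metis rtranclE mem_Sigma_iff subsetD)
    then show "reachable (with_proj Q) u v"
      using uv assms(2) rtrancl_consistent_rtrancl_on[of u v "parcs Q" "pverts Q"] by (auto simp: reachable_def)
  qed
  have symr: "(v, u) \<in> (parcs Q)\<^sup>*" if "(u, v) \<in> (parcs Q)\<^sup>*" for u v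
    using that assms(1) by (meson sym_rtrancl symD)
  have V: "v \<in> pverts Q" if "(u, v) \<in> (parcs Q)\<^sup>*" "u \<in> pverts Q" for u v
    using that assms(2) by (metis rtranclE mem_Sigma_iff subsetD)
  have "C \<in> pre_digraph.sccs_verts (with_proj Q) \<longleftrightarrow> (\<exists>x\<in>pverts Q. C = {y. (x, y) \<in> (parcs Q)\<^sup>*})"
    (is "?L \<longleftrightarrow> ?R")
  proof
    assume ?L
    then have C: "C \<noteq> {}" "\<And>u v. u \<in> C \<Longrightarrow> v \<in> C \<Longrightarrow> reachable (with_proj Q) u v"
      "\<And>u v. u \<in> C \<Longrightarrow> reachable (with_proj Q) u v \<Longrightarrow> reachable (with_proj Q) v u \<Longrightarrow> v \<in> C"
      unfolding pre_digraph.sccs_verts_def by blast+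
    then obtain x where x: "x \<in> C" by blast
    have xV: "x \<in> pverts Q" using C(2)[OF x x] unfolding r ..
    have "C = {y. (x, y) \<in> (parcs Q)\<^sup>*}"
    proof (rule subset_antisym; rule subsetI)
      fix y assume "y \<in> C"
      then show "y \<in> {y. (x, y) \<in> (parcs Q)\<^sup>*}" using C(2)[OF x] unfolding r by simp
    next
      fix y assume "y \<in> {y. (x, y) \<in> (parcs Q)\<^sup>*}"
      then have "(x, y) \<in> (parcs Q)\<^sup>*" by simp
      then show "y \<in> C" using C(3)[OF x] symr[of x y] V[of x y] xV unfolding r by simp
    qed
    then show ?R using xV by blast
  next
    assume ?R
    then obtain x where x: "x \<in> pverts Q" "C = {y. (x, y) \<in> (parcs Q)\<^sup>*}" by blast
    have C: "u \<in> C \<longleftrightarrow> (x, u) \<in> (parcs Q)\<^sup>*" for u by (simp add: x(2))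
    show ?L
      unfolding pre_digraph.sccs_verts_def mem_Collect_eq r
    proof (intro conjI ballI allI impI)
      show "C \<noteq> {}" using C[of x] by blast
      fix u assume u: "u \<in> C"
      show "u \<in> pverts Q" if "v \<in> C" for v using V[of x u] u x(1) by (simp add: C)
      show "(u, v) \<in> (parcs Q)\<^sup>*" if "v \<in> C" for v
        using rtrancl_trans[OF symr[of x u], of v] u that by (simp add: C)
      show "\<not> (u \<in> pverts Q \<and> (u, v) \<in> (parcs Q)\<^sup>*) \<or> \<not> (v \<in> pverts Q \<and> (v, u) \<in> (parcs Q)\<^sup>*)"
        if "v \<notin> C" for v
        using u that rtrancl_trans[of x u "parcs Q" v] unfolding C by blast
    qed
  qed
  then show ?thesis by (auto simp: infinite_components_def)
qed

lemma full_cayley_graph: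
  assumes "group G"
  shows "sym (parcs (full_subgraph (cayley_graph G S) U))"
    "parcs (full_subgraph (cayley_graph G S) U) \<subseteq>
      pverts (full_subgraph (cayley_graph G S) U) \<times> pverts (full_subgraph (cayley_graph G S) U)"
  using group.sym_cayley_graph[OF assms, of S] by (auto simp: full_subgraph_def sym_def)

text \<open>\<open>N\<close> consists of the vertices outside \<open>F\<close> that are adjacent to
  \<open>F\<close>. A path from \<open>x\<close> to \<open>\<one>\<close>, which lies in
  \<open>F\<close>, reaches \<open>N\<close> before it first enters \<open>F\<close>. In particular
  the complement of \<open>F\<close> has finitely many components.\<close>

lemma (in group) component_meets_boundary:
  assumes S: "finite_generating_set G S" and F: "\<one> \<in> F" "finite F"
  defines "R \<equiv> parcs (full_subgraph (cayley_graph G S) (carrier G - F))"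
  shows "\<exists>N. finite N \<and> N \<subseteq> carrier G - F \<and> (\<forall>x\<in>carrier G - F. \<exists>n\<in>N. (n, x) \<in> R\<^sup>*)"
proof -
  define N where "N = ((\<lambda>(f, s). f \<otimes> s) ` (F \<times> S) \<union> (\<lambda>(f, s). f \<otimes> inv s) ` (F \<times> S)) \<inter> (carrier G - F)"
  have SG: "S \<subseteq> carrier G" "finite S" using S by (auto simp: finite_generating_set_def)
  have "finite N" unfolding N_def using SG F by auto
  moreover have "\<exists>n\<in>N. (n, x) \<in> R\<^sup>*" if x: "x \<in> carrier G - F" for x
  proof -
    have "(x, y) \<in> (parcs (cayley_graph G S))\<^sup>* \<Longrightarrow> (y \<in> carrier G - F \<and> (x, y) \<in> R\<^sup>*) \<or> (\<exists>n\<in>N. (x, n) \<in> R\<^sup>*)" for y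
    proof (induction rule: rtrancl_induct)
      case base
      then show ?case using x by simp
    next
      case (step y z)
      have z: "z \<in> carrier G" using step(2) by (auto simp: cayley_graph_def)
      show ?case
      proof (cases "\<exists>n\<in>N. (x, n) \<in> R\<^sup>*")
        case False
        then have y: "y \<in> carrier G - F" "(x, y) \<in> R\<^sup>*" using step by auto
        show ?thesis
        proof (cases "z \<in> F")
          case True
          have "y \<in> N"
          proof -
            obtain s where s: "s \<in> S" "z = y \<otimes> s \<or> y = z \<otimes> s" using step(2) by (auto simp: cayley_graph_def)
            have sG: "s \<in> carrier G" using s SG by blast
            then have "y = z \<otimes> inv s \<or> y = z \<otimes> s" using s y(1) by (auto simp: m_assoc)
            then show ?thesis using True s y(1) unfolding N_def by force
          qed
          then show ?thesis using y by blast
        next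
          case False
          then have "(y, z) \<in> R" using step(2) y z by (auto simp: R_def full_subgraph_def)
          then show ?thesis using y z False by (auto intro: rtrancl_into_rtrancl)
        qed
      qed simp
    qed
    moreover have "(x, \<one>) \<in> (parcs (cayley_graph G S))\<^sup>*"
      using cayley_graph_connected[OF S, of "inv x" x] x by simp
    ultimately obtain n where "n \<in> N" "(x, n) \<in> R\<^sup>*" using F by blast
    moreover have "sym (R\<^sup>*)" unfolding R_def using full_cayley_graph(1)[OF group_axioms] by (rule sym_rtrancl)
    ultimately show ?thesis by (meson symD)
  qed
  moreover have "N \<subseteq> carrier G - F" by (simp add: N_def)
  ultimately show ?thesis by (intro exI[of _ N]) simp
qed

text \<open>Once the boundary is removed, no component meets both \<open>E\<close> and its
  complement. Both sets are infinite since \<open>chi\<close> is unbounded on them, and there are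
  finitely many components, so each set meets an infinite one.\<close>

lemma (in free_splitting) graph_ends_neq_1:
  assumes S: "finite_generating_set G S"
    and chi: "chi \<in> hom G real_additive_group" "\<exists>g\<in>carrier G. chi g \<noteq> 0"
  shows "graph_ends (cayley_graph G S) \<noteq> 1"
proof -
  \<comment> \<open>The unit is added because \<open>component_meets_boundary\<close> needs a point
    of \<open>F\<close> to walk to.\<close>
  define F where "F = insert \<one> (cayley_boundary S)"
  let ?Q = "full_subgraph (cayley_graph G S) (carrier G - F)"
  have F: "finite F" "\<one> \<in> F" "F \<subseteq> carrier G"
    using finite_cayley_boundary[OF S] by (auto simp: F_def cayley_boundary_def)
  obtain N where N: "finite N" "N \<subseteq> carrier G - F" "\<And>x. x \<in> carrier G - F \<Longrightarrow> \<exists>n\<in>N. (n, x) \<in> (parcs ?Q)\<^sup>*"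
    using component_meets_boundary[OF S F(2,1)] by blast
  have inv: "(u \<in> E \<longleftrightarrow> v \<in> E) \<and> (u \<in> carrier G \<longleftrightarrow> v \<in> carrier G)" if "(u, v) \<in> (parcs ?Q)\<^sup>*" for u v
    using that
  proof (induction rule: rtrancl_induct)
    case (step y z)
    then show ?case using arc_cayley_boundary[of y z S] by (auto simp: full_subgraph_def F_def)
  qed simp
  have inf: "infinite X" if "\<And>c. \<exists>g\<in>X. c \<le> chi g" for X
  proof
    assume "finite X"
    then have "bdd_above (chi ` X)" by simp
    then obtain M where "\<And>g. g \<in> X \<Longrightarrow> chi g \<le> M" by (auto simp: bdd_above_def)
    then show False using that[of "M + 1"] by force
  qed
  have comp: "\<exists>C. C \<in> infinite_components ?Q \<and> C \<inter> X \<noteq> {}"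
    if X: "X \<subseteq> carrier G" "infinite X" "\<And>u v. (u, v) \<in> (parcs ?Q)\<^sup>* \<Longrightarrow> u \<in> X \<longleftrightarrow> v \<in> X" for X
  proof -
    have "X - F \<subseteq> (\<Union>n\<in>N. {x \<in> X. (n, x) \<in> (parcs ?Q)\<^sup>*})" using N(3) X(1) by blast
    moreover have "infinite (X - F)" using X(2) F(1) by simp
    ultimately have "infinite (\<Union>n\<in>N. {x \<in> X. (n, x) \<in> (parcs ?Q)\<^sup>*})" using finite_subset by blast
    then obtain n where n: "n \<in> N" "infinite {x \<in> X. (n, x) \<in> (parcs ?Q)\<^sup>*}" using N(1) by blast
    then obtain x where x: "x \<in> X" "(n, x) \<in> (parcs ?Q)\<^sup>*" using infinite_imp_nonempty by blast
    have "infinite {x. (n, x) \<in> (parcs ?Q)\<^sup>*}" using n(2) by (rule contrapos_nn) (erule rev_finite_subset, blast)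
    then have "{x. (n, x) \<in> (parcs ?Q)\<^sup>*} \<in> infinite_components ?Q"
      using n(1) N(2) by (subst infinite_components_iff[OF full_cayley_graph[OF group_axioms]])
        (auto simp: full_subgraph_def)
    then show ?thesis using x by blast
  qed
  obtain C where C: "C \<in> infinite_components ?Q" "C \<inter> (carrier G \<inter> E) \<noteq> {}"
  proof -
    have "infinite (carrier G \<inter> E)" using character_unbounded(1)[OF chi] by (rule inf)
    then show ?thesis using comp[of "carrier G \<inter> E"] inv that by blast
  qed
  obtain C' where C': "C' \<in> infinite_components ?Q" "C' \<inter> (carrier G - E) \<noteq> {}"
  proof -
    have "infinite (carrier G - E)" using character_unbounded(2)[OF chi] by (rule inf)
    then show ?thesis using comp[of "carrier G - E"] inv that by blast
  qed
  have "C \<noteq> C'"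
  proof
    assume "C = C'"
    then obtain u v where uv: "u \<in> C" "u \<in> E" "v \<in> C" "v \<notin> E" using C C' by blast
    obtain x where "C = {y. (x, y) \<in> (parcs ?Q)\<^sup>*}"
      using C(1) infinite_components_iff[OF full_cayley_graph[OF group_axioms]] by blast
    then show False using uv inv by blast
  qed
  let ?Cs = "infinite_components ?Q"
  have "2 \<le> (if finite ?Cs then enat (card ?Cs) else \<infinity>)"
  proof (cases "finite ?Cs")
    case True
    have "card {C, C'} \<le> card ?Cs" using C(1) C'(1) True by (intro card_mono) auto
    then show ?thesis using True \<open>C \<noteq> C'\<close> by (simp add: numeral_eq_enat)
  qed simp
  also have "\<dots> \<le> graph_ends (cayley_graph G S)"
    unfolding graph_ends_def Let_def using F
    by (intro SUP_upper2[of F]) (auto simp: cayley_graph_def)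
  finally show ?thesis by (auto simp: one_enat_def numeral_eq_enat)
qed

section \<open>Finitely generated kernels\<close>

context group
begin

lemma inv_mult_cancel:
  "\<lbrakk>a \<in> carrier G; b \<in> carrier G\<rbrakk> \<Longrightarrow> inv a \<otimes> (a \<otimes> b) = b"
  "\<lbrakk>a \<in> carrier G; b \<in> carrier G\<rbrakk> \<Longrightarrow> a \<otimes> (inv a \<otimes> b) = b"
  by (simp_all add: m_assoc[symmetric])

lemma conj_int_pow:
  assumes "c \<in> carrier G" "x \<in> carrier G"
  shows "c \<otimes> x [^] (i :: int) \<otimes> inv c = (c \<otimes> x \<otimes> inv c) [^] i"
proof -
  have "(\<lambda>x. c \<otimes> x \<otimes> inv c) \<in> hom G G"
    using assms(1) by (intro homI) (simp_all add: m_assoc inv_mult_cancel)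
  from hom_int_pow[OF this assms(2) group_axioms group_axioms] show ?thesis .
qed

lemma int_pow_commute_left:
  assumes "x \<otimes> y = y \<otimes> x" "x \<in> carrier G" "y \<in> carrier G"
  shows "x [^] (i :: int) \<otimes> y = y \<otimes> x [^] i"
proof -
  have "y \<otimes> x \<otimes> inv y = x" using assms by (simp add: assms(1)[symmetric] m_assoc)
  then have "y \<otimes> x [^] i \<otimes> inv y = x [^] i" using assms by (simp add: conj_int_pow)
  then have "y \<otimes> x [^] i \<otimes> inv y \<otimes> y = x [^] i \<otimes> y" by simp
  then show ?thesis using assms by (simp add: m_assoc)
qed

lemma int_pow_commute:
  assumes "x \<otimes> y = y \<otimes> x" "x \<in> carrier G" "y \<in> carrier G"
  shows "x [^] (i :: int) \<otimes> y [^] (j :: int) = y [^] j \<otimes> x [^] i"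
  using int_pow_commute_left[OF int_pow_commute_left[OF assms, of i, symmetric], of j] assms by simp

end

text \<open>The powers \<open>p s\<close> of the generators have the same image \<open>M\<close>, and the conjugates of the quotients
  of any two of their \<open>q\<close>-th powers lie in the finitely generated subgroup \<open>N\<close> for all \<open>q\<close>. So a power
  of \<open>\<tau>\<close> can be moved past a generator modulo \<open>N\<close> by trading it for a power that commutes with
  that generator.\<close>

lemma finitely_generated_kernel:
  fixes G (structure)
  assumes G: "group G" and S: "finite_generating_set G S"
    and epi: "\<phi> \<in> epi G integer_group" and nz: "\<And>s. s \<in> S \<Longrightarrow> \<phi> s \<noteq> 0"
    and conn: "\<And>s t. s \<in> S \<Longrightarrow> t \<in> S \<Longrightarrow>
      (s, t) \<in> {(x, y). x \<in> S \<and> y \<in> S \<and> x \<otimes> y = y \<otimes> x}\<^sup>*"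
  shows "finitely_generated (G\<lparr>carrier := kernel G integer_group \<phi>\<rparr>)"
proof -
  interpret group G by fact
  have hom: "\<phi> \<in> hom G integer_group" using epi by (simp add: epi_def)
  interpret h: group_hom G integer_group \<phi>
    by (intro group_hom.intro group_hom_axioms.intro group_axioms hom) simp
  have \<phi>_pow: "\<phi> (x [^] (i :: int)) = i * \<phi> x" if "x \<in> carrier G" for x i
    using h.hom_int_pow[OF that] by simp
  have SG: "S \<subseteq> carrier G" "finite S" "generate G S = carrier G"
    using S by (auto simp: finite_generating_set_def)
  obtain z where z: "z \<in> carrier G" "\<phi> z = 1"
    using epi by (auto simp: epi_def) (metis UNIV_I imageE)
  have "S \<noteq> {}"
  proof
    assume "S = {}"
    then have "carrier G = {\<one>}" using SG(3) generate_empty by simp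
    then show False using z h.hom_one by auto
  qed
  then obtain t where t: "t \<in> S" by blast
  \<comment> \<open>A positive common multiple of the values \<open>\<phi> s\<close>. The exponent
    in \<open>p s\<close> is then exact and has the sign of \<open>\<phi> s\<close>, so every
    \<open>p s\<close> has height \<open>M\<close>.\<close>
  define M where "M = (\<Prod>s\<in>S. \<bar>\<phi> s\<bar>)"
  have M: "M > 0" unfolding M_def by (intro prod_pos) (simp add: nz)
  have dvd: "\<phi> s dvd M" if "s \<in> S" for s
    using dvd_prodI[OF SG(2) that, of "\<lambda>s. \<bar>\<phi> s\<bar>"] by (simp add: M_def)
  define p where "p s = s [^] (M div \<phi> s)" for s
  have pG: "p s \<in> carrier G" if "s \<in> S" for s using that SG(1) by (auto simp: p_def)
  have \<phi>p: "\<phi> (p s) = M" if "s \<in> S" for s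
    using that SG(1) dvd[OF that] by (auto simp: p_def \<phi>_pow)
  define \<tau> where "\<tau> = p t"
  have \<tau>: "\<tau> \<in> carrier G" "\<phi> \<tau> = M" using pG \<phi>p t by (auto simp: \<tau>_def)
  \<comment> \<open>The products of \<open>y r\<close>, for \<open>r\<close> in
    \<open>{0..<M}\<close>, with the integral powers of \<open>\<tau>\<close> have each height
    exactly once: they form a transversal of the kernel.\<close>
  define y where "y r = z [^] r" for r :: int
  have y: "y r \<in> carrier G" "\<phi> (y r) = r" for r using z by (auto simp: y_def \<phi>_pow)
  \<comment> \<open>The conjugators that occur when a letter is appended to a transversal element:
    the prefix without the letter and the prefix with it.\<close>
  define C where "C = y ` {0..<M} \<union> (\<lambda>(r, s, e). y r \<otimes> s [^] e) ` ({0..<M} \<times> S \<times> {1, - 1 :: int})"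
  define W1 where "W1 = (\<lambda>(c, s, s'). c \<otimes> (p s \<otimes> inv (p s')) \<otimes> inv c) ` (C \<times> S \<times> S)"
  \<comment> \<open>The corrections that replace \<open>y r\<close> times a letter by the
    transversal element of the same height. Working with residues modulo \<open>M\<close> keeps them
    finite in number.\<close>
  define W2 where "W2 = (\<lambda>(r, s, e). (y r \<otimes> s [^] e) \<otimes>
      inv (y ((r + e * \<phi> s) mod M) \<otimes> \<tau> [^] ((r + e * \<phi> s) div M))) ` ({0..<M} \<times> S \<times> {1, - 1 :: int})"
  define N where "N = generate G (W1 \<union> W2)"
  have CG: "c \<in> carrier G" if "c \<in> C" for c using that y SG(1) by (auto simp: C_def)
  have W: "W1 \<union> W2 \<subseteq> kernel G integer_group \<phi>"
  proof
    fix w assume "w \<in> W1 \<union> W2"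
    then show "w \<in> kernel G integer_group \<phi>"
    proof
      assume "w \<in> W1"
      then obtain c s s' where "c \<in> C" "s \<in> S" "s' \<in> S" "w = c \<otimes> (p s \<otimes> inv (p s')) \<otimes> inv c"
        unfolding W1_def by auto
      then show ?thesis using CG pG \<phi>p by (simp add: kernel_def)
    next
      assume "w \<in> W2"
      then obtain r s e where *: "s \<in> S" "w = (y r \<otimes> s [^] e) \<otimes>
          inv (y ((r + e * \<phi> s) mod M) \<otimes> \<tau> [^] ((r + e * \<phi> s) div M))"
        unfolding W2_def by auto
      have "s \<in> carrier G" using * SG(1) by blast
      then show ?thesis using * y \<tau> by (simp add: kernel_def \<phi>_pow algebra_simps)
    qed
  qed
  have fin: "finite (W1 \<union> W2)" using SG(2) by (simp add: W1_def W2_def C_def)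
  have sub_ker: "subgroup (kernel G integer_group \<phi>) G" by (rule h.subgroup_kernel)
  have WG: "W1 \<union> W2 \<subseteq> carrier G" using W by (auto simp: kernel_def)
  have N: "subgroup N G" unfolding N_def by (rule generate_is_subgroup[OF WG])
  have NG: "n \<in> carrier G" if "n \<in> N" for n using that N by (rule subgroup.mem_carrier[rotated])
  \<comment> \<open>Neighbours in the chain commute, so the quotient of their \<open>q\<close>-th
    powers is the \<open>q\<close>-th power of their quotient, and one element of \<open>W1\<close>
    serves all \<open>q\<close>. Along the chain the quotients telescope.\<close>
  have \<kappa>: "c \<otimes> (p s [^] q \<otimes> inv (p s' [^] q)) \<otimes> inv c \<in> N"
    if c: "c \<in> C" and s: "s \<in> S" and s': "s' \<in> S" for c s s' and q :: int
    using conn[OF s s']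
  proof (induction rule: rtrancl_induct)
    case base
    have "c \<otimes> (p s [^] q \<otimes> inv (p s [^] q)) \<otimes> inv c = \<one>" using CG[OF c] pG[OF s] by simp
    then show ?case using subgroup.one_closed[OF N] by simp
  next
    case (step a b)
    then have ab: "a \<in> S" "b \<in> S" "a \<otimes> b = b \<otimes> a" by auto
    have "p a \<otimes> p b = p b \<otimes> p a"
      unfolding p_def using ab SG(1) by (intro int_pow_commute) auto
    then have "p a \<otimes> inv (p b) = inv (p b) \<otimes> p a"
      using int_pow_commute[of "p a" "p b" 1 "- 1"] pG ab by (simp add: int_pow_neg)
    then have "p a [^] q \<otimes> inv (p b [^] q) = (p a \<otimes> inv (p b)) [^] q"
      using pG[OF ab(1)] pG[OF ab(2)] by (subst int_pow_mult_distrib) (simp_all add: int_pow_inv)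
    then have "c \<otimes> (p a [^] q \<otimes> inv (p b [^] q)) \<otimes> inv c = (c \<otimes> (p a \<otimes> inv (p b)) \<otimes> inv c) [^] q"
      using CG[OF c] pG ab by (simp only: conj_int_pow m_closed inv_closed)
    moreover have "c \<otimes> (p a \<otimes> inv (p b)) \<otimes> inv c \<in> N"
      unfolding N_def W1_def using c ab by (intro generate.incl UnI1 image_eqI[of _ _ "(c, a, b)"]) auto
    ultimately have "c \<otimes> (p a [^] q \<otimes> inv (p b [^] q)) \<otimes> inv c \<in> N"
      using subgroup_int_pow_closed[OF N] by simp
    then have "(c \<otimes> (p s [^] q \<otimes> inv (p a [^] q)) \<otimes> inv c) \<otimes> (c \<otimes> (p a [^] q \<otimes> inv (p b [^] q)) \<otimes> inv c) \<in> N"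
      using step.IH subgroup.m_closed[OF N] by blast
    moreover have "(c \<otimes> (p s [^] q \<otimes> inv (p a [^] q)) \<otimes> inv c) \<otimes> (c \<otimes> (p a [^] q \<otimes> inv (p b [^] q)) \<otimes> inv c)
        = c \<otimes> (p s [^] q \<otimes> inv (p b [^] q)) \<otimes> inv c"
      using CG[OF c] pG s ab by (simp add: m_assoc inv_mult_cancel)
    ultimately show ?case by simp
  qed
  \<comment> \<open>\<open>N\<close> times the transversal. It contains \<open>\<one>\<close> and is
    stable under right multiplication by generators and their inverses, so it exhausts
    \<open>G\<close>.\<close>
  define X where "X = {n \<otimes> (y r \<otimes> \<tau> [^] q) | n r (q :: int). n \<in> N \<and> 0 \<le> r \<and> r < M}"
  have step: "x \<otimes> s [^] e \<in> X" if x: "x \<in> X" and s: "s \<in> S" and e: "e \<in> {1, - 1 :: int}" for x s e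
  proof -
    obtain n r and q :: int where nrq: "n \<in> N" "0 \<le> r" "r < M" "x = n \<otimes> (y r \<otimes> \<tau> [^] q)"
      using x unfolding X_def by auto
    have sG: "s \<in> carrier G" using s SG(1) by blast
    define \<sigma> where "\<sigma> = s [^] e"
    define P where "P = p s [^] q"
    define T where "T = \<tau> [^] q"
    define d where "d = (r + e * \<phi> s) div M"
    define r' where "r' = (r + e * \<phi> s) mod M"
    define w where "w = (y r \<otimes> \<sigma>) \<otimes> inv (y r' \<otimes> \<tau> [^] d)"
    define \<alpha> where "\<alpha> = y r \<otimes> (T \<otimes> inv P) \<otimes> inv (y r)"
    define \<beta> where "\<beta> = (y r \<otimes> \<sigma>) \<otimes> (P \<otimes> inv T) \<otimes> inv (y r \<otimes> \<sigma>)"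
    have G: "\<sigma> \<in> carrier G" "P \<in> carrier G" "T \<in> carrier G" "w \<in> carrier G" "\<alpha> \<in> carrier G" "\<beta> \<in> carrier G"
      using sG pG[OF s] \<tau> y by (simp_all add: \<sigma>_def P_def T_def w_def \<alpha>_def \<beta>_def)
    have comm: "P \<otimes> \<sigma> = \<sigma> \<otimes> P"
      unfolding P_def \<sigma>_def p_def using sG
      by (simp add: int_pow_pow int_pow_mult[symmetric] add.commute)
    have CC: "y r \<in> C" "y r \<otimes> \<sigma> \<in> C"
      using nrq s e unfolding C_def \<sigma>_def by (auto intro!: image_eqI[of _ _ "(r, s, e)"])
    have "\<alpha> \<in> N" "\<beta> \<in> N"
      unfolding \<alpha>_def \<beta>_def P_def T_def \<tau>_def using \<kappa> CC s t by simp_all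
    moreover have "w \<in> N"
      unfolding N_def w_def \<sigma>_def W2_def r'_def d_def using nrq s e
      by (intro generate.incl UnI2 image_eqI[of _ _ "(r, s, e)"]) auto
    ultimately have "n \<otimes> (\<alpha> \<otimes> (\<beta> \<otimes> w)) \<in> N"
      using nrq(1) subgroup.m_closed[OF N] by simp
    \<comment> \<open>\<open>\<alpha>\<close> trades \<open>T\<close> for \<open>P\<close>, which
      commutes with the letter; \<open>\<beta>\<close> trades \<open>P\<close> for \<open>T\<close>
      again behind the letter; \<open>w\<close> brings the remaining prefix back to the
      transversal.\<close>
    moreover have "x \<otimes> s [^] e = n \<otimes> (\<alpha> \<otimes> (\<beta> \<otimes> w)) \<otimes> (y r' \<otimes> \<tau> [^] (d + q))"
    proof -
      have 1: "y r \<otimes> T = \<alpha> \<otimes> (y r \<otimes> P)"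
        unfolding \<alpha>_def using G y by (simp add: m_assoc inv_mult_cancel)
      have 2: "(y r \<otimes> \<sigma>) \<otimes> P = \<beta> \<otimes> ((y r \<otimes> \<sigma>) \<otimes> T)"
        unfolding \<beta>_def using G y by (simp add: m_assoc inv_mult_cancel inv_mult_group)
      have 3: "y r \<otimes> \<sigma> = w \<otimes> (y r' \<otimes> \<tau> [^] d)"
        unfolding w_def using G y \<tau> by (simp add: m_assoc inv_mult_cancel inv_mult_group)
      have "x \<otimes> s [^] e = n \<otimes> ((y r \<otimes> T) \<otimes> \<sigma>)"
        using nrq G y NG by (simp add: T_def[symmetric] \<sigma>_def[symmetric] m_assoc)
      also have "\<dots> = n \<otimes> (\<alpha> \<otimes> ((y r \<otimes> \<sigma>) \<otimes> P))"
        unfolding 1 using G y NG nrq comm by (simp add: m_assoc)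
      also have "\<dots> = n \<otimes> (\<alpha> \<otimes> (\<beta> \<otimes> (w \<otimes> (y r' \<otimes> \<tau> [^] d) \<otimes> T)))"
        unfolding 2 unfolding 3 ..
      also have "\<dots> = n \<otimes> (\<alpha> \<otimes> (\<beta> \<otimes> w)) \<otimes> (y r' \<otimes> \<tau> [^] (d + q))"
        using G y \<tau> NG nrq by (simp add: m_assoc int_pow_mult T_def)
      finally show ?thesis .
    qed
    moreover have "0 \<le> r'" "r' < M" using M by (simp_all add: r'_def)
    ultimately show ?thesis unfolding X_def mem_Collect_eq by blast
  qed
  have XG: "x \<in> carrier G" if "x \<in> X" for x using that NG y \<tau> unfolding X_def by auto
  have right: "x \<otimes> g \<in> X" if "g \<in> generate G S" "x \<in> X" for x g
    using that
  proof (induction arbitrary: x rule: generate.induct)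
    case one then show ?case using XG by simp
  next
    case (incl s)
    then show ?case using step[of x s 1] SG(1) by (auto simp: subset_iff)
  next
    case (inv s)
    then show ?case using step[of x s "- 1"] SG(1) by (auto simp: int_pow_neg subset_iff)
  next
    case (eng g h)
    have "g \<in> carrier G" "h \<in> carrier G" using eng(1,2) by (auto simp: SG(3))
    then show ?case using eng XG by (simp add: m_assoc[symmetric])
  qed
  have "\<one> \<otimes> (y 0 \<otimes> \<tau> [^] (0 :: int)) \<in> X"
    unfolding X_def mem_Collect_eq using subgroup.one_closed[OF N] M by blast
  then have oneX: "\<one> \<in> X" using z by (simp add: y_def)
  have "kernel G integer_group \<phi> \<subseteq> N"
  proof
    fix g assume g: "g \<in> kernel G integer_group \<phi>"
    then have gG: "g \<in> carrier G" "\<phi> g = 0" by (auto simp: kernel_def)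
    have "g \<in> X" using right[of g \<one>] oneX gG by (simp add: SG(3))
    then obtain n r and q :: int where nrq: "n \<in> N" "0 \<le> r" "r < M" "g = n \<otimes> (y r \<otimes> \<tau> [^] q)"
      unfolding X_def by auto
    have "n \<in> kernel G integer_group \<phi>"
      using nrq(1) generate_subgroup_incl[OF W sub_ker] unfolding N_def by blast
    then have "\<phi> g = r + q * M" using nrq y \<tau> by (simp add: kernel_def \<phi>_pow)
    then have 0: "r + q * M = 0" using gG by simp
    have "r = (r + q * M) mod M" using nrq by simp
    then have "r = 0" using 0 by simp
    then have "q = 0" using 0 M by simp
    then show "g \<in> N" using nrq \<open>r = 0\<close> NG z by (simp add: y_def)
  qed
  then have "N = kernel G integer_group \<phi>"
    using generate_subgroup_incl[OF W sub_ker] unfolding N_def by blast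
  then have "generate (G\<lparr>carrier := kernel G integer_group \<phi>\<rparr>) (W1 \<union> W2) = kernel G integer_group \<phi>"
    using generate_consistent[OF W sub_ker] by (simp add: N_def)
  then show ?thesis
    unfolding finitely_generated_def finite_generating_set_def using fin W by (intro exI[of _ "W1 \<union> W2"]) simp
qed

text \<open>Walk to an element of height \<open>n \<ge> 0\<close> first within the kernel and then upwards along the powers of
  an element of height one.\<close>

lemma algebraically_fibers_imp_BNS_invariant:
  fixes G (structure)
  assumes G: "group G" and "algebraically_fibers G"
  shows "BNS_invariant G \<noteq> {}"
proof -
  interpret group G by fact
  obtain \<phi> T where \<phi>: "\<phi> \<in> epi G integer_group"
    and T: "finite_generating_set (G\<lparr>carrier := kernel G integer_group \<phi>\<rparr>) T"
    using assms(2) unfolding algebraically_fibers_def finitely_generated_def by blast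
  have hom: "\<phi> \<in> hom G integer_group" using \<phi> by (simp add: epi_def)
  interpret h: group_hom G integer_group \<phi>
    by (intro group_hom.intro group_hom_axioms.intro group_axioms hom) simp
  let ?N = "kernel G integer_group \<phi>"
  have sub_ker: "subgroup ?N G" by (rule h.subgroup_kernel)
  interpret N: group "G\<lparr>carrier := ?N\<rparr>" by (rule subgroup.subgroup_is_group[OF sub_ker G])
  obtain t where t: "t \<in> carrier G" "\<phi> t = 1"
    using \<phi> by (auto simp: epi_def) (metis UNIV_I imageE)
  define S where "S = insert t T"
  have TN: "T \<subseteq> ?N" "finite T" using T by (auto simp: finite_generating_set_def)
  have SG: "S \<subseteq> carrier G" "finite S" using TN t by (auto simp: S_def kernel_def)
  have decomp: "g \<otimes> inv (t [^] \<phi> g) \<in> ?N" if "g \<in> carrier G" for g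
    using that t h.hom_int_pow[of t "\<phi> g"] by (simp add: kernel_def)
  have "carrier G \<subseteq> generate G S"
  proof
    fix g assume g: "g \<in> carrier G"
    have "?N \<subseteq> generate G S"
      using T generate_consistent[OF TN(1) sub_ker] mono_generate[of T S]
      by (auto simp: finite_generating_set_def S_def)
    then have "g \<otimes> inv (t [^] \<phi> g) \<in> generate G S" using decomp[OF g] by blast
    moreover have "t [^] \<phi> g \<in> generate G S"
      by (intro subgroup_int_pow_closed[OF generate_is_subgroup[OF SG(1)]] generate.incl) (simp add: S_def)
    ultimately have "g \<otimes> inv (t [^] \<phi> g) \<otimes> t [^] \<phi> g \<in> generate G S" by (rule generate.eng)
    then show "g \<in> generate G S" using g t by (simp add: m_assoc)
  qed
  then have S: "finite_generating_set G S"
    using SG generate_incl[OF SG(1)] by (auto simp: finite_generating_set_def)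
  define chi where "chi = (\<lambda>g\<in>carrier G. real_of_int (\<phi> g))"
  have "chi \<in> nonzero_characters G"
    unfolding nonzero_characters_def chi_def using t
    by (auto intro!: homI bexI[of _ t] simp: real_additive_group_def)
  moreover have "graph_connected (full_subgraph (cayley_graph G S) {g \<in> carrier G. chi g \<ge> 0})"
  proof -
    let ?Q = "full_subgraph (cayley_graph G S) {g \<in> carrier G. chi g \<ge> 0}"
    have Q: "(g, h) \<in> parcs ?Q \<longleftrightarrow> (g, h) \<in> parcs (cayley_graph G S) \<and> \<phi> g \<ge> 0 \<and> \<phi> h \<ge> 0" for g h
      by (auto simp: full_subgraph_def chi_def cayley_graph_def)
    have up: "(\<one>, g) \<in> (parcs ?Q)\<^sup>*" if g: "g \<in> carrier G" "\<phi> g \<ge> 0" for g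
    proof -
      define n where "n = g \<otimes> inv (t [^] \<phi> g)"
      have n: "n \<in> ?N" "n \<in> carrier G" "\<phi> n = 0" using decomp[OF g(1)] by (auto simp: n_def kernel_def)
      have "(\<one>, \<one> \<otimes> n) \<in> (parcs (cayley_graph (G\<lparr>carrier := ?N\<rparr>) T))\<^sup>*"
        using N.cayley_graph_connected[OF T, of n \<one>] n subgroup.one_closed[OF sub_ker] by simp
      moreover have "parcs (cayley_graph (G\<lparr>carrier := ?N\<rparr>) T) \<subseteq> parcs ?Q"
        unfolding subset_iff split_paired_All Q by (simp add: cayley_graph_def kernel_def S_def)
      ultimately have "(\<one>, \<one> \<otimes> n) \<in> (parcs ?Q)\<^sup>*" by (meson rtrancl_mono subsetD)
      then have "(\<one>, n) \<in> (parcs ?Q)\<^sup>*" using n by simp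
      moreover have "(n, n \<otimes> t [^] k) \<in> (parcs ?Q)\<^sup>*" for k :: nat
      proof (induction k)
        case (Suc k)
        have "(n \<otimes> t [^] k, n \<otimes> t [^] Suc k) \<in> parcs ?Q"
          using n t h.hom_nat_pow[of t] by (simp add: Q) (simp add: cayley_graph_def S_def m_assoc)
        then show ?case using Suc by (rule rtrancl_into_rtrancl[rotated])
      qed (use n in simp)
      moreover have "n \<otimes> t [^] nat (\<phi> g) = g"
      proof -
        have "t [^] \<phi> g = t [^] nat (\<phi> g)" using g(2) int_pow_int[of G t "nat (\<phi> g)"] by simp
        then show ?thesis using g(1) t(1) by (simp add: n_def m_assoc)
      qed
      ultimately show ?thesis using rtrancl_trans[of \<one> n "parcs ?Q" g] by metis
    qed
    have sym: "sym ((parcs ?Q)\<^sup>*)" using full_cayley_graph(1)[OF G] by (rule sym_rtrancl)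
    have "chi g = \<phi> g" if "g \<in> carrier G" for g using that by (simp add: chi_def)
    then have "(g, h) \<in> (parcs ?Q)\<^sup>*" if "g \<in> pverts ?Q" "h \<in> pverts ?Q" for g h
      using that up[of g] up[of h] symD[OF sym, of \<one> g] by (auto simp: full_subgraph_def intro: rtrancl_trans)
    moreover have "\<one> \<in> pverts ?Q" by (simp add: full_subgraph_def chi_def)
    ultimately show ?thesis
      unfolding graph_connected_iff[OF full_cayley_graph[OF G]] by blast
  qed
  ultimately show ?thesis using S unfolding BNS_invariant_def by blast
qed

section \<open>One-endedness from commuting generators\<close>

context group
begin

definition free_abelian_pair :: "'a \<Rightarrow> 'a \<Rightarrow> bool" where
  "free_abelian_pair s t \<longleftrightarrow> s \<otimes> t = t \<otimes> s \<and> inj (\<lambda>(i :: int, j :: int). s [^] i \<otimes> t [^] j)"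

text \<open>\<open>partner\<close> does not follow from \<open>conn\<close>: the chain from a
  generator to itself may be empty, and a single generator could be that of an infinite cyclic
  group, which has two ends.\<close>

context
  fixes S F :: "'a set" and R :: "'a rel"
  assumes S: "finite_generating_set G S" and F: "finite F"
    and conn: "\<And>s t. s \<in> S \<Longrightarrow> t \<in> S \<Longrightarrow> (s, t) \<in> {(x, y). x \<in> S \<and> y \<in> S \<and> free_abelian_pair x y}\<^sup>*"
    and partner: "\<And>s. s \<in> S \<Longrightarrow> \<exists>t\<in>S. free_abelian_pair s t"
  defines "R \<equiv> parcs (full_subgraph (cayley_graph G S) (carrier G - F))"
begin

lemma gens_carrier: "S \<subseteq> carrier G"
  using S by (simp add: finite_generating_set_def)

lemma reach_sym: "(x, y) \<in> R\<^sup>* \<Longrightarrow> (y, x) \<in> R\<^sup>*"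
  unfolding R_def using sym_rtrancl[OF full_cayley_graph(1)[OF group_axioms]] by (rule symD)

lemma step_in_R:
  assumes "x \<in> carrier G" "s \<in> S" "x \<notin> F" "x \<otimes> s \<notin> F"
  shows "(x, x \<otimes> s) \<in> R"
  using assms gens_carrier by (auto simp: R_def full_subgraph_def cayley_graph_def)

lemma line_in_component:
  assumes "x \<in> carrier G" "s \<in> S" "\<And>i :: int. x \<otimes> s [^] i \<notin> F"
  shows "(x, x \<otimes> s [^] (j :: int)) \<in> R\<^sup>*"
proof -
  have s: "s \<in> carrier G" using assms(2) gens_carrier by blast
  have step: "(x \<otimes> s [^] i, x \<otimes> s [^] (i + 1)) \<in> R" for i :: int
    using step_in_R[of "x \<otimes> s [^] i" s] assms s assms(3)[of "i + 1"]
    by (simp add: int_pow_mult m_assoc)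
  have "(x, x \<otimes> s [^] int n) \<in> R\<^sup>* \<and> (x, x \<otimes> s [^] (- int n)) \<in> R\<^sup>*" for n
  proof (induction n)
    case 0
    then show ?case using assms s by simp
  next
    case (Suc n)
    have "(x, x \<otimes> s [^] (int n + 1)) \<in> R\<^sup>*"
      using Suc step[of "int n"] by (meson rtrancl_into_rtrancl)
    moreover have "(x \<otimes> s [^] (- int n), x \<otimes> s [^] (- int n - 1)) \<in> R\<^sup>*"
      using step[of "- int n - 1"] reach_sym by auto
    then have "(x, x \<otimes> s [^] (- int n - 1)) \<in> R\<^sup>*" using Suc rtrancl_trans by metis
    moreover have "int (Suc n) = int n + 1" "- int (Suc n) = - int n - 1" by simp_all
    ultimately show ?case by metis
  qed
  from this[of "nat \<bar>j\<bar>"] show ?thesis by (cases "j \<ge> 0") auto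
qed

text \<open>The flat \<open>g \<langle>s, t\<rangle>\<close> is one-ended: far out, every line parallel to \<open>s\<close> or \<open>t\<close> avoids \<open>F\<close>.\<close>

lemma flat_tail:
  assumes g: "g \<in> carrier G" and st: "s \<in> S" "t \<in> S" "free_abelian_pair s t"
  shows "\<exists>N y. \<forall>i :: int. N \<le> \<bar>i\<bar> \<longrightarrow> (y, g \<otimes> s [^] i) \<in> R\<^sup>* \<and> (y, g \<otimes> t [^] i) \<in> R\<^sup>*"
proof -
  have stG: "s \<in> carrier G" "t \<in> carrier G" using st gens_carrier by auto
  have comm: "s [^] i \<otimes> t [^] j = t [^] j \<otimes> s [^] i" for i j :: int
    using st(3) stG by (intro int_pow_commute) (simp_all add: free_abelian_pair_def)
  define f where "f = (\<lambda>(i :: int, j :: int). g \<otimes> (s [^] i \<otimes> t [^] j))"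
  have "inj f"
  proof (rule injI)
    fix p q assume "f p = f q"
    then have "(\<lambda>(i :: int, j :: int). s [^] i \<otimes> t [^] j) p = (\<lambda>(i, j). s [^] i \<otimes> t [^] j) q"
      using g stG by (auto simp: f_def split: prod.splits)
    then show "p = q" using st(3) unfolding free_abelian_pair_def by (auto dest: injD)
  qed
  then have "finite (f -` F)" using F by (rule finite_vimageI[rotated])
  then have "finite ((\<lambda>(i, j). max \<bar>i\<bar> \<bar>j\<bar>) ` (f -` F))" by simp
  then have "bdd_above ((\<lambda>(i, j). max \<bar>i\<bar> \<bar>j\<bar>) ` (f -` F))" by simp
  then obtain K where K: "\<And>i j. (i, j) \<in> f -` F \<Longrightarrow> \<bar>i\<bar> \<le> K \<and> \<bar>j\<bar> \<le> K"
    unfolding bdd_above_def by force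
  \<comment> \<open>Positive, so that the lines with index \<open>N\<close> itself avoid
    \<open>F\<close> and can connect all the others.\<close>
  define N where "N = max 0 K + 1"
  have out: "g \<otimes> (s [^] i \<otimes> t [^] j) \<notin> F" if "N \<le> \<bar>i\<bar> \<or> N \<le> \<bar>j\<bar>" for i j
    using K[of i j] that by (auto simp: f_def N_def)
  have 1: "(g \<otimes> s [^] i, g \<otimes> s [^] i \<otimes> t [^] j) \<in> R\<^sup>*" if "N \<le> \<bar>i\<bar>" for i j :: int
  proof (rule line_in_component)
    show "g \<otimes> s [^] i \<otimes> t [^] k \<notin> F" for k :: int using out[of i k] that g stG by (simp add: m_assoc)
  qed (use g stG st in auto)
  have 2: "(g \<otimes> t [^] j, g \<otimes> s [^] i \<otimes> t [^] j) \<in> R\<^sup>*" if "N \<le> \<bar>j\<bar>" for i j :: int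
  proof -
    have "(g \<otimes> t [^] j, g \<otimes> t [^] j \<otimes> s [^] i) \<in> R\<^sup>*"
    proof (rule line_in_component)
      show "g \<otimes> t [^] j \<otimes> s [^] k \<notin> F" for k :: int
        using out[of k j] that g stG by (simp add: m_assoc comm)
    qed (use g stG st in auto)
    then show ?thesis using g stG by (simp add: m_assoc comm)
  qed
  have N: "N \<le> \<bar>N\<bar>" by (simp add: N_def)
  \<comment> \<open>Go parallel to \<open>s\<close> up to the corner
    \<open>g \<otimes> s [^] i \<otimes> t [^] N\<close>, then parallel to \<open>t\<close> down to
    the \<open>s\<close>-axis.\<close>
  have a: "(g \<otimes> t [^] N, g \<otimes> s [^] i) \<in> R\<^sup>*" if "N \<le> \<bar>i\<bar>" for i
    using 2[OF N, of i] reach_sym[OF 1[OF that, of N]] by (rule rtrancl_trans)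
  have b: "(g \<otimes> t [^] N, g \<otimes> t [^] j) \<in> R\<^sup>*" if "N \<le> \<bar>j\<bar>" for j
    using a[OF N] rtrancl_trans[OF 1[OF N, of j] reach_sym[OF 2[OF that, of N]]] by (rule rtrancl_trans)
  show ?thesis using a b by blast
qed

text \<open>The absolute value includes both ends of the line through \<open>g\<close> in direction
  \<open>s\<close>. For a single line \<open>tail_out\<close> is stronger than the negation of
  \<open>tail_in\<close>; the two become complementary because each line lies in a one-ended
  flat.\<close>

definition tail_in :: "'a \<Rightarrow> 'a \<Rightarrow> 'a \<Rightarrow> bool" where
  "tail_in x g s \<longleftrightarrow> (\<exists>N. \<forall>i :: int. N \<le> \<bar>i\<bar> \<longrightarrow> (x, g \<otimes> s [^] i) \<in> R\<^sup>*)"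

definition tail_out :: "'a \<Rightarrow> 'a \<Rightarrow> 'a \<Rightarrow> bool" where
  "tail_out x g s \<longleftrightarrow> (\<exists>N. \<forall>i :: int. N \<le> \<bar>i\<bar> \<longrightarrow> (x, g \<otimes> s [^] i) \<notin> R\<^sup>*)"

lemma tail_in_out: "tail_in x g s \<Longrightarrow> tail_out x g s \<Longrightarrow> False"
proof -
  assume "tail_in x g s" "tail_out x g s"
  then obtain N N' where N: "\<And>i :: int. N \<le> \<bar>i\<bar> \<Longrightarrow> (x, g \<otimes> s [^] i) \<in> R\<^sup>*"
    "\<And>i :: int. N' \<le> \<bar>i\<bar> \<Longrightarrow> (x, g \<otimes> s [^] i) \<notin> R\<^sup>*"
    unfolding tail_in_def tail_out_def by blast
  have "N \<le> \<bar>max N N'\<bar>" "N' \<le> \<bar>max N N'\<bar>" by auto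
  then show False using N by blast
qed

text \<open>Both tails run into the single end of the flat spanned by \<open>s\<close> and
  \<open>t\<close>, hence into one and the same component.\<close>

lemma tail_pair:
  assumes "g \<in> carrier G" "s \<in> S" "t \<in> S" "free_abelian_pair s t"
  shows "tail_in x g s \<and> tail_in x g t \<or> tail_out x g s \<and> tail_out x g t"
proof -
  obtain N y where N: "\<And>i :: int. N \<le> \<bar>i\<bar> \<Longrightarrow> (y, g \<otimes> s [^] i) \<in> R\<^sup>* \<and> (y, g \<otimes> t [^] i) \<in> R\<^sup>*"
    using flat_tail[OF assms] by blast
  show ?thesis
  proof (cases "(x, y) \<in> R\<^sup>*")
    case True
    then have "tail_in x g s \<and> tail_in x g t"
      unfolding tail_in_def using N by (meson rtrancl_trans)
    then show ?thesis ..
  next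
    case False
    have "tail_out x g s \<and> tail_out x g t"
      unfolding tail_out_def using N False by (meson rtrancl_trans reach_sym)
    then show ?thesis ..
  qed
qed

lemma tail_dichotomy: "g \<in> carrier G \<Longrightarrow> s \<in> S \<Longrightarrow> tail_in x g s \<or> tail_out x g s"
  using partner tail_pair by meson

lemma tail_gens:
  assumes "g \<in> carrier G" "s \<in> S" "t \<in> S"
  shows "tail_in x g s \<longleftrightarrow> tail_in x g t"
  using conn[OF assms(2,3)]
proof (induction rule: rtrancl_induct)
  case (step y z)
  then have "tail_in x g y \<longleftrightarrow> tail_in x g z"
    using tail_pair[OF assms(1), of y z x] tail_in_out by blast
  then show ?case using step by simp
qed simp

lemma tail_shift:
  assumes g: "g \<in> carrier G" and s: "s \<in> S" and T: "tail_in x g s"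
  shows "tail_in x (g \<otimes> s [^] (k :: int)) s"
proof -
  have sG: "s \<in> carrier G" using s gens_carrier by blast
  obtain N where N: "\<And>i :: int. N \<le> \<bar>i\<bar> \<Longrightarrow> (x, g \<otimes> s [^] i) \<in> R\<^sup>*"
    using T unfolding tail_in_def by blast
  have "(x, g \<otimes> s [^] k \<otimes> s [^] i) \<in> R\<^sup>*" if "N + \<bar>k\<bar> \<le> \<bar>i\<bar>" for i
    using N[of "k + i"] that g sG by (simp add: int_pow_mult m_assoc)
  then show ?thesis unfolding tail_in_def by blast
qed

text \<open>To move the base point by a generator \<open>t\<close>, switch to the line in direction
  \<open>t\<close>, shift along it, and switch back.\<close>

lemma tail_translate:
  assumes "h \<in> generate G S" "g \<in> carrier G" "s \<in> S" "tail_in x g s"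
  shows "tail_in x (g \<otimes> h) s"
  using assms(1,2,4)
proof (induction arbitrary: g rule: generate.induct)
  case (incl t)
  then have "tail_in x (g \<otimes> t [^] (1 :: int)) t"
    using tail_gens[of g s t x] assms(3) by (intro tail_shift) auto
  then show ?case
    using incl tail_gens[of "g \<otimes> t" t s x] assms(3) gens_carrier by (simp add: subset_iff)
next
  case (inv t)
  have "tail_in x (g \<otimes> t [^] (- 1 :: int)) t"
    using inv tail_gens[of g s t x] assms(3) by (intro tail_shift) auto
  moreover have "t \<in> carrier G" using inv gens_carrier by blast
  ultimately show ?case
    using inv tail_gens[of "g \<otimes> inv t" t s x] assms(3) by (simp add: int_pow_neg)
next
  case (eng h k)
  then have "h \<in> carrier G" "k \<in> carrier G" using generate_in_carrier[OF gens_carrier] by auto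
  then show ?case using eng by (simp add: m_assoc[symmetric])
qed simp

lemma tail_const:
  assumes "g \<in> carrier G" "h \<in> carrier G" "s \<in> S"
  shows "tail_in x g s \<longleftrightarrow> tail_in x h s"
proof -
  have gen: "generate G S = carrier G" using S by (simp add: finite_generating_set_def)
  have "tail_in x h s" if "tail_in x g s" "g \<in> carrier G" "h \<in> carrier G" for g h
    using tail_translate[of "inv g \<otimes> h" g s x] that assms(3) by (simp add: gen m_assoc[symmetric])
  then show ?thesis using assms by blast
qed

text \<open>Starting in the component and following \<open>s\<close>, one eventually leaves it, and
  the first step out must enter \<open>F\<close>. So the component is covered by the finitely many
  lines in direction \<open>s\<close> through \<open>F\<close>, each of which meets it in a bounded
  set.\<close>

lemma finite_component:
  assumes x: "x \<in> carrier G - F" and s: "s \<in> S" and out: "\<And>g. g \<in> carrier G \<Longrightarrow> tail_out x g s"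
  shows "finite {y. (x, y) \<in> R\<^sup>*}"
proof -
  let ?C = "{y. (x, y) \<in> R\<^sup>*}"
  have sG: "s \<in> carrier G" using s gens_carrier by blast
  have CG: "y \<in> carrier G - F" if "y \<in> ?C" for y
  proof -
    have "(x, y) \<in> R\<^sup>*" using that by simp
    then show ?thesis using x by induction (auto simp: R_def full_subgraph_def)
  qed
  have "?C \<subseteq> (\<Union>f\<in>F \<inter> carrier G. (\<lambda>i. f \<otimes> s [^] i) ` {i :: int. f \<otimes> s [^] i \<in> ?C})"
  proof
    fix y assume y: "y \<in> ?C"
    have yG: "y \<in> carrier G" "y \<notin> F" using CG[OF y] by auto
    have "\<exists>k. y \<otimes> s [^] k \<in> ?C \<and> y \<otimes> s [^] Suc k \<notin> ?C"
    proof (rule ccontr)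
      assume no: "\<not> ?thesis"
      have all: "y \<otimes> s [^] k \<in> ?C" for k :: nat
      proof (induction k)
        case 0
        then show ?case using y yG by simp
      next
        case (Suc k)
        then show ?case using no by blast
      qed
      obtain N where N: "\<And>i :: int. N \<le> \<bar>i\<bar> \<Longrightarrow> (x, y \<otimes> s [^] i) \<notin> R\<^sup>*"
        using out[OF yG(1)] unfolding tail_out_def by blast
      have "(x, y \<otimes> s [^] int (nat \<bar>N\<bar>)) \<notin> R\<^sup>*" by (rule N) simp
      then show False using all[of "nat \<bar>N\<bar>"] by (simp add: int_pow_int)
    qed
    then obtain k where k: "y \<otimes> s [^] k \<in> ?C" "y \<otimes> s [^] Suc k \<notin> ?C" by blast
    have "y \<otimes> s [^] Suc k \<in> F"
    proof (rule ccontr)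
      assume "y \<otimes> s [^] Suc k \<notin> F"
      then have "(y \<otimes> s [^] k, y \<otimes> s [^] k \<otimes> s) \<in> R"
        using CG[OF k(1)] s yG sG by (intro step_in_R) (auto simp: m_assoc)
      then have "y \<otimes> s [^] k \<otimes> s \<in> ?C" using k(1) by (auto intro: rtrancl_into_rtrancl)
      then show False using k(2) yG sG by (simp add: m_assoc)
    qed
    moreover have "y = y \<otimes> s [^] Suc k \<otimes> s [^] (- int (Suc k))"
      using yG sG by (simp only: int_pow_neg_int nat_pow_closed m_assoc inv_closed r_inv r_one)
    ultimately show "y \<in> (\<Union>f\<in>F \<inter> carrier G. (\<lambda>i. f \<otimes> s [^] i) ` {i :: int. f \<otimes> s [^] i \<in> ?C})"
      using y yG sG
      by (intro UN_I[of "y \<otimes> s [^] Suc k"] image_eqI[of _ _ "- int (Suc k)"]) (simp_all del: nat_pow_Suc)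
  qed
  moreover have "finite {i :: int. f \<otimes> s [^] i \<in> ?C}" if f: "f \<in> F \<inter> carrier G" for f
  proof -
    obtain N where N: "\<And>i :: int. N \<le> \<bar>i\<bar> \<Longrightarrow> (x, f \<otimes> s [^] i) \<notin> R\<^sup>*"
      using out[of f] f unfolding tail_out_def by blast
    have "{i :: int. f \<otimes> s [^] i \<in> ?C} \<subseteq> {- N..N}"
    proof
      fix i :: int assume "i \<in> {i. f \<otimes> s [^] i \<in> ?C}"
      then have "\<not> N \<le> \<bar>i\<bar>" using N by blast
      then show "i \<in> {- N..N}" by auto
    qed
    then show ?thesis by (rule finite_subset) simp
  qed
  ultimately show ?thesis using F by (meson finite_Int finite_UN_I finite_imageI finite_subset)
qed

text \<open>If a component lacked the tail of the line of \<open>s\<close> through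
  \<open>\<one>\<close>, it would lack the tails of all lines in that direction and be finite. Two
  components that contain this tail meet.\<close>

lemma infinite_components_unique:
  assumes ne: "S \<noteq> {}"
    and C: "C \<in> infinite_components (full_subgraph (cayley_graph G S) (carrier G - F))"
    and C': "C' \<in> infinite_components (full_subgraph (cayley_graph G S) (carrier G - F))"
  shows "C = C'"
proof -
  obtain s where s: "s \<in> S" using ne by blast
  have *: "\<exists>x. C = {y. (x, y) \<in> R\<^sup>*} \<and> tail_in x \<one> s"
    if C: "C \<in> infinite_components (full_subgraph (cayley_graph G S) (carrier G - F))" for C
  proof -
    obtain x where x: "x \<in> carrier G - F" "C = {y. (x, y) \<in> R\<^sup>*}" "infinite C"
      using C unfolding infinite_components_iff[OF full_cayley_graph[OF group_axioms]] R_def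
      by (auto simp: full_subgraph_def)
    have "tail_in x \<one> s"
    proof (rule ccontr)
      assume "\<not> tail_in x \<one> s"
      then have "tail_out x g s" if "g \<in> carrier G" for g
        using tail_const[OF that one_closed s] tail_dichotomy[OF that s] by blast
      then show False using finite_component[OF x(1) s] x by blast
    qed
    then show ?thesis using x by blast
  qed
  obtain x x' where x: "C = {y. (x, y) \<in> R\<^sup>*}" "tail_in x \<one> s" "C' = {y. (x', y) \<in> R\<^sup>*}" "tail_in x' \<one> s"
    using *[OF C] *[OF C'] by blast
  obtain N N' where N: "\<And>i :: int. N \<le> \<bar>i\<bar> \<Longrightarrow> (x, \<one> \<otimes> s [^] i) \<in> R\<^sup>*"
    "\<And>i :: int. N' \<le> \<bar>i\<bar> \<Longrightarrow> (x', \<one> \<otimes> s [^] i) \<in> R\<^sup>*"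
    using x(2,4) unfolding tail_in_def by blast
  define i where "i = max N N'"
  have "(x, \<one> \<otimes> s [^] i) \<in> R\<^sup>*" "(x', \<one> \<otimes> s [^] i) \<in> R\<^sup>*" by (auto intro!: N simp: i_def)
  then have "(x, x') \<in> R\<^sup>*" "(x', x) \<in> R\<^sup>*" by (meson reach_sym rtrancl_trans)+
  then show ?thesis unfolding x by (auto intro: rtrancl_trans)
qed

end

lemma one_ended_if_commuting:
  assumes S: "finite_generating_set G S" "S \<noteq> {}"
    and conn: "\<And>s t. s \<in> S \<Longrightarrow> t \<in> S \<Longrightarrow> (s, t) \<in> {(x, y). x \<in> S \<and> y \<in> S \<and> free_abelian_pair x y}\<^sup>*"
    and partner: "\<And>s. s \<in> S \<Longrightarrow> \<exists>t\<in>S. free_abelian_pair s t"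
  shows "one_ended G"
proof -
  let ?I = "\<lambda>F. infinite_components (full_subgraph (cayley_graph G S) (carrier G - F))"
  let ?e = "\<lambda>F. if finite (?I F) then enat (card (?I F)) else \<infinity>"
  have le: "?e F \<le> 1" if "finite F" for F
  proof -
    have "?I F = {} \<or> (\<exists>C. ?I F = {C})"
      using infinite_components_unique[OF S(1) that conn partner S(2)] by blast
    then show ?thesis by (auto simp: one_enat_def)
  qed
  \<comment> \<open>Removing nothing leaves the whole group as one infinite component, which bounds
    the supremum below by 1.\<close>
  have "carrier G \<in> ?I {}"
  proof -
    obtain s t where st: "s \<in> S" "t \<in> S" "free_abelian_pair s t" using S(2) partner by blast
    then have stG: "s \<in> carrier G" "t \<in> carrier G" using S(1) by (auto simp: finite_generating_set_def)
    have "range (\<lambda>(i :: int, j :: int). s [^] i \<otimes> t [^] j) \<subseteq> carrier G" using stG by auto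
    moreover have "infinite (range (\<lambda>(i :: int, j :: int). s [^] i \<otimes> t [^] j))"
      using st(3) finite_imageD infinite_UNIV_int
      by (auto simp: free_abelian_pair_def finite_prod dest!: finite_imageD)
    ultimately have "infinite (carrier G)" using finite_subset by blast
    moreover have "carrier G = {y. (\<one>, y) \<in> (parcs (full_subgraph (cayley_graph G S) (carrier G - {})))\<^sup>*}"
    proof -
      have eq: "parcs (full_subgraph (cayley_graph G S) (carrier G - {})) = parcs (cayley_graph G S)"
        by (auto simp: full_subgraph_def cayley_graph_def)
      have "(\<one>, y) \<in> (parcs (cayley_graph G S))\<^sup>*" if "y \<in> carrier G" for y
        using cayley_graph_connected[OF S(1) that one_closed] that by simp
      moreover have "y \<in> carrier G" if "(\<one>, y) \<in> (parcs (cayley_graph G S))\<^sup>*" for y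
        using that by induction (auto simp: cayley_graph_def)
      ultimately show ?thesis unfolding eq by blast
    qed
    ultimately show ?thesis
      unfolding infinite_components_iff[OF full_cayley_graph[OF group_axioms]]
      by (auto simp: full_subgraph_def)
  qed
  then have "?I {} \<noteq> {}" by blast
  then have ge: "1 \<le> ?e {}"
    by (auto simp: one_enat_def Suc_le_eq card_gt_0_iff)
  have "graph_ends (cayley_graph G S) = (SUP F \<in> {F. finite F \<and> F \<subseteq> carrier G}. ?e F)"
    by (simp add: graph_ends_def cayley_graph_def Let_def)
  also have "\<dots> = 1"
  proof (rule antisym)
    show "(SUP F \<in> {F. finite F \<and> F \<subseteq> carrier G}. ?e F) \<le> 1" by (rule SUP_least) (use le in simp)
    show "1 \<le> (SUP F \<in> {F. finite F \<and> F \<subseteq> carrier G}. ?e F)"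
      by (rule SUP_upper2[of "{}"]) (use ge in simp_all)
  qed
  finally show ?thesis unfolding one_ended_def using S(1) by blast
qed

end

section \<open>Bestvina--Brady groups\<close>

text \<open>Von Dyck's theorem. The value at a class is computed from a chosen representative, and
  \<open>gword_eval_pres_eq\<close> makes the choice immaterial.\<close>

lemma presented_group_hom_exists:
  assumes M: "group M" and f: "f \<in> X \<rightarrow> carrier M"
    and rel: "\<And>r. r \<in> R \<Longrightarrow> gword_eval M f r = \<one>\<^bsub>M\<^esub>"
  shows "\<exists>h\<in>hom (presented_group X R) M. \<forall>u\<in>gwords X. h (pres_class X R u) = gword_eval M f u"
proof -
  interpret M: group M by fact
  define h where "h A = gword_eval M f (SOME u. u \<in> A)" for A
  have h: "h (pres_class X R u) = gword_eval M f u" if u: "u \<in> gwords X" for u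
  proof -
    have "u \<in> pres_class X R u" using u by (simp add: pres_class_def pres_eq.refl)
    then have "(SOME w. w \<in> pres_class X R u) \<in> pres_class X R u" by (rule someI)
    then have "pres_eq X R u (SOME w. w \<in> pres_class X R u)" by (simp add: pres_class_def)
    then show ?thesis using M.gword_eval_pres_eq[OF f rel] by (simp add: h_def)
  qed
  have "h \<in> hom (presented_group X R) M"
  proof (rule homI)
    fix A B assume A: "A \<in> carrier (presented_group X R)" and B: "B \<in> carrier (presented_group X R)"
    obtain u where u: "u \<in> gwords X" "A = pres_class X R u" using A by (rule presented_group_cases)
    obtain w where w: "w \<in> gwords X" "B = pres_class X R w" using B by (rule presented_group_cases)
    show "h A \<in> carrier M" using u f by (simp add: h M.gword_eval_closed)
    show "h (A \<otimes>\<^bsub>presented_group X R\<^esub> B) = h A \<otimes>\<^bsub>M\<^esub> h B"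
      using u w by (simp add: presented_group_mult h M.gword_eval_append[OF f])
  qed
  then show ?thesis using h by blast
qed

section \<open>Vertex and edge generators, and homomorphisms given by vertex labels\<close>

abbreviation raag_class :: "'a pair_pre_digraph \<Rightarrow> 'a gword \<Rightarrow> 'a gword set" where
  "raag_class G \<equiv> pres_class (pverts G) (raag_relators G)"

abbreviation raag_gen :: "'a pair_pre_digraph \<Rightarrow> 'a \<Rightarrow> 'a gword set" where
  "raag_gen G x \<equiv> raag_class G [(x, True)]"

abbreviation bb_carrier :: "'a pair_pre_digraph \<Rightarrow> 'a gword set set" where
  "bb_carrier G \<equiv> kernel (raag G) integer_group raag_height"

lemma raag_gen_closed: "v \<in> pverts G \<Longrightarrow> raag_gen G v \<in> carrier (raag G)"
  by (simp add: raag_def)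

lemma raag_gen_commute:
  assumes "(v, w) \<in> parcs G" "v \<in> pverts G" "w \<in> pverts G"
  shows "raag_gen G v \<otimes>\<^bsub>raag G\<^esub> raag_gen G w = raag_gen G w \<otimes>\<^bsub>raag G\<^esub> raag_gen G v"
proof -
  interpret group "raag G" by (rule group_raag)
  let ?v = "raag_gen G v" and ?w = "raag_gen G w"
  note closed = raag_gen_closed[OF assms(2)] raag_gen_closed[OF assms(3)]
  let ?r = "[(v, True), (w, True), (v, False), (w, False)]"
  have "raag_class G ?r = \<one>\<^bsub>raag G\<^esub>"
    unfolding raag_def by (rule pres_class_relator) (use assms in \<open>auto simp: raag_relators_def\<close>)
  moreover have "raag_class G ?r = gword_eval (raag G) (raag_gen G) ?r"
    unfolding raag_def by (rule pres_class_eval) (use assms in simp)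
  ultimately have "?v \<otimes>\<^bsub>raag G\<^esub> (?w \<otimes>\<^bsub>raag G\<^esub> (inv\<^bsub>raag G\<^esub> ?v \<otimes>\<^bsub>raag G\<^esub> inv\<^bsub>raag G\<^esub> ?w)) = \<one>\<^bsub>raag G\<^esub>"
    using closed by simp
  then have "(?v \<otimes>\<^bsub>raag G\<^esub> ?w) \<otimes>\<^bsub>raag G\<^esub> inv\<^bsub>raag G\<^esub> (?w \<otimes>\<^bsub>raag G\<^esub> ?v) = \<one>\<^bsub>raag G\<^esub>"
    using closed by (simp add: m_assoc inv_mult_group)
  then show ?thesis
    using closed by (subst (asm) inv_solve_right') simp_all
qed

text \<open>The relators are commutators and the target is abelian, so the labels \<open>n\<close>
  are arbitrary.\<close>

lemma raag_character:
  fixes n :: "'a \<Rightarrow> int"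
  shows "\<exists>\<phi>\<in>hom (raag G) integer_group. \<forall>v\<in>pverts G. \<phi> (raag_gen G v) = n v"
proof -
  have "\<exists>h\<in>hom (raag G) integer_group. \<forall>u\<in>gwords (pverts G). h (raag_class G u) = gword_eval integer_group n u"
    unfolding raag_def by (rule presented_group_hom_exists) (auto simp: raag_relators_def)
  then obtain h where h: "h \<in> hom (raag G) integer_group"
    "\<And>u. u \<in> gwords (pverts G) \<Longrightarrow> h (raag_class G u) = gword_eval integer_group n u" by blast
  show ?thesis using h(2)[of "[(_, True)]"] by (intro bexI[OF _ h(1)]) simp
qed

lemma subgroup_bb_carrier: "subgroup (bb_carrier G) (raag G)"
proof -
  interpret h: group_hom "raag G" integer_group raag_height
    by (intro group_hom.intro group_hom_axioms.intro group_raag raag_height_hom) simp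
  show ?thesis by (rule h.subgroup_kernel)
qed

lemma bestvina_brady_simps [simp]:
  "carrier (bestvina_brady G) = bb_carrier G"
  "x \<otimes>\<^bsub>bestvina_brady G\<^esub> y = x \<otimes>\<^bsub>raag G\<^esub> y"
  "\<one>\<^bsub>bestvina_brady G\<^esub> = \<one>\<^bsub>raag G\<^esub>"
  by (simp_all add: bestvina_brady_def)

text \<open>The edge generators of Dicks and Leary; reversing the edge inverts the element.\<close>

definition bb_edge :: "'a pair_pre_digraph \<Rightarrow> 'a \<times> 'a \<Rightarrow> 'a gword set" where
  "bb_edge G = (\<lambda>(v, w). raag_gen G v \<otimes>\<^bsub>raag G\<^esub> inv\<^bsub>raag G\<^esub> raag_gen G w)"

lemma raag_hom_bb_edge:
  assumes "\<phi> \<in> hom (raag G) integer_group" "v \<in> pverts G" "w \<in> pverts G"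
  shows "\<phi> (bb_edge G (v, w)) = \<phi> (raag_gen G v) - \<phi> (raag_gen G w)"
proof -
  interpret h: group_hom "raag G" integer_group \<phi>
    by (intro group_hom.intro group_hom_axioms.intro group_raag assms) simp
  show ?thesis
    using raag_gen_closed[OF assms(2)] raag_gen_closed[OF assms(3)] by (simp add: bb_edge_def)
qed

lemma bb_edge_closed:
  assumes "v \<in> pverts G" "w \<in> pverts G"
  shows "bb_edge G (v, w) \<in> bb_carrier G"
proof -
  interpret group "raag G" by (rule group_raag)
  show ?thesis
    using raag_hom_bb_edge[OF raag_height_hom assms] raag_height_generator[of _ G] assms raag_gen_closed[of _ G]
    by (simp add: kernel_def) (simp add: bb_edge_def)
qed

text \<open>Quotients of equal powers of two vertex generators telescope along a path of edges. With
  powers of a base vertex \<open>t\<close> inserted between its letters, a word of exponent sum zero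
  becomes a product of such quotients.\<close>

lemma finite_generating_set_bb:
  assumes G: "pair_graph G" and conn: "\<And>v w. v \<in> pverts G \<Longrightarrow> w \<in> pverts G \<Longrightarrow> (v, w) \<in> (parcs G)\<^sup>*"
    and ne: "pverts G \<noteq> {}"
  shows "finite_generating_set (bestvina_brady G) (bb_edge G ` parcs G)"
proof -
  interpret group "raag G" by (rule group_raag)
  let ?A = "raag G" and ?S = "bb_edge G ` parcs G"
  note arcs = pair_graph_arcs[OF G]
  have SK: "?S \<subseteq> bb_carrier G"
  proof
    fix s assume "s \<in> ?S"
    then obtain v w where vw: "(v, w) \<in> parcs G" "s = bb_edge G (v, w)" by auto
    then show "s \<in> bb_carrier G" using bb_edge_closed[OF arcs(3,4)[OF vw(1)]] by simp
  qed
  have SA: "?S \<subseteq> carrier ?A" using SK subgroup.subset[OF subgroup_bb_carrier] by blast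
  define N where "N = generate ?A ?S"
  have N: "subgroup N ?A" unfolding N_def by (rule generate_is_subgroup[OF SA])
  let ?g = "raag_gen G"
  have gc: "?g v \<in> carrier ?A" if "v \<in> pverts G" for v using that by (rule raag_gen_closed)
  have pow: "?g v [^]\<^bsub>?A\<^esub> k \<otimes>\<^bsub>?A\<^esub> inv\<^bsub>?A\<^esub> (?g w [^]\<^bsub>?A\<^esub> k) \<in> N"
    if v: "v \<in> pverts G" and w: "w \<in> pverts G" for v w and k :: int
    using conn[OF v w] w
  proof (induction rule: rtrancl_induct)
    case base
    then show ?case using gc[OF v] subgroup.one_closed[OF N] by simp
  next
    case (step y z)
    have yz: "y \<in> pverts G" "z \<in> pverts G" using arcs[OF step(2)] by auto
    have comm: "?g y \<otimes>\<^bsub>?A\<^esub> inv\<^bsub>?A\<^esub> ?g z = inv\<^bsub>?A\<^esub> ?g z \<otimes>\<^bsub>?A\<^esub> ?g y"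
      using int_pow_commute[OF raag_gen_commute[OF step(2) yz], of 1 "- 1"] gc yz by (simp add: int_pow_neg)
    have "?g y [^]\<^bsub>?A\<^esub> k \<otimes>\<^bsub>?A\<^esub> inv\<^bsub>?A\<^esub> (?g z [^]\<^bsub>?A\<^esub> k) = (?g y \<otimes>\<^bsub>?A\<^esub> inv\<^bsub>?A\<^esub> ?g z) [^]\<^bsub>?A\<^esub> k"
      using gc[OF yz(1)] gc[OF yz(2)] comm by (subst int_pow_mult_distrib) (simp_all add: int_pow_inv)
    moreover have "?g y \<otimes>\<^bsub>?A\<^esub> inv\<^bsub>?A\<^esub> ?g z \<in> N"
      unfolding N_def using step(2) by (intro generate.incl image_eqI[of _ _ "(y, z)"]) (simp_all add: bb_edge_def)
    ultimately have "?g y [^]\<^bsub>?A\<^esub> k \<otimes>\<^bsub>?A\<^esub> inv\<^bsub>?A\<^esub> (?g z [^]\<^bsub>?A\<^esub> k) \<in> N"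
      using subgroup_int_pow_closed[OF N] by simp
    from subgroup.m_closed[OF N step.IH[OF yz(1)] this] show ?case
      using gc[OF yz(1)] gc[OF yz(2)] gc[OF v] by (simp add: m_assoc inv_mult_cancel)
  qed
  obtain t where t: "t \<in> pverts G" using ne by blast
  let ?t = "\<lambda>k :: int. ?g t [^]\<^bsub>?A\<^esub> k"
  have tc: "?t k \<in> carrier ?A" for k using gc[OF t] by simp
  \<comment> \<open>Inserting the \<open>h\<close>-th power of \<open>x\<close> and its inverse
    splits this into two quotients of equal powers, with exponents \<open>h\<close> and
    \<open>h + e\<close>.\<close>
  have letter: "?t h \<otimes>\<^bsub>?A\<^esub> ?g x [^]\<^bsub>?A\<^esub> e \<otimes>\<^bsub>?A\<^esub> inv\<^bsub>?A\<^esub> (?t (h + e)) \<in> N" if x: "x \<in> pverts G" for x and h e :: int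
    using subgroup.m_closed[OF N pow[OF t x, of h] pow[OF x t, of "h + e"]] gc[OF x] tc
    by (simp add: m_assoc inv_mult_cancel int_pow_mult)
  have word: "?t h \<otimes>\<^bsub>?A\<^esub> raag_class G u \<otimes>\<^bsub>?A\<^esub> inv\<^bsub>?A\<^esub> (?t (h + exponent_sum u)) \<in> N"
    if "u \<in> gwords (pverts G)" for u h
    using that
  proof (induction u arbitrary: h)
    case Nil
    have "raag_class G [] = \<one>\<^bsub>?A\<^esub>" by (simp add: raag_def one_presented_group)
    then show ?case using tc subgroup.one_closed[OF N] by (simp add: exponent_sum_def)
  next
    case (Cons l u)
    obtain x b where l: "l = (x, b)" by (cases l)
    let ?e = "if b then 1 else - 1 :: int"
    have x: "x \<in> pverts G" and u: "u \<in> gwords (pverts G)" using Cons.prems l by auto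
    have uc: "raag_class G u \<in> carrier ?A" using u by (simp add: raag_def)
    have "raag_class G (l # u) = ?g x [^]\<^bsub>?A\<^esub> ?e \<otimes>\<^bsub>?A\<^esub> raag_class G u"
      using pres_class_Cons[of x b u "pverts G" "raag_relators G"] Cons.prems l gc[OF x]
      by (simp add: raag_def[symmetric] int_pow_neg)
    moreover have "exponent_sum (l # u) = ?e + exponent_sum u" using l by (simp add: exponent_sum_def)
    ultimately show ?case
      using subgroup.m_closed[OF N letter[OF x, of h ?e] Cons.IH[OF u, of "h + ?e"]] gc[OF x] tc uc
      by (simp add: m_assoc inv_mult_cancel add.assoc del: if_split)
  qed
  have "bb_carrier G \<subseteq> N"
  proof
    fix g assume g: "g \<in> bb_carrier G"
    then have gA: "g \<in> carrier ?A" "raag_height g = 0" by (auto simp: kernel_def)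
    obtain u where u: "u \<in> gwords (pverts G)" "g = raag_class G u"
      using gA(1) unfolding raag_def by (rule presented_group_cases)
    have "exponent_sum u = 0" using gA(2) u by (simp add: raag_height_class)
    then show "g \<in> N" using word[OF u(1), of 0] u gA by simp
  qed
  moreover have "N \<subseteq> bb_carrier G"
    unfolding N_def by (rule generate_subgroup_incl[OF SK subgroup_bb_carrier])
  moreover have "generate (bestvina_brady G) ?S = N"
    unfolding N_def bestvina_brady_def by (rule generate_consistent[OF SK subgroup_bb_carrier])
  ultimately have "generate (bestvina_brady G) ?S = carrier (bestvina_brady G)" by simp
  moreover have "finite ?S"
  proof -
    interpret pair_graph G by fact
    show ?thesis using pair_finite_arcs by simp
  qed
  ultimately show ?thesis using SK by (simp add: finite_generating_set_def)
qed

lemma (in group) commute_quotients: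
  assumes "a \<otimes> c = c \<otimes> a" "a \<otimes> d = d \<otimes> a" "b \<otimes> c = c \<otimes> b" "b \<otimes> d = d \<otimes> b"
    and "a \<in> carrier G" "b \<in> carrier G" "c \<in> carrier G" "d \<in> carrier G"
  shows "(a \<otimes> inv b) \<otimes> (c \<otimes> inv d) = (c \<otimes> inv d) \<otimes> (a \<otimes> inv b)"
proof -
  have inv: "x \<otimes> inv y = inv y \<otimes> x" if "x \<otimes> y = y \<otimes> x" "x \<in> carrier G" "y \<in> carrier G" for x y
    using int_pow_commute[OF that, of 1 "- 1"] that by (simp add: int_pow_neg)
  have mult: "x \<otimes> (y \<otimes> z) = (y \<otimes> z) \<otimes> x"
    if "x \<otimes> y = y \<otimes> x" "x \<otimes> z = z \<otimes> x" "x \<in> carrier G" "y \<in> carrier G" "z \<in> carrier G" for x y z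
    using that by (metis m_assoc)
  have 1: "a \<otimes> (c \<otimes> inv d) = (c \<otimes> inv d) \<otimes> a" using assms by (intro mult inv) simp_all
  have "b \<otimes> (c \<otimes> inv d) = (c \<otimes> inv d) \<otimes> b" using assms by (intro mult inv) simp_all
  then have 2: "(c \<otimes> inv d) \<otimes> inv b = inv b \<otimes> (c \<otimes> inv d)" using assms by (intro inv) simp_all
  show ?thesis using mult[OF 1[symmetric] 2] assms by simp
qed

lemma bb_edge_commute:
  assumes G: "pair_graph G" and "v \<in> pverts G" "w \<in> pverts G" "x \<in> pverts G" "y \<in> pverts G"
    and "v = x \<or> (v, x) \<in> parcs G" "v = y \<or> (v, y) \<in> parcs G" "w = x \<or> (w, x) \<in> parcs G"
      "w = y \<or> (w, y) \<in> parcs G"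
  shows "bb_edge G (v, w) \<otimes>\<^bsub>raag G\<^esub> bb_edge G (x, y) = bb_edge G (x, y) \<otimes>\<^bsub>raag G\<^esub> bb_edge G (v, w)"
proof -
  interpret group "raag G" by (rule group_raag)
  have c: "raag_gen G v \<otimes>\<^bsub>raag G\<^esub> raag_gen G w = raag_gen G w \<otimes>\<^bsub>raag G\<^esub> raag_gen G v"
    if "v = w \<or> (v, w) \<in> parcs G" for v w
  proof (cases "v = w")
    case False
    then have vw: "(v, w) \<in> parcs G" using that by blast
    show ?thesis by (rule raag_gen_commute[OF vw pair_graph_arcs(3,4)[OF G vw]])
  qed simp
  show ?thesis
    unfolding bb_edge_def prod.case using assms by (intro commute_quotients c raag_gen_closed)
qed

lemma bb_hom: "\<phi> \<in> hom (raag G) H \<Longrightarrow> \<phi> \<in> hom (bestvina_brady G) H"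
  using subgroup.subset[OF subgroup_bb_carrier[of G]] by (auto simp: hom_def subset_iff)

text \<open>The two homomorphisms are dual to \<open>s\<close> and \<open>t\<close> and read off the
  exponents.\<close>

lemma (in group) free_abelian_pairI:
  assumes "s \<otimes> t = t \<otimes> s" "s \<in> carrier G" "t \<in> carrier G"
    and \<phi>: "\<phi> \<in> hom G integer_group" "\<phi> s = 1" "\<phi> t = 0"
    and \<psi>: "\<psi> \<in> hom G integer_group" "\<psi> s = 0" "\<psi> t = 1"
  shows "free_abelian_pair s t"
proof -
  have "\<phi> (s [^] i \<otimes> t [^] j) = i" "\<psi> (s [^] i \<otimes> t [^] j) = j" for i j :: int
    using assms hom_int_pow[OF \<phi>(1) _ group_axioms group_integer_group]
      hom_int_pow[OF \<psi>(1) _ group_axioms group_integer_group]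
      hom_mult[OF \<phi>(1)] hom_mult[OF \<psi>(1)] by simp_all
  then have "inj (\<lambda>(i :: int, j :: int). s [^] i \<otimes> t [^] j)"
    by (intro injI) (metis (mono_tags, lifting) case_prod_beta prod.expand)
  then show ?thesis using assms(1) by (simp add: free_abelian_pair_def)
qed

lemma rtrancl_hom:
  assumes "\<And>x y. (x, y) \<in> R \<Longrightarrow> (f x, f y) \<in> R'" "(a, b) \<in> R\<^sup>*"
  shows "(f a, f b) \<in> R'\<^sup>*"
  using assms(2) by induction (auto intro: rtrancl_into_rtrancl assms(1))

lemma arcs_nonempty:
  assumes conn: "\<And>v w. v \<in> pverts G \<Longrightarrow> w \<in> pverts G \<Longrightarrow> (v, w) \<in> (parcs G)\<^sup>*"
    and card: "card (pverts G) \<ge> 2"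
  shows "parcs G \<noteq> {}"
proof -
  have "finite (pverts G)" using card card.infinite by fastforce
  then obtain v w where "v \<in> pverts G" "w \<in> pverts G" "v \<noteq> w"
    using card card_le_Suc0_iff_eq[of "pverts G"] by auto
  then show ?thesis using conn[of v w] by (auto elim: converse_rtranclE)
qed

section \<open>Chains of triangles\<close>

context
  fixes G :: "'a pair_pre_digraph"
  assumes G: "pair_graph G"
    and conn: "\<And>v w. v \<in> pverts G \<Longrightarrow> w \<in> pverts G \<Longrightarrow> (v, w) \<in> (parcs G)\<^sup>*"
    and link: "\<And>v a b. (v, a) \<in> parcs G \<Longrightarrow> (v, b) \<in> parcs G \<Longrightarrow>
      (b, a) \<in> (parcs G \<inter> {x. (v, x) \<in> parcs G} \<times> {x. (v, x) \<in> parcs G})\<^sup>*"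
begin

text \<open>Connectedness of the link of \<open>v\<close> turns one edge at \<open>v\<close> into
  any other through a fan of triangles, and a path of vertices carries this across the graph.
  \<open>T\<close> is left open because two relations are needed: commuting, and spanning a flat.
  Reversal is a separate assumption because an edge and its reverse satisfy the first relation but
  not the second.\<close>

lemma arcs_connected:
  assumes tri: "\<And>v a b. (v, a) \<in> parcs G \<Longrightarrow> (v, b) \<in> parcs G \<Longrightarrow> (a, b) \<in> parcs G \<Longrightarrow> ((v, a), (v, b)) \<in> T\<^sup>*"
    and swap: "\<And>v w. (v, w) \<in> parcs G \<Longrightarrow> ((v, w), (w, v)) \<in> T\<^sup>*"
    and p: "p \<in> parcs G" and q: "q \<in> parcs G"
  shows "(p, q) \<in> T\<^sup>*"
proof -
  have star: "((v, b), (v, a)) \<in> T\<^sup>*" if "(v, a) \<in> parcs G" "(v, b) \<in> parcs G" for v a b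
    using link[OF that]
  proof (induction rule: rtrancl_induct)
    case (step y z)
    then show ?case using tri[of v y z] by (auto intro: rtrancl_trans)
  qed simp
  obtain v a where va: "p = (v, a)" "(v, a) \<in> parcs G" using p by (cases p) auto
  have "((v, a), (w, b)) \<in> T\<^sup>*" if vw: "(v, w) \<in> (parcs G)\<^sup>*" and wb: "(w, b) \<in> parcs G" for w b
    using vw wb
  proof (induction arbitrary: b rule: rtrancl_induct)
    case base
    then show ?case using star va by blast
  next
    case (step y z)
    have "((v, a), (y, z)) \<in> T\<^sup>*" using step by blast
    also have "((y, z), (z, y)) \<in> T\<^sup>*" using swap step by blast
    also have "((z, y), (z, b)) \<in> T\<^sup>*" using star step pair_graph_arcs[OF G] by blast
    finally show ?case .
  qed
  moreover obtain w b where wb: "q = (w, b)" "(w, b) \<in> parcs G" using q by (cases q) auto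
  moreover have "(v, w) \<in> (parcs G)\<^sup>*"
    using pair_graph_arcs(3)[OF G va(2)] pair_graph_arcs(3)[OF G wb(2)] by (rule conn)
  ultimately show ?thesis using va by simp
qed

text \<open>If the edge lies in no triangle, each endpoint is isolated in the link of the other.
  Connected links then leave no further neighbours, and the graph is this single edge.\<close>

lemma arc_in_triangle:
  assumes card: "card (pverts G) \<ge> 3" and vw: "(v, w) \<in> parcs G"
  shows "\<exists>x. (v, x) \<in> parcs G \<and> (w, x) \<in> parcs G"
proof (rule ccontr)
  assume no: "\<not> ?thesis"
  note arcs = pair_graph_arcs[OF G]
  have one: "a = w" if no: "\<not> (\<exists>x. (v, x) \<in> parcs G \<and> (w, x) \<in> parcs G)"
    and vw: "(v, w) \<in> parcs G" and va: "(v, a) \<in> parcs G" for v w a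
  proof (rule ccontr)
    assume ne: "a \<noteq> w"
    from link[OF va vw] show False
    proof (rule converse_rtranclE)
      assume "w = a"
      then show False using ne by simp
    next
      fix x assume "(w, x) \<in> parcs G \<inter> {x. (v, x) \<in> parcs G} \<times> {x. (v, x) \<in> parcs G}"
      then show False using no by blast
    qed
  qed
  have Nv: "a = w" if "(v, a) \<in> parcs G" for a using one[OF no vw that] .
  have Nw: "a = v" if "(w, a) \<in> parcs G" for a using one[of w v a] no arcs(1)[OF vw] that by blast
  have "pverts G \<subseteq> {v, w}"
  proof
    fix y assume "y \<in> pverts G"
    then have "(v, y) \<in> (parcs G)\<^sup>*" using conn arcs(3)[OF vw] by blast
    then show "y \<in> {v, w}" using Nv Nw by induction auto
  qed
  then have "card (pverts G) \<le> card {v, w}" by (intro card_mono) auto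
  also have "\<dots> \<le> 2" by (simp add: card_insert_if)
  finally show False using card by simp
qed

lemma bestvina_brady_fibers:
  assumes card: "card (pverts G) \<ge> 2"
  shows "algebraically_fibers (bestvina_brady G)"
proof -
  note arcs = pair_graph_arcs[OF G]
  let ?B = "bestvina_brady G" and ?S = "bb_edge G ` parcs G"
  have "parcs G \<noteq> {}" using conn card by (rule arcs_nonempty)
  then obtain u0 w0 where e0: "(u0, w0) \<in> parcs G" by auto
  then have "pverts G \<noteq> {}" using arcs by blast
  then have S: "finite_generating_set ?B ?S" by (intro finite_generating_set_bb G conn)
  have "finite (pverts G)" using card card.infinite by fastforce
  then obtain g :: "'a \<Rightarrow> nat" where g: "inj_on g (pverts G)" using finite_imp_inj_to_nat_seg by metis
  \<comment> \<open>The labels 1 and 0 at the ends of one edge make the homomorphism surjective. All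
    labels are distinct, so it vanishes on no edge generator.\<close>
  define n :: "'a \<Rightarrow> int" where "n = (\<lambda>x. if x = w0 then 0 else if x = u0 then 1 else int (g x) + 2)"
  have n_inj: "n x \<noteq> n y" if "x \<in> pverts G" "y \<in> pverts G" "x \<noteq> y" for x y
    using that inj_onD[OF g, of x y] by (auto simp: n_def)
  obtain \<phi> where \<phi>: "\<phi> \<in> hom (raag G) integer_group" "\<And>v. v \<in> pverts G \<Longrightarrow> \<phi> (raag_gen G v) = n v"
    using raag_character[of G n] by blast
  have \<phi>e: "\<phi> (bb_edge G (v, w)) = n v - n w" if "(v, w) \<in> parcs G" for v w
    using raag_hom_bb_edge[OF \<phi>(1)] \<phi>(2) arcs[OF that] by simp
  have hom: "\<phi> \<in> hom ?B integer_group" by (rule bb_hom[OF \<phi>(1)])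
  interpret B: group ?B by (rule group_bestvina_brady)
  interpret h: group_hom ?B integer_group \<phi>
    by (intro group_hom.intro group_hom_axioms.intro B.group_axioms hom) simp
  have epi: "\<phi> \<in> epi ?B integer_group"
  proof -
    have "u0 \<noteq> w0" using arcs(2)[OF e0] .
    then have 1: "\<phi> (bb_edge G (u0, w0)) = 1" using \<phi>e[OF e0] by (simp add: n_def)
    have e: "bb_edge G (u0, w0) \<in> carrier ?B" using bb_edge_closed arcs[OF e0] by simp
    have "k \<in> \<phi> ` carrier ?B" for k
    proof -
      have "\<phi> (bb_edge G (u0, w0) [^]\<^bsub>?B\<^esub> k) = k" using h.hom_int_pow[OF e, of k] 1 by simp
      moreover have "bb_edge G (u0, w0) [^]\<^bsub>?B\<^esub> k \<in> carrier ?B" using B.int_pow_closed[OF e] .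
      ultimately show ?thesis by (metis image_eqI)
    qed
    then show ?thesis using hom by (auto simp: epi_def)
  qed
  have "finitely_generated (?B\<lparr>carrier := kernel ?B integer_group \<phi>\<rparr>)"
  proof (rule finitely_generated_kernel[OF B.group_axioms S epi])
    show "\<phi> s \<noteq> 0" if "s \<in> ?S" for s
      using that \<phi>e arcs n_inj by fastforce
    let ?C = "{(x, y). x \<in> ?S \<and> y \<in> ?S \<and> x \<otimes>\<^bsub>?B\<^esub> y = y \<otimes>\<^bsub>?B\<^esub> x}"
    let ?T = "{(p, q). p \<in> parcs G \<and> q \<in> parcs G \<and>
      bb_edge G p \<otimes>\<^bsub>raag G\<^esub> bb_edge G q = bb_edge G q \<otimes>\<^bsub>raag G\<^esub> bb_edge G p}"
    show "(s, t) \<in> ?C\<^sup>*" if s: "s \<in> ?S" and t: "t \<in> ?S" for s t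
    proof -
      obtain p q where pq: "p \<in> parcs G" "q \<in> parcs G" "s = bb_edge G p" "t = bb_edge G q" using s t by blast
      have "(p, q) \<in> ?T\<^sup>*"
      proof (rule arcs_connected[OF _ _ pq(1,2)])
        fix v a b assume "(v, a) \<in> parcs G" "(v, b) \<in> parcs G" "(a, b) \<in> parcs G"
        then show "((v, a), (v, b)) \<in> ?T\<^sup>*"
          using bb_edge_commute[OF G, of v a v b] arcs by (intro r_into_rtrancl) blast
      next
        fix v w assume "(v, w) \<in> parcs G"
        then show "((v, w), (w, v)) \<in> ?T\<^sup>*"
          using bb_edge_commute[OF G, of v w w v] arcs by (intro r_into_rtrancl) blast
      qed
      then have "(bb_edge G p, bb_edge G q) \<in> ?C\<^sup>*"
        by (rule rtrancl_hom[rotated]) auto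
      then show ?thesis using pq by simp
    qed
  qed
  then show ?thesis
    unfolding algebraically_fibers_def using epi S finitely_generated_def by blast
qed

lemma bestvina_brady_one_ended:
  assumes card: "card (pverts G) \<ge> 3"
  shows "one_ended (bestvina_brady G)"
proof -
  note arcs = pair_graph_arcs[OF G]
  let ?B = "bestvina_brady G" and ?S = "bb_edge G ` parcs G"
  have ne: "parcs G \<noteq> {}" by (rule arcs_nonempty) (use conn card in simp_all)
  then have "pverts G \<noteq> {}" using arcs by fastforce
  then have S: "finite_generating_set ?B ?S" by (intro finite_generating_set_bb G conn)
  interpret B: group ?B by (rule group_bestvina_brady)
  have fap: "B.free_abelian_pair (bb_edge G (a, b)) (bb_edge G (c, d))"
    if ab: "(a, b) \<in> parcs G" and cd: "(c, d) \<in> parcs G"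
      and comm: "bb_edge G (a, b) \<otimes>\<^bsub>raag G\<^esub> bb_edge G (c, d) = bb_edge G (c, d) \<otimes>\<^bsub>raag G\<^esub> bb_edge G (a, b)"
      and m: "m a - m b = 1" "m c - m d = 0" and m': "m' a - m' b = 0" "m' c - m' d = 1"
    for a b c d and m m' :: "'a \<Rightarrow> int"
  proof -
    have "\<exists>\<phi>\<in>hom ?B integer_group. \<forall>(v, w)\<in>parcs G. \<phi> (bb_edge G (v, w)) = m v - m w" for m
    proof -
      obtain \<phi> where \<phi>: "\<phi> \<in> hom (raag G) integer_group" "\<And>v. v \<in> pverts G \<Longrightarrow> \<phi> (raag_gen G v) = m v"
        using raag_character[of G m] by blast
      have "\<phi> (bb_edge G (v, w)) = m v - m w" if "(v, w) \<in> parcs G" for v w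
        using raag_hom_bb_edge[OF \<phi>(1)] \<phi>(2) arcs[OF that] by simp
      then show ?thesis using bb_hom[OF \<phi>(1)] by blast
    qed
    then obtain \<phi> \<psi> where "\<phi> \<in> hom ?B integer_group" "\<forall>(v, w)\<in>parcs G. \<phi> (bb_edge G (v, w)) = m v - m w"
      "\<psi> \<in> hom ?B integer_group" "\<forall>(v, w)\<in>parcs G. \<psi> (bb_edge G (v, w)) = m' v - m' w"
      by meson
    then show ?thesis
      using ab cd m m' comm bb_edge_closed arcs[OF ab] arcs[OF cd]
      by (intro B.free_abelian_pairI[of _ _ \<phi> \<psi>]) auto
  qed
  \<comment> \<open>The labels are dual to the two edges: -1 at the far end of one of them and 0
    elsewhere.\<close>
  have tri: "B.free_abelian_pair (bb_edge G (v, a)) (bb_edge G (v, b))"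
    if "(v, a) \<in> parcs G" "(v, b) \<in> parcs G" "(a, b) \<in> parcs G" for v a b
  proof -
    note vab = arcs[OF that(1)] arcs[OF that(2)] arcs[OF that(3)]
    show ?thesis
      by (rule fap[of v a v b "\<lambda>x. if x = a then - 1 else 0" "\<lambda>x. if x = b then - 1 else 0"])
        (use that vab bb_edge_commute[OF G, of v a v b] in auto)
  qed
  have tri': "B.free_abelian_pair (bb_edge G (a, v)) (bb_edge G (b, v))"
    if "(a, v) \<in> parcs G" "(b, v) \<in> parcs G" "(a, b) \<in> parcs G" for v a b
  proof -
    note vab = arcs[OF that(1)] arcs[OF that(2)] arcs[OF that(3)]
    show ?thesis
      by (rule fap[of a v b v "\<lambda>x. if x = a then 1 else 0" "\<lambda>x. if x = b then 1 else 0"])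
        (use that vab bb_edge_commute[OF G, of a v b v] in auto)
  qed
  show ?thesis
  proof (rule B.one_ended_if_commuting[OF S])
    show "?S \<noteq> {}" using ne by simp
    let ?C = "{(x, y). x \<in> ?S \<and> y \<in> ?S \<and> B.free_abelian_pair x y}"
    let ?T = "{(p, q). p \<in> parcs G \<and> q \<in> parcs G \<and> B.free_abelian_pair (bb_edge G p) (bb_edge G q)}"
    show "(s, t) \<in> ?C\<^sup>*" if s: "s \<in> ?S" and t: "t \<in> ?S" for s t
    proof -
      obtain p q where pq: "p \<in> parcs G" "q \<in> parcs G" "s = bb_edge G p" "t = bb_edge G q" using s t by blast
      have "(p, q) \<in> ?T\<^sup>*"
      proof (rule arcs_connected[OF _ _ pq(1,2)])
        show 1: "((v, a), (v, b)) \<in> ?T\<^sup>*"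
          if "(v, a) \<in> parcs G" "(v, b) \<in> parcs G" "(a, b) \<in> parcs G" for v a b
          using tri[OF that] that by (intro r_into_rtrancl) simp
        fix v w assume vw: "(v, w) \<in> parcs G"
        then obtain x where x: "(v, x) \<in> parcs G" "(w, x) \<in> parcs G"
          using arc_in_triangle[OF card vw] by blast
        \<comment> \<open>The edge is reversed around the triangle \<open>v\<close>,
          \<open>w\<close>, \<open>x\<close>; the middle step joins two edges with the same target,
          hence \<open>tri'\<close>.\<close>
        have "((v, w), (v, x)) \<in> ?T\<^sup>*" using 1 vw x by blast
        also have "((v, x), (w, x)) \<in> ?T\<^sup>*" using tri'[OF x vw] x by (intro r_into_rtrancl) simp
        also have "((w, x), (w, v)) \<in> ?T\<^sup>*"
          using 1[of w x v] x arcs(1)[OF x(1)] arcs(1)[OF vw] by blast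
        finally show "((v, w), (w, v)) \<in> ?T\<^sup>*" .
      qed
      then have "(bb_edge G p, bb_edge G q) \<in> ?C\<^sup>*"
        by (rule rtrancl_hom[rotated]) auto
      then show ?thesis using pq by simp
    qed
    show "\<exists>t\<in>?S. B.free_abelian_pair s t" if s: "s \<in> ?S" for s
    proof -
      obtain v w where vw: "(v, w) \<in> parcs G" "s = bb_edge G (v, w)" using s by auto
      then obtain x where x: "(v, x) \<in> parcs G" "(w, x) \<in> parcs G"
        using arc_in_triangle[OF card vw(1)] by blast
      show ?thesis using tri[OF vw(1) x] x vw by blast
    qed
  qed
qed

end

section \<open>Splitting along a cut vertex\<close>

lemma exponent_sum_Cons: "exponent_sum ((x, b) # u) = (if b then 1 else - 1) + exponent_sum u"
  by (simp add: exponent_sum_def)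

lemma exponent_sum_Nil: "exponent_sum [] = 0"
  by (simp add: exponent_sum_def)

text \<open>Reidemeister--Schreier rewriting of the right-angled Artin group with the powers of \<open>t\<close> as
  transversal: \<open>level G t h u\<close> is the contribution of \<open>u\<close> when it is read from height \<open>h\<close> on.\<close>

definition level :: "'a pair_pre_digraph \<Rightarrow> 'a \<Rightarrow> int \<Rightarrow> 'a gword \<Rightarrow> 'a gword set" where
  "level G t h u = raag_gen G t [^]\<^bsub>raag G\<^esub> h \<otimes>\<^bsub>raag G\<^esub> raag_class G u \<otimes>\<^bsub>raag G\<^esub>
     inv\<^bsub>raag G\<^esub> (raag_gen G t [^]\<^bsub>raag G\<^esub> (h + exponent_sum u))"

context
  fixes G :: "'a pair_pre_digraph" and t :: 'a
  assumes t: "t \<in> pverts G"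
begin

interpretation A: group "raag G" by (rule group_raag)

lemma raag_class_closed: "u \<in> gwords (pverts G) \<Longrightarrow> raag_class G u \<in> carrier (raag G)"
  by (simp add: raag_def)

lemma raag_class_append:
  "u \<in> gwords (pverts G) \<Longrightarrow> w \<in> gwords (pverts G) \<Longrightarrow>
    raag_class G (u @ w) = raag_class G u \<otimes>\<^bsub>raag G\<^esub> raag_class G w"
  by (simp add: raag_def presented_group_mult)

text \<open>The cocycle rule of the rewriting: the inner powers of \<open>t\<close> cancel.\<close>

lemma level_append:
  assumes "u \<in> gwords (pverts G)" "w \<in> gwords (pverts G)"
  shows "level G t h (u @ w) = level G t h u \<otimes>\<^bsub>raag G\<^esub> level G t (h + exponent_sum u) w"
  using assms raag_class_closed[of u] raag_class_closed[of w] raag_gen_closed[OF t]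
  by (simp add: level_def raag_class_append A.m_assoc A.inv_mult_cancel add.assoc)

lemma level_Nil: "level G t h [] = \<one>\<^bsub>raag G\<^esub>"
proof -
  have "raag_class G [] = \<one>\<^bsub>raag G\<^esub>" by (simp add: raag_def one_presented_group)
  then show ?thesis using raag_gen_closed[OF t] by (simp add: level_def exponent_sum_Nil)
qed

lemma level_trivial_word:
  assumes "raag_class G u = \<one>\<^bsub>raag G\<^esub>" "exponent_sum u = 0"
  shows "level G t h u = \<one>\<^bsub>raag G\<^esub>"
  using assms raag_gen_closed[OF t] by (simp add: level_def)

text \<open>The transversal consists of powers of \<open>t\<close>, so a letter \<open>t\<close>
  leaves no trace at any height. This permits reading the shared vertex in either factor.\<close>

lemma level_power:
  "level G t h [(t, b)] = \<one>\<^bsub>raag G\<^esub>"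
proof -
  let ?e = "if b then 1 else - 1 :: int"
  have "raag_class G [(t, b)] = raag_gen G t [^]\<^bsub>raag G\<^esub> ?e"
    using t raag_gen_closed[OF t] inv_presented_group[of "[(t, True)]" "pverts G" "raag_relators G"]
    by (simp add: A.int_pow_neg gword_inv_def raag_def[symmetric])
  then have "level G t h [(t, b)] = raag_gen G t [^]\<^bsub>raag G\<^esub> h \<otimes>\<^bsub>raag G\<^esub> raag_gen G t [^]\<^bsub>raag G\<^esub> ?e \<otimes>\<^bsub>raag G\<^esub>
     inv\<^bsub>raag G\<^esub> (raag_gen G t [^]\<^bsub>raag G\<^esub> (h + ?e))"
    by (simp only: level_def exponent_sum_Cons exponent_sum_Nil add_0_right)
  also have "\<dots> = \<one>\<^bsub>raag G\<^esub>"
    using raag_gen_closed[OF t] by (simp only: A.int_pow_mult[symmetric] A.r_inv A.int_pow_closed)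
  finally show ?thesis .
qed

definition vertex_subgroup :: "'a set \<Rightarrow> 'a gword set set" where
  "vertex_subgroup U = raag_class G ` gwords U"

lemma gwords_mono: "u \<in> gwords U \<Longrightarrow> U \<subseteq> W \<Longrightarrow> u \<in> gwords W"
  by (auto simp: gwords_def)

lemma subgroup_vertex_subgroup:
  assumes U: "U \<subseteq> pverts G"
  shows "subgroup (vertex_subgroup U) (raag G)"
proof (rule A.subgroupI)
  note V = gwords_mono[OF _ U]
  show "vertex_subgroup U \<subseteq> carrier (raag G)"
    using V raag_class_closed by (auto simp: vertex_subgroup_def)
  show "vertex_subgroup U \<noteq> {}" using gwords_Nil[of U] unfolding vertex_subgroup_def by blast
  fix a assume "a \<in> vertex_subgroup U"
  then obtain u where u: "u \<in> gwords U" "a = raag_class G u" by (auto simp: vertex_subgroup_def)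
  have "inv\<^bsub>raag G\<^esub> a = raag_class G (gword_inv u)"
    unfolding u(2) raag_def by (rule inv_presented_group[OF V[OF u(1)]])
  then show "inv\<^bsub>raag G\<^esub> a \<in> vertex_subgroup U"
    using gword_inv_gwords[OF u(1)] by (simp add: vertex_subgroup_def)
  fix b assume "b \<in> vertex_subgroup U"
  then obtain w where w: "w \<in> gwords U" "b = raag_class G w" by (auto simp: vertex_subgroup_def)
  have "a \<otimes>\<^bsub>raag G\<^esub> b = raag_class G (u @ w)"
    using raag_class_append[OF V[OF u(1)] V[OF w(1)]] u w by simp
  then show "a \<otimes>\<^bsub>raag G\<^esub> b \<in> vertex_subgroup U"
    using u w by (simp add: vertex_subgroup_def)
qed

lemma level_height:
  assumes "u \<in> gwords (pverts G)"
  shows "level G t h u \<in> bb_carrier G"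
proof -
  interpret h: group_hom "raag G" integer_group raag_height
    by (intro group_hom.intro group_hom_axioms.intro group_raag raag_height_hom) simp
  note closed = raag_class_closed[OF assms] raag_gen_closed[OF t]
  have "raag_height (raag_gen G t [^]\<^bsub>raag G\<^esub> k) = k" for k :: int
    using h.hom_int_pow[OF closed(2), of k] raag_height_generator[OF t] by simp
  moreover have "raag_height (raag_class G u) = exponent_sum u" using assms by (rule raag_height_class)
  ultimately show ?thesis using closed by (simp add: kernel_def level_def)
qed

lemma level_in_vertex_subgroup:
  assumes U: "U \<subseteq> pverts G" "t \<in> U" and u: "u \<in> gwords U"
  shows "level G t h u \<in> bb_carrier G \<inter> vertex_subgroup U"
proof -
  note sub = subgroup_vertex_subgroup[OF U(1)]
  have "raag_gen G t \<in> vertex_subgroup U" "raag_class G u \<in> vertex_subgroup U"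
    using U u by (auto simp: vertex_subgroup_def)
  then have "level G t h u \<in> vertex_subgroup U"
    unfolding level_def by (intro subgroup.m_closed[OF sub] subgroup.m_inv_closed[OF sub] A.subgroup_int_pow_closed[OF sub])
  then show ?thesis using level_height[OF gwords_mono[OF u U(1)]] by blast
qed

lemma level_0:
  assumes "u \<in> gwords (pverts G)" "exponent_sum u = 0"
  shows "level G t 0 u = raag_class G u"
  using assms raag_class_closed by (simp add: level_def)

section \<open>Rewriting into the free product of the two sides of a separating vertex\<close>

context
  fixes P Q :: "'a set"
  assumes PQ: "P \<union> Q = pverts G" "P \<inter> Q = {t}" "P \<noteq> {t}" "Q \<noteq> {t}"
    and sep: "\<And>x y. (x, y) \<in> parcs G \<Longrightarrow> x \<in> P \<and> y \<in> P \<or> x \<in> Q \<and> y \<in> Q"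
begin

text \<open>The height-zero part of one side, taken as a subgroup of the ambient group, so that the
  map back from the free product is given by inclusions.\<close>

definition factor :: "'a set \<Rightarrow> 'a gword set monoid" where
  "factor U = (raag G)\<lparr>carrier := bb_carrier G \<inter> vertex_subgroup U\<rparr>"

lemma carrier_factor: "a \<in> carrier (factor U) \<longleftrightarrow> a \<in> bb_carrier G \<and> a \<in> vertex_subgroup U"
  and mult_factor: "a \<otimes>\<^bsub>factor U\<^esub> b = a \<otimes>\<^bsub>raag G\<^esub> b"
  and one_factor: "\<one>\<^bsub>factor U\<^esub> = \<one>\<^bsub>raag G\<^esub>"
  by (simp_all add: factor_def)

lemma subgroup_factor: "U \<subseteq> pverts G \<Longrightarrow> subgroup (bb_carrier G \<inter> vertex_subgroup U) (raag G)"
  using A.subgroups_Inter_pair[OF subgroup_bb_carrier subgroup_vertex_subgroup] .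

lemma group_factor: "U \<subseteq> pverts G \<Longrightarrow> group (factor U)"
  unfolding factor_def by (rule subgroup.subgroup_is_group[OF subgroup_factor group_raag])

lemma P_sub: "P \<subseteq> pverts G" "t \<in> P" and Q_sub: "Q \<subseteq> pverts G" "t \<in> Q"
  using PQ by auto

lemma factor_nontrivial:
  assumes U: "U \<subseteq> pverts G" "t \<in> U" "U \<noteq> {t}"
  shows "\<not> trivial_group (factor U)"
proof
  assume triv: "trivial_group (factor U)"
  obtain x where x: "x \<in> U" "x \<noteq> t" using U by blast
  then have xV: "x \<in> pverts G" using U by blast
  have "level G t 0 [(x, True)] \<in> carrier (factor U)"
    using level_in_vertex_subgroup[OF U(1,2), of "[(x, True)]" 0] x by (simp add: carrier_factor)
  then have 1: "level G t 0 [(x, True)] = \<one>\<^bsub>raag G\<^esub>"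
    using triv by (simp add: trivial_group_def one_factor)
  have "level G t 0 [(x, True)] = raag_gen G x \<otimes>\<^bsub>raag G\<^esub> inv\<^bsub>raag G\<^esub> raag_gen G t"
    using raag_gen_closed[OF t] raag_gen_closed[OF xV] by (simp add: level_def exponent_sum_Cons exponent_sum_Nil)
  then have edge: "level G t 0 [(x, True)] = bb_edge G (x, t)" by (simp add: bb_edge_def)
  obtain \<phi> where \<phi>: "\<phi> \<in> hom (raag G) integer_group"
    "\<And>v. v \<in> pverts G \<Longrightarrow> \<phi> (raag_gen G v) = (if v = x then 1 else 0)"
    using raag_character[of G "\<lambda>v. if v = x then 1 else 0"] by blast
  have "\<phi> (bb_edge G (x, t)) = 1" using raag_hom_bb_edge[OF \<phi>(1) xV t] \<phi>(2) xV t x by simp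
  moreover have "\<phi> \<one>\<^bsub>raag G\<^esub> = 0" using hom_one[OF \<phi>(1) group_raag group_integer_group] by simp
  ultimately show False using 1 edge by simp
qed

text \<open>The argument \<open>h\<close> tracks the height reached so far. The vertex
  \<open>t\<close> lies on both sides and is assigned to the first.\<close>

fun rewrite :: "int \<Rightarrow> 'a gword \<Rightarrow> ('a gword set + 'a gword set) gword" where
  "rewrite h [] = []"
| "rewrite h (l # u) = ((if fst l \<in> P then Inl (level G t h [l]) else Inr (level G t h [l])), True) #
     rewrite (h + exponent_sum [l]) u"

abbreviation fp_class :: "('a gword set + 'a gword set) gword \<Rightarrow> ('a gword set + 'a gword set) gword set" where
  "fp_class \<equiv> pres_class (fp_gens (factor P) (factor Q)) (fp_relators (factor P) (factor Q))"

abbreviation fp :: "('a gword set + 'a gword set) gword set monoid" where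
  "fp \<equiv> free_product (factor P) (factor Q)"

lemmas fp_altdef = free_product_altdef[OF group_factor[OF P_sub(1)] group_factor[OF Q_sub(1)]]

lemma group_fp: "group fp"
  unfolding fp_altdef by (rule group_presented_group)

interpretation fp: group fp by (rule group_fp)

lemma rewrite_letter:
  assumes "fst l \<in> pverts G"
  shows "(if fst l \<in> P then Inl (level G t h [l]) else Inr (level G t h [l])) \<in> fp_gens (factor P) (factor Q)"
proof (cases "fst l \<in> P")
  case True
  then have "[l] \<in> gwords P" by simp
  from level_in_vertex_subgroup[OF P_sub this, of h] have "level G t h [l] \<in> carrier (factor P)"
    by (simp add: carrier_factor)
  then show ?thesis using True by auto
next
  case False
  then have "[l] \<in> gwords Q" using assms PQ by auto
  from level_in_vertex_subgroup[OF Q_sub this, of h] have "level G t h [l] \<in> carrier (factor Q)"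
    by (simp add: carrier_factor)
  then show ?thesis using False by auto
qed

lemma rewrite_gwords: "u \<in> gwords (pverts G) \<Longrightarrow> rewrite h u \<in> gwords (fp_gens (factor P) (factor Q))"
proof (induction u arbitrary: h)
  case (Cons l u)
  then show ?case using rewrite_letter[of l h] by (simp del: if_split)
qed simp

lemma rewrite_append: "rewrite h (u @ w) = rewrite h u @ rewrite (h + exponent_sum u) w"
proof (induction u arbitrary: h)
  case (Cons l u)
  have "exponent_sum (l # u) = exponent_sum [l] + exponent_sum u"
    using exponent_sum_append[of "[l]" u] by simp
  then show ?case using Cons by (simp add: add.assoc)
qed (simp add: exponent_sum_Nil)

lemma fp_class_Cons:
  assumes "x \<in> fp_gens (factor P) (factor Q)" "u \<in> gwords (fp_gens (factor P) (factor Q))"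
  shows "fp_class ((x, True) # u) = fp_letter (factor P) (factor Q) x \<otimes>\<^bsub>fp\<^esub> fp_class u"
  using pres_class_Cons[of x True u "fp_gens (factor P) (factor Q)" "fp_relators (factor P) (factor Q)"] assms
  by (simp add: fp_altdef)

lemmas fp_letter_mult' = fp_letter_mult[OF group_factor[OF P_sub(1)] group_factor[OF Q_sub(1)]]
lemmas fp_letter_one' = fp_letter_one[OF group_factor[OF P_sub(1)] group_factor[OF Q_sub(1)]]

lemma fp_letter_one_Inl: "fp_letter (factor P) (factor Q) (Inl \<one>\<^bsub>raag G\<^esub>) = \<one>\<^bsub>fp\<^esub>"
  and fp_letter_one_Inr: "fp_letter (factor P) (factor Q) (Inr \<one>\<^bsub>raag G\<^esub>) = \<one>\<^bsub>fp\<^esub>"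
proof -
  have "\<one>\<^bsub>raag G\<^esub> \<in> carrier (factor P)" "\<one>\<^bsub>raag G\<^esub> \<in> carrier (factor Q)"
    using subgroup.one_closed[OF subgroup_factor[OF P_sub(1)]] subgroup.one_closed[OF subgroup_factor[OF Q_sub(1)]]
    by (simp_all add: carrier_factor)
  then show "fp_letter (factor P) (factor Q) (Inl \<one>\<^bsub>raag G\<^esub>) = \<one>\<^bsub>fp\<^esub>"
    "fp_letter (factor P) (factor Q) (Inr \<one>\<^bsub>raag G\<^esub>) = \<one>\<^bsub>fp\<^esub>"
    by (intro fp_letter_one' InlI InrI; simp add: letter_one_def one_factor)+
qed

text \<open>On words of one side the rewriting collapses to a single letter: the multiplication
  table of the factor absorbs the cocycle rule for \<open>level\<close>.\<close>

lemma rewrite_P: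
  "u \<in> gwords P \<Longrightarrow> fp_class (rewrite h u) = fp_letter (factor P) (factor Q) (Inl (level G t h u))"
proof (induction u arbitrary: h)
  case Nil
  then show ?case using fp_letter_one_Inl by (simp add: level_Nil fp_altdef one_presented_group)
next
  case (Cons l u)
  have l: "fst l \<in> P" "[l] \<in> gwords P" and u: "u \<in> gwords P" using Cons.prems by auto
  let ?h = "h + exponent_sum [l]"
  have V: "[l] \<in> gwords (pverts G)" "u \<in> gwords (pverts G)"
    using gwords_mono[OF l(2) P_sub(1)] gwords_mono[OF u P_sub(1)] by auto
  have in_P: "level G t h [l] \<in> carrier (factor P)" "level G t ?h u \<in> carrier (factor P)"
    using level_in_vertex_subgroup[OF P_sub l(2)] level_in_vertex_subgroup[OF P_sub u]
    by (simp_all add: carrier_factor)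
  have "fp_class (rewrite h (l # u)) =
      fp_letter (factor P) (factor Q) (Inl (level G t h [l])) \<otimes>\<^bsub>fp\<^esub> fp_class (rewrite ?h u)"
    unfolding rewrite.simps using l(1) in_P rewrite_gwords[OF V(2)]
    by (simp only: if_True) (intro fp_class_Cons InlI)
  also have "\<dots> = fp_letter (factor P) (factor Q) (letter_mult (factor P) (factor Q)
      (Inl (level G t h [l])) (Inl (level G t ?h u)))"
    unfolding Cons.IH[OF u] using in_P by (intro fp_letter_mult'[symmetric] InlI) simp_all
  also have "letter_mult (factor P) (factor Q) (Inl (level G t h [l])) (Inl (level G t ?h u)) =
      Inl (level G t h ([l] @ u))"
    unfolding level_append[OF V] by (simp add: mult_factor)
  finally show ?case by simp
qed

lemma rewrite_Q:
  "u \<in> gwords Q \<Longrightarrow> fp_class (rewrite h u) = fp_letter (factor P) (factor Q) (Inr (level G t h u))"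
proof (induction u arbitrary: h)
  case Nil
  then show ?case using fp_letter_one_Inr by (simp add: level_Nil fp_altdef one_presented_group)
next
  case (Cons l u)
  have l: "fst l \<in> Q" "[l] \<in> gwords Q" and u: "u \<in> gwords Q" using Cons.prems by auto
  let ?h = "h + exponent_sum [l]"
  have V: "[l] \<in> gwords (pverts G)" "u \<in> gwords (pverts G)"
    using gwords_mono[OF l(2) Q_sub(1)] gwords_mono[OF u Q_sub(1)] by auto
  have in_Q: "level G t h [l] \<in> carrier (factor Q)" "level G t ?h u \<in> carrier (factor Q)"
    using level_in_vertex_subgroup[OF Q_sub l(2)] level_in_vertex_subgroup[OF Q_sub u]
    by (simp_all add: carrier_factor)
  \<comment> \<open>The one letter of a word over \<open>Q\<close> that is sent to the wrong side is
    \<open>t\<close>, and its level is trivial in both factors.\<close>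
  have letter: "fp_letter (factor P) (factor Q)
      (if fst l \<in> P then Inl (level G t h [l]) else Inr (level G t h [l])) =
      fp_letter (factor P) (factor Q) (Inr (level G t h [l]))"
  proof (cases "fst l \<in> P")
    case True
    then have "fst l = t" using l(1) PQ by blast
    then have "level G t h [l] = \<one>\<^bsub>raag G\<^esub>" using level_power[of h "snd l"] by (cases l) simp
    then show ?thesis using fp_letter_one_Inl fp_letter_one_Inr by simp
  qed simp
  have "fst l \<in> pverts G" using V by simp
  then have "fp_class (rewrite h (l # u)) =
      fp_letter (factor P) (factor Q) (if fst l \<in> P then Inl (level G t h [l]) else Inr (level G t h [l]))
        \<otimes>\<^bsub>fp\<^esub> fp_class (rewrite ?h u)"
    unfolding rewrite.simps using rewrite_gwords[OF V(2)] by (intro fp_class_Cons rewrite_letter)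
  also have "\<dots> = fp_letter (factor P) (factor Q) (letter_mult (factor P) (factor Q)
      (Inr (level G t h [l])) (Inr (level G t ?h u)))"
    unfolding letter Cons.IH[OF u] using in_Q by (intro fp_letter_mult'[symmetric] InrI) simp_all
  also have "letter_mult (factor P) (factor Q) (Inr (level G t h [l])) (Inr (level G t ?h u)) =
      Inr (level G t h ([l] @ u))"
    unfolding level_append[OF V] by (simp add: mult_factor)
  finally show ?case by simp
qed

lemma fp_class_append:
  assumes "u \<in> gwords (fp_gens (factor P) (factor Q))" "w \<in> gwords (fp_gens (factor P) (factor Q))"
  shows "fp_class (u @ w) = fp_class u \<otimes>\<^bsub>fp\<^esub> fp_class w"
  using assms by (simp add: fp_altdef presented_group_mult)

lemma fp_class_closed: "u \<in> gwords (fp_gens (factor P) (factor Q)) \<Longrightarrow> fp_class u \<in> carrier fp"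
  by (simp add: fp_altdef)

text \<open>By \<open>sep\<close>, every relator is a word over one side, as is every cancelling
  pair. It is rewritten to a single letter of trivial level and, having exponent sum zero, does not
  shift the height at which the rest is read.\<close>

lemma rewrite_pres_eq:
  assumes "pres_eq (pverts G) (raag_relators G) u w"
  shows "fp_class (rewrite h u) = fp_class (rewrite h w)"
proof -
  have drop: "fp_class (rewrite h (u @ r @ w)) = fp_class (rewrite h (u @ w))"
    if u: "u \<in> gwords (pverts G)" and w: "w \<in> gwords (pverts G)" and r: "r \<in> gwords P \<or> r \<in> gwords Q"
      and triv: "pres_eq (pverts G) (raag_relators G) r []" for u r w
  proof -
    have rV: "r \<in> gwords (pverts G)" using r gwords_mono[OF _ P_sub(1)] gwords_mono[OF _ Q_sub(1)] by blast
    have r0: "exponent_sum r = 0" using exponent_sum_pres_eq[OF triv] by (simp add: exponent_sum_Nil)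
    have "raag_class G r = \<one>\<^bsub>raag G\<^esub>"
      using pres_class_eqI[OF triv] by (simp add: raag_def one_presented_group)
    then have "level G t k r = \<one>\<^bsub>raag G\<^esub>" for k using r0 by (rule level_trivial_word)
    then have "fp_class (rewrite k r) = \<one>\<^bsub>fp\<^esub>" for k
      using r rewrite_P[of r k] rewrite_Q[of r k] fp_letter_one_Inl fp_letter_one_Inr by auto
    then show ?thesis
      using rewrite_gwords[OF u] rewrite_gwords[OF w] rewrite_gwords[OF rV] r0 fp_class_closed
      by (simp add: rewrite_append fp_class_append)
  qed
  show ?thesis
    using assms
  proof (induction rule: pres_eq.induct)
    case (cancel u w x b)
    have "pres_eq (pverts G) (raag_relators G) ([] @ [(x, b), (x, \<not> b)] @ []) ([] @ [])"
      using cancel(3) by (intro pres_eq.cancel) simp_all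
    moreover have "[(x, b), (x, \<not> b)] \<in> gwords P \<or> [(x, b), (x, \<not> b)] \<in> gwords Q" using cancel(3) PQ(1) by auto
    ultimately show ?case using drop[OF cancel(1,2), of "[(x, b), (x, \<not> b)]"] by simp
  next
    case (relator u w r)
    obtain x y where xy: "(x, y) \<in> parcs G" "r = [(x, True), (y, True), (x, False), (y, False)]"
      using relator(3) by (auto simp: raag_relators_def)
    have "pres_eq (pverts G) (raag_relators G) ([] @ r @ []) ([] @ [])"
      using relator(3,4) by (intro pres_eq.relator) simp_all
    moreover have "r \<in> gwords P \<or> r \<in> gwords Q" using sep[OF xy(1)] xy(2) by auto
    ultimately show ?case using drop[OF relator(1,2), of r] by simp
  qed auto
qed

text \<open>This is the left inverse that makes the rewriting injective on height-zero
  elements.\<close>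

lemma eval_rewrite:
  obtains \<psi> where "\<psi> \<in> hom fp (raag G)"
    "\<And>u h. u \<in> gwords (pverts G) \<Longrightarrow> \<psi> (fp_class (rewrite h u)) = level G t h u"
proof -
  let ?f = "case_sum id id"
  have f: "?f \<in> fp_gens (factor P) (factor Q) \<rightarrow> carrier (raag G)"
    using subgroup.subset[OF subgroup_bb_carrier[of G]] by (auto simp: carrier_factor)
  have "\<exists>\<psi>\<in>hom fp (raag G). \<forall>u\<in>gwords (fp_gens (factor P) (factor Q)). \<psi> (fp_class u) = gword_eval (raag G) ?f u"
    unfolding fp_altdef
  proof (rule presented_group_hom_exists[OF group_raag f])
    fix r assume "r \<in> fp_relators (factor P) (factor Q)"
    moreover have "a \<in> carrier (raag G)" if "a \<in> bb_carrier G" for a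
      using that subgroup.subset[OF subgroup_bb_carrier[of G]] by blast
    ultimately show "gword_eval (raag G) ?f r = \<one>\<^bsub>raag G\<^esub>"
      by (auto simp: carrier_factor mult_factor A.m_assoc[symmetric])
  qed
  then obtain \<psi> where \<psi>: "\<psi> \<in> hom fp (raag G)"
    "\<And>u. u \<in> gwords (fp_gens (factor P) (factor Q)) \<Longrightarrow> \<psi> (fp_class u) = gword_eval (raag G) ?f u" by blast
  have "gword_eval (raag G) ?f (rewrite h u) = level G t h u" if "u \<in> gwords (pverts G)" for u h
    using that
  proof (induction u arbitrary: h)
    case Nil
    then show ?case by (simp add: level_Nil)
  next
    case (Cons l u)
    then have V: "[l] \<in> gwords (pverts G)" "u \<in> gwords (pverts G)" by auto
    then show ?case using Cons.IH[OF V(2)] level_append[OF V] by simp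
  qed
  then show ?thesis using \<psi>(2) rewrite_gwords by (intro that[OF \<psi>(1)]) simp
qed

text \<open>Rewriting from height 0 is multiplicative here because the first word ends at height 0
  again. It is onto since each letter of the free product is the rewriting of a word on its own
  side.\<close>

lemma bestvina_brady_splits: "splits_as_free_product (bestvina_brady G)"
proof -
  let ?B = "bestvina_brady G"
  interpret B: group ?B by (rule group_bestvina_brady)
  define \<Phi> where "\<Phi> g = fp_class (rewrite 0 (SOME u. u \<in> g))" for g
  have \<Phi>: "\<Phi> (raag_class G u) = fp_class (rewrite 0 u)" if "u \<in> gwords (pverts G)" for u
  proof -
    have "u \<in> raag_class G u" using that by (simp add: pres_class_def pres_eq.refl)
    then have "(SOME w. w \<in> raag_class G u) \<in> raag_class G u" by (rule someI)
    then have "pres_eq (pverts G) (raag_relators G) u (SOME w. w \<in> raag_class G u)" by (simp add: pres_class_def)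
    then show ?thesis unfolding \<Phi>_def by (rule rewrite_pres_eq[symmetric])
  qed
  have word: "\<exists>u\<in>gwords (pverts G). g = raag_class G u \<and> exponent_sum u = 0" if g: "g \<in> bb_carrier G" for g
  proof -
    have "g \<in> carrier (raag G)" "raag_height g = 0" using g by (auto simp: kernel_def)
    moreover obtain u where u: "u \<in> gwords (pverts G)" "g = raag_class G u"
      using calculation(1) unfolding raag_def by (rule presented_group_cases)
    ultimately show ?thesis using raag_height_class[OF u(1)] by auto
  qed
  have hom: "\<Phi> \<in> hom ?B fp"
  proof (rule homI)
    fix g k assume g: "g \<in> carrier ?B" and k: "k \<in> carrier ?B"
    obtain u where u: "u \<in> gwords (pverts G)" "g = raag_class G u" "exponent_sum u = 0" using word[of g] g by auto
    obtain w where w: "w \<in> gwords (pverts G)" "k = raag_class G w" "exponent_sum w = 0" using word[of k] k by auto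
    show "\<Phi> g \<in> carrier fp" using u \<Phi> fp_class_closed rewrite_gwords by simp
    have "g \<otimes>\<^bsub>?B\<^esub> k = raag_class G (u @ w)" using u w raag_class_append by simp
    then show "\<Phi> (g \<otimes>\<^bsub>?B\<^esub> k) = \<Phi> g \<otimes>\<^bsub>fp\<^esub> \<Phi> k"
      using u w by (simp add: \<Phi> rewrite_append fp_class_append rewrite_gwords)
  qed
  interpret h: group_hom ?B fp \<Phi>
    by (intro group_hom.intro group_hom_axioms.intro B.group_axioms group_fp hom)
  obtain \<psi> where \<psi>: "\<psi> \<in> hom fp (raag G)"
    "\<And>u h. u \<in> gwords (pverts G) \<Longrightarrow> \<psi> (fp_class (rewrite h u)) = level G t h u"
    using eval_rewrite by blast
  have "\<psi> (\<Phi> g) = g" if g: "g \<in> bb_carrier G" for g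
  proof -
    obtain u where u: "u \<in> gwords (pverts G)" "g = raag_class G u" "exponent_sum u = 0" using word[OF g] by blast
    then show ?thesis using \<psi>(2)[OF u(1), of 0] level_0 by (simp add: \<Phi>)
  qed
  then have inj: "inj_on \<Phi> (carrier ?B)" by (intro inj_on_inverseI[of _ \<psi>]) simp
  have "carrier fp \<subseteq> \<Phi> ` carrier ?B"
  proof
    fix g assume "g \<in> carrier fp"
    then obtain u where u: "u \<in> gwords (fp_gens (factor P) (factor Q))" "g = fp_class u"
      unfolding fp_altdef by (rule presented_group_cases)
    have "fp_letter (factor P) (factor Q) x \<in> \<Phi> ` carrier ?B" if x: "x \<in> fp_gens (factor P) (factor Q)" for x
    proof -
      have *: "\<exists>w\<in>gwords U. a = raag_class G w \<and> exponent_sum w = 0"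
        if U: "U \<subseteq> pverts G" and a: "a \<in> bb_carrier G" "a \<in> vertex_subgroup U" for a U
      proof -
        obtain w where w: "w \<in> gwords U" "a = raag_class G w" using a(2) by (auto simp: vertex_subgroup_def)
        have "raag_height a = 0" using a(1) by (simp add: kernel_def)
        then show ?thesis using w raag_height_class[OF gwords_mono[OF w(1) U]] by auto
      qed
      show ?thesis
      proof (cases x)
        case (Inl a)
        then have a: "a \<in> bb_carrier G" "a \<in> vertex_subgroup P" using x by (auto simp: carrier_factor)
        obtain w where w: "w \<in> gwords P" "a = raag_class G w" "exponent_sum w = 0" using *[OF P_sub(1) a] by blast
        have "fp_letter (factor P) (factor Q) x = \<Phi> a"
          using rewrite_P[OF w(1), of 0] \<Phi>[OF gwords_mono[OF w(1) P_sub(1)]]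
            level_0[OF gwords_mono[OF w(1) P_sub(1)] w(3)] w(2) Inl by simp
        then show ?thesis using a(1) by simp
      next
        case (Inr a)
        then have a: "a \<in> bb_carrier G" "a \<in> vertex_subgroup Q" using x by (auto simp: carrier_factor)
        obtain w where w: "w \<in> gwords Q" "a = raag_class G w" "exponent_sum w = 0" using *[OF Q_sub(1) a] by blast
        have "fp_letter (factor P) (factor Q) x = \<Phi> a"
          using rewrite_Q[OF w(1), of 0] \<Phi>[OF gwords_mono[OF w(1) Q_sub(1)]]
            level_0[OF gwords_mono[OF w(1) Q_sub(1)] w(3)] w(2) Inr by simp
        then show ?thesis using a(1) by simp
      qed
    qed
    then have "fp_letter (factor P) (factor Q) \<in> fp_gens (factor P) (factor Q) \<rightarrow> \<Phi> ` carrier ?B" by blast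
    then have "gword_eval fp (fp_letter (factor P) (factor Q)) u \<in> \<Phi> ` carrier ?B"
      by (rule fp.gword_eval_in_subgroup[OF h.img_is_subgroup _ u(1)])
    moreover have "g = gword_eval fp (fp_letter (factor P) (factor Q)) u"
      unfolding u(2) fp_altdef by (rule pres_class_eval[OF u(1)])
    ultimately show "g \<in> \<Phi> ` carrier ?B" by simp
  qed
  then have "\<Phi> ` carrier ?B = carrier fp" using h.hom_closed by blast
  then have "\<Phi> \<in> iso ?B fp" using hom inj by (simp add: iso_def bij_betw_def)
  then have "?B \<cong> fp" by (rule is_isoI)
  moreover have "group (factor P)" "group (factor Q)" using group_factor P_sub Q_sub by auto
  moreover have "\<not> trivial_group (factor P)" "\<not> trivial_group (factor Q)"
    using factor_nontrivial P_sub Q_sub PQ by auto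
  ultimately show ?thesis unfolding splits_as_free_product_def by blast
qed

end

end

text \<open>The sides are one component of the complement of \<open>t\<close> and the union of all
  others, each with \<open>t\<close> added.\<close>

lemma cut_vertex_imp_splits:
  assumes G: "pair_graph G" and cut: "cut_vertex G t"
  shows "splits_as_free_product (bestvina_brady G)"
proof -
  note arcs = pair_graph_arcs[OF G]
  let ?V = "pverts G - {t}"
  let ?Q = "full_subgraph G ?V"
  have t: "t \<in> pverts G" and ne: "?V \<noteq> {}" and nc: "\<not> graph_connected ?Q" using cut by (auto simp: cut_vertex_def)
  have sym: "sym (parcs ?Q)" and sub: "parcs ?Q \<subseteq> pverts ?Q \<times> pverts ?Q"
    using arcs by (auto simp: full_subgraph_def sym_def)
  have V: "pverts ?Q = ?V" by (simp add: full_subgraph_def)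
  obtain x y where xy: "x \<in> ?V" "y \<in> ?V" "(x, y) \<notin> (parcs ?Q)\<^sup>*"
    using nc ne unfolding graph_connected_iff[OF sym sub] V by blast
  define C where "C = {z \<in> ?V. (x, z) \<in> (parcs ?Q)\<^sup>*}"
  have step: "a \<in> C \<longleftrightarrow> b \<in> C" if ab: "(a, b) \<in> parcs G" "a \<noteq> t" "b \<noteq> t" for a b
  proof -
    have "(a, b) \<in> parcs ?Q" "(b, a) \<in> parcs ?Q" "a \<in> ?V" "b \<in> ?V"
      using ab arcs[OF ab(1)] by (auto simp: full_subgraph_def)
    then show ?thesis unfolding C_def by (auto intro: rtrancl_into_rtrancl)
  qed
  show ?thesis
  proof (rule bestvina_brady_splits[OF t, of "insert t C" "insert t (?V - C)"])
    show "insert t C \<union> insert t (?V - C) = pverts G" using t by (auto simp: C_def)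
    show "insert t C \<inter> insert t (?V - C) = {t}" by auto
    show "insert t C \<noteq> {t}" using xy by (auto simp: C_def)
    show "insert t (?V - C) \<noteq> {t}" using xy by (auto simp: C_def)
    show "a \<in> insert t C \<and> b \<in> insert t C \<or> a \<in> insert t (?V - C) \<and> b \<in> insert t (?V - C)"
      if "(a, b) \<in> parcs G" for a b
      using step[OF that] arcs[OF that] by (auto simp: C_def)
  qed
qed

section \<open>The equivalences\<close>

lemma trivial_bestvina_brady:
  assumes G: "pair_graph G" and conn: "graph_connected G" and card: "card (pverts G) \<le> 1"
  shows "carrier (bestvina_brady G) = {\<one>\<^bsub>bestvina_brady G\<^esub>}"
proof -
  note arcs = pair_graph_arcs[OF G]
  interpret pair_graph G by fact
  have "sym (parcs G)" "parcs G \<subseteq> pverts G \<times> pverts G" using arcs by (auto simp: sym_def)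
  then have conn': "pverts G \<noteq> {}" "\<And>v w. v \<in> pverts G \<Longrightarrow> w \<in> pverts G \<Longrightarrow> (v, w) \<in> (parcs G)\<^sup>*"
    using conn by (auto simp: graph_connected_iff)
  have "x = y" if "x \<in> pverts G" "y \<in> pverts G" for x y
    using that card pair_finite_verts by (metis card_le_Suc0_iff_eq One_nat_def)
  then have "parcs G = {}" using arcs by fastforce
  moreover have "finite_generating_set (bestvina_brady G) (bb_edge G ` parcs G)"
    by (intro finite_generating_set_bb G conn')
  ultimately show ?thesis
    using group.generate_empty[OF group_bestvina_brady[of G]] by (simp add: finite_generating_set_def)
qed

lemma bestvina_brady_character:
  assumes G: "pair_graph G" and e: "(v, w) \<in> parcs G"
  shows "\<exists>chi\<in>hom (bestvina_brady G) real_additive_group. \<exists>g\<in>carrier (bestvina_brady G). chi g \<noteq> 0"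
proof -
  note arcs = pair_graph_arcs[OF G e]
  obtain \<phi> where \<phi>: "\<phi> \<in> hom (raag G) integer_group"
    "\<And>x. x \<in> pverts G \<Longrightarrow> \<phi> (raag_gen G x) = (if x = v then 1 else 0)"
    using raag_character[of G "\<lambda>x. if x = v then 1 else 0"] by blast
  have "(\<lambda>g. real_of_int (\<phi> g)) \<in> hom (bestvina_brady G) real_additive_group"
    using bb_hom[OF \<phi>(1)] by (simp add: hom_def real_additive_group_def)
  moreover have "\<phi> (bb_edge G (v, w)) = 1"
    using raag_hom_bb_edge[OF \<phi>(1) arcs(3,4)] \<phi>(2) arcs by simp
  moreover have "bb_edge G (v, w) \<in> carrier (bestvina_brady G)"
    using bb_edge_closed[OF arcs(3,4)] by simp
  ultimately show ?thesis by (intro bexI[of _ "\<lambda>g. real_of_int (\<phi> g)"] bexI[of _ "bb_edge G (v, w)"]) simp_all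
qed

text \<open>The bounds single out the exceptional biconnected graphs: one vertex gives the trivial
  group, without characters, and one edge gives an infinite cyclic group, with two ends. The
  implications close up as biconnected, fibering, nonempty invariant, no free splitting,
  biconnected; one-endedness is attached between the first and the fourth.\<close>

theorem corollary4p21:
  fixes \<Gamma> :: "'a pair_pre_digraph"
  assumes "pair_graph \<Gamma>"
    and "graph_connected \<Gamma>"
    and "simply_connected (geometric_realization (flag_complex \<Gamma>))"
  shows "(biconnected \<Gamma> \<longleftrightarrow> \<not> splits_as_free_product (bestvina_brady \<Gamma>)) \<and>
    (card (pverts \<Gamma>) \<ge> 2 \<longrightarrow>
       (biconnected \<Gamma> \<longleftrightarrow> BNS_invariant (bestvina_brady \<Gamma>) \<noteq> {}) \<and>
       (biconnected \<Gamma> \<longleftrightarrow> algebraically_fibers (bestvina_brady \<Gamma>))) \<and>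
    (card (pverts \<Gamma>) \<ge> 3 \<longrightarrow>
       (biconnected \<Gamma> \<longleftrightarrow> one_ended (bestvina_brady \<Gamma>)))"
proof -
  let ?B = "bestvina_brady \<Gamma>"
  note arcs = pair_graph_arcs[OF assms(1)]
  have "sym (parcs \<Gamma>)" "parcs \<Gamma> \<subseteq> pverts \<Gamma> \<times> pverts \<Gamma>" using arcs by (auto simp: sym_def)
  then have conn: "\<And>v w. v \<in> pverts \<Gamma> \<Longrightarrow> w \<in> pverts \<Gamma> \<Longrightarrow> (v, w) \<in> (parcs \<Gamma>)\<^sup>*"
    using assms(2) by (auto simp: graph_connected_iff)
  have link: "(b, a) \<in> (parcs \<Gamma> \<inter> {x. (v, x) \<in> parcs \<Gamma>} \<times> {x. (v, x) \<in> parcs \<Gamma>})\<^sup>*"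
    if "biconnected \<Gamma>" "(v, a) \<in> parcs \<Gamma>" "(v, b) \<in> parcs \<Gamma>" for v a b
    using link_connected[OF assms(1,3) _ that(2,3)] that(1) by (simp add: biconnected_def)
  have splitting: "\<exists>A B E. free_splitting ?B A B E" if "splits_as_free_product ?B"
    using splits_as_free_product_imp_free_splitting[OF group_bestvina_brady that] .
  have cut_splits: "splits_as_free_product ?B" if "\<not> biconnected \<Gamma>"
    using that cut_vertex_imp_splits[OF assms(1)] by (auto simp: biconnected_def)
  have split_BNS: "BNS_invariant ?B = {}" if "splits_as_free_product ?B"
    using splitting[OF that] free_splitting.BNS_invariant_empty by blast
  have fibers_BNS: "BNS_invariant ?B \<noteq> {}" if "algebraically_fibers ?B"
    using algebraically_fibers_imp_BNS_invariant[OF group_bestvina_brady that] .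
  have fibers: "algebraically_fibers ?B" if "biconnected \<Gamma>" "card (pverts \<Gamma>) \<ge> 2"
    using bestvina_brady_fibers[OF assms(1)] conn link[OF that(1)] that(2) by blast
  have ends: "one_ended ?B" if "biconnected \<Gamma>" "card (pverts \<Gamma>) \<ge> 3"
    using bestvina_brady_one_ended[OF assms(1)] conn link[OF that(1)] that(2) by blast
  \<comment> \<open>An edge supplies the nonzero character that shows both sides of the splitting to
    be infinite.\<close>
  have split_ends: "\<not> one_ended ?B" if split: "splits_as_free_product ?B" and card: "card (pverts \<Gamma>) \<ge> 2"
  proof
    assume "one_ended ?B"
    then obtain S where S: "finite_generating_set ?B S" "graph_ends (cayley_graph ?B S) = 1"
      unfolding one_ended_def by blast
    obtain A B E where "free_splitting ?B A B E" using splitting[OF split] by blast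
    then interpret F: free_splitting ?B A B E .
    have "parcs \<Gamma> \<noteq> {}" using conn card by (rule arcs_nonempty)
    then obtain v w where "(v, w) \<in> parcs \<Gamma>" by auto
    then obtain chi where "chi \<in> hom ?B real_additive_group" "\<exists>g\<in>carrier ?B. chi g \<noteq> 0"
      using bestvina_brady_character[OF assms(1)] by blast
    then show False using F.graph_ends_neq_1[OF S(1)] S(2) by blast
  qed
  \<comment> \<open>The graph is a single vertex here and its group is trivial, which leaves no room
    for a nontrivial factor.\<close>
  have small: "biconnected \<Gamma> \<and> \<not> splits_as_free_product ?B" if card: "\<not> card (pverts \<Gamma>) \<ge> 2"
  proof
    have fin: "finite (pverts \<Gamma>)" and card1: "card (pverts \<Gamma>) \<le> 1"
      using assms(1) card by (auto simp: pair_graph_def pair_digraph_def pair_fin_digraph_def pair_fin_digraph_axioms_def)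
    show "biconnected \<Gamma>"
    proof -
      have "pverts \<Gamma> - {v} = {}" if "v \<in> pverts \<Gamma>" for v
        using fin card1 that by (metis Diff_eq_empty_iff One_nat_def card_le_Suc0_iff_eq insertCI singletonI subsetI)
      then show ?thesis by (auto simp: biconnected_def cut_vertex_def)
    qed
    show "\<not> splits_as_free_product ?B"
    proof
      assume "splits_as_free_product ?B"
      then obtain A B E where "free_splitting ?B A B E" using splitting by blast
      then interpret F: free_splitting ?B A B E .
      have "A \<subseteq> {\<one>\<^bsub>?B\<^esub>}"
        using subgroup.subset[OF F.subgroup_A] trivial_bestvina_brady[OF assms(1,2) card1] by simp
      then show False using F.A_nontrivial subgroup.one_closed[OF F.subgroup_A] by blast
    qed
  qed
  have "biconnected \<Gamma> \<longleftrightarrow> \<not> splits_as_free_product ?B"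
    using small cut_splits split_BNS fibers_BNS fibers by (cases "card (pverts \<Gamma>) \<ge> 2") blast+
  moreover have "biconnected \<Gamma> \<longleftrightarrow> BNS_invariant ?B \<noteq> {}" "biconnected \<Gamma> \<longleftrightarrow> algebraically_fibers ?B"
    if "card (pverts \<Gamma>) \<ge> 2"
    using cut_splits split_BNS fibers_BNS fibers that by blast+
  moreover have "biconnected \<Gamma> \<longleftrightarrow> one_ended ?B" if "card (pverts \<Gamma>) \<ge> 3"
  proof
    assume "one_ended ?B"
    then show "biconnected \<Gamma>" using split_ends cut_splits that by fastforce
  qed (use ends that in blast)
  ultimately show ?thesis by blast
qed

end
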